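(* Let $\overline{k}$ be an algebraically closed field of characteristic $\neq 2$, $m,n\ge 0$. Let $G$ be the split orthogonal group $O_{2m+2n+1}$, $K=O_{2m}\times O_{2n+1}\subset G$ the symmetric subgroup, and $B$ a Borel subgroup of $G$. There is a bijection between the set of minus-invariant $2m$-matchings in the corona graph $C_{2m+2n+1}$ and the set of double cosets $B(\overline{k})\backslash G(\overline{k})/K(\overline{k})$.
   Context: Here the corona graph $C_{2m+2n+1}$ has vertices $v_i,w_i$ for $i\in[-m-n,m+n]$ (integers), an edge $v_iv_j$ for each $i\ne j$ and an edge $v_iw_i$ for each $i$. A $2m$-matching is a set of $2m$ edges no two sharing a vertex. The minus involution on sets of edges is induced by the graph automorphism $v_i\leftrightarrow v_{-i}$, $w_i\leftrightarrow w_{-i}$; a matching is minus-invariant if it is fixed by it. *)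

theory Defs
  imports
    "HOL-Analysis.Abstract_Topology"
    "HOL-Algebra.Solvable_Groups"
    "HOL-Computational_Algebra.Polynomial"
    "Jordan_Normal_Form.Matrix"
begin

section \<open>Matchings in the corona graph\<close>

text \<open>\<open>Core i\<close> and \<open>Leaf i\<close> are the vertices written \<open>v\<^sub>i\<close> and \<open>w\<^sub>i\<close>. An edge is the set of
  its two end points. The graph has no isolated vertex, so its edge set determines it.\<close>

datatype corona_vertex = Core int | Leaf int

definition corona_edges :: "int set \<Rightarrow> corona_vertex set set" where
  "corona_edges I =
     {{Core i, Core j} | i j. i \<in> I \<and> j \<in> I \<and> i \<noteq> j} \<union> {{Core i, Leaf i} | i. i \<in> I}"

definition r_matching :: "nat \<Rightarrow> 'v set set \<Rightarrow> 'v set set \<Rightarrow> bool" where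
  "r_matching r E M \<longleftrightarrow> M \<subseteq> E \<and> finite M \<and> card M = r \<and> pairwise disjnt M"

fun minus_vertex :: "corona_vertex \<Rightarrow> corona_vertex" where
  "minus_vertex (Core i) = Core (- i)"
| "minus_vertex (Leaf i) = Leaf (- i)"

definition minus_edges :: "corona_vertex set set \<Rightarrow> corona_vertex set set" where
  "minus_edges M = (\<lambda>e. minus_vertex ` e) ` M"

definition minus_invariant_matchings :: "nat \<Rightarrow> nat \<Rightarrow> corona_vertex set set set" where
  "minus_invariant_matchings m n =
     {M. r_matching (2 * m) (corona_edges {- int (m + n)..int (m + n)}) M \<and> minus_edges M = M}"


section \<open>Zariski topology and Borel subgroups\<close>

text \<open>Polynomial functions in the entries of an \<open>N \<times> N\<close> matrix.\<close>

inductive_set poly_funs :: "nat \<Rightarrow> ('a :: field mat \<Rightarrow> 'a) set" for N where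
  const: "(\<lambda>_. c) \<in> poly_funs N"
| entry: "i < N \<Longrightarrow> j < N \<Longrightarrow> (\<lambda>x. x $$ (i, j)) \<in> poly_funs N"
| add: "f \<in> poly_funs N \<Longrightarrow> g \<in> poly_funs N \<Longrightarrow> (\<lambda>x. f x + g x) \<in> poly_funs N"
| mult: "f \<in> poly_funs N \<Longrightarrow> g \<in> poly_funs N \<Longrightarrow> (\<lambda>x. f x * g x) \<in> poly_funs N"

text \<open>The principal open sets \<open>{x. f x \<noteq> 0}\<close> form a basis of this topology.\<close>

definition mat_zariski :: "nat \<Rightarrow> 'a :: field mat topology" where
  "mat_zariski N = topology_generated_by {{x \<in> carrier_mat N N. f x \<noteq> 0} | f. f \<in> poly_funs N}"

text \<open>Here \<open>G\<close> is a group of \<open>N \<times> N\<close> matrices. On invertible matrices, the Zariski topology of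
  \<open>GL\<^sub>N\<close> is the one induced from the affine space of all \<open>N \<times> N\<close> matrices.\<close>

definition closed_connected_solvable :: "nat \<Rightarrow> 'a :: field mat monoid \<Rightarrow> 'a mat set \<Rightarrow> bool" where
  "closed_connected_solvable N G H \<longleftrightarrow>
     subgroup H G \<and>
     closedin (subtopology (mat_zariski N) (carrier G)) H \<and>
     connectedin (subtopology (mat_zariski N) (carrier G)) H \<and>
     solvable (G\<lparr>carrier := H\<rparr>)"

definition borel_subgroup :: "nat \<Rightarrow> 'a :: field mat monoid \<Rightarrow> 'a mat set \<Rightarrow> bool" where
  "borel_subgroup N G B \<longleftrightarrow>
     closed_connected_solvable N G B \<and>
     (\<forall>H. closed_connected_solvable N G H \<longrightarrow> B \<subseteq> H \<longrightarrow> H = B)"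


section \<open>Split orthogonal groups and double cosets\<close>

text \<open>Gram matrix of the split symmetric bilinear form: it pairs the \<open>i\<close>-th basis vector with the
  \<open>i\<close>-th last one.\<close>

definition split_gram :: "nat \<Rightarrow> 'a :: field mat" where
  "split_gram d = mat d d (\<lambda>(i, j). if i + j + 1 = d then 1 else 0)"

definition split_orthogonal :: "nat \<Rightarrow> 'a :: field mat monoid" where
  "split_orthogonal d =
     \<lparr>carrier = {g \<in> carrier_mat d d. transpose_mat g * split_gram d * g = split_gram d},
      monoid.mult = (*), one = 1\<^sub>m d\<rparr>"

text \<open>The split space of dimension \<open>2m + 2n + 1\<close> is the orthogonal sum of the span of the first
  \<open>m\<close> and last \<open>m\<close> basis vectors, which is a split space of dimension \<open>2m\<close>, and the span of the
  middle \<open>2n + 1\<close> basis vectors, which is again split. In \<open>orth_sum m n a b\<close> the matrix \<open>a\<close> acts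
  on the former and \<open>b\<close> on the latter.\<close>

definition is_inner :: "nat \<Rightarrow> nat \<Rightarrow> nat \<Rightarrow> bool" where
  "is_inner m n i \<longleftrightarrow> m \<le> i \<and> i < m + 2 * n + 1"

definition outer_pos :: "nat \<Rightarrow> nat \<Rightarrow> nat \<Rightarrow> nat" where
  "outer_pos m n i = (if i < m then i else i - (2 * n + 1))"

definition orth_sum :: "nat \<Rightarrow> nat \<Rightarrow> 'a :: field mat \<Rightarrow> 'a mat \<Rightarrow> 'a mat" where
  "orth_sum m n a b = mat (2 * m + 2 * n + 1) (2 * m + 2 * n + 1) (\<lambda>(i, j).
     if is_inner m n i \<and> is_inner m n j then b $$ (i - m, j - m)
     else if \<not> is_inner m n i \<and> \<not> is_inner m n j
       then a $$ (outer_pos m n i, outer_pos m n j)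
     else 0)"

definition split_orthogonal_product :: "nat \<Rightarrow> nat \<Rightarrow> 'a :: field mat set" where
  "split_orthogonal_product m n =
     {orth_sum m n a b | a b.
        a \<in> carrier (split_orthogonal (2 * m)) \<and> b \<in> carrier (split_orthogonal (2 * n + 1))}"

definition double_cosets :: "('g, 'r) monoid_scheme \<Rightarrow> 'g set \<Rightarrow> 'g set \<Rightarrow> 'g set set" where
  "double_cosets G H K = {(H #>\<^bsub>G\<^esub> g) <#>\<^bsub>G\<^esub> K | g. g \<in> carrier G}"


text \<open>The product subgroup is the symmetric subgroup attached to the involution of the orthogonal
  group given by conjugation with a diagonal matrix of signs.\<close>

definition sign_mat :: "nat \<Rightarrow> nat \<Rightarrow> 'a :: field mat" where
  "sign_mat m n = mat (2 * m + 2 * n + 1) (2 * m + 2 * n + 1) (\<lambda>(i, j).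
     if i \<noteq> j then 0 else if is_inner m n i then 1 else - 1)"

lemma sum_outer_inner:
  fixes f :: "nat \<Rightarrow> 'a :: field"
  shows "(\<Sum>k<2 * m + 2 * n + 1. f k) =
    (\<Sum>k<2 * m. f (if k < m then k else k + (2 * n + 1))) + (\<Sum>k<2 * n + 1. f (k + m))"
proof -
  have split: "(\<Sum>k<p + q. g k) = (\<Sum>k<p. g k) + (\<Sum>k<q. g (k + p))" for p q and g :: "nat \<Rightarrow> 'a"
    by (induction q) (simp_all add: algebra_simps)
  have "(\<Sum>k<2 * m + 2 * n + 1. f k) = (\<Sum>k<m + ((2 * n + 1) + m). f k)"
    by (rule arg_cong[where f = "\<lambda>N. sum f {..<N}"]) simp
  also have "\<dots> = (\<Sum>k<m. f k) + ((\<Sum>k<2 * n + 1. f (k + m)) + (\<Sum>k<m. f (k + (2 * n + 1) + m)))"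
    by (simp only: split)
  finally have A: "(\<Sum>k<2 * m + 2 * n + 1. f k) =
    (\<Sum>k<m. f k) + ((\<Sum>k<2 * n + 1. f (k + m)) + (\<Sum>k<m. f (k + (2 * n + 1) + m)))" .
  have "(\<Sum>k<2 * m. f (if k < m then k else k + (2 * n + 1))) =
    (\<Sum>k<m + m. f (if k < m then k else k + (2 * n + 1)))"
    by (simp only: mult_2)
  also have "\<dots> = (\<Sum>k<m. f (if k < m then k else k + (2 * n + 1))) +
      (\<Sum>k<m. f (if k + m < m then k + m else k + m + (2 * n + 1)))"
    by (rule split)
  also have "(\<Sum>k<m. f (if k < m then k else k + (2 * n + 1))) = (\<Sum>k<m. f k)"
    by (rule sum.cong) simp_all
  also have "(\<Sum>k<m. f (if k + m < m then k + m else k + m + (2 * n + 1))) =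
      (\<Sum>k<m. f (k + (2 * n + 1) + m))"
    by (rule sum.cong) (simp_all add: add.assoc add.commute[of m])
  finally show ?thesis unfolding A by (simp only: add.assoc add.commute add.left_commute)
qed

lemma orth_sum_carrier [simp]: "orth_sum m n a b \<in> carrier_mat (2 * m + 2 * n + 1) (2 * m + 2 * n + 1)"
  by (simp add: orth_sum_def)

lemma orth_sum_mult:
  assumes "a \<in> carrier_mat (2 * m) (2 * m)" "c \<in> carrier_mat (2 * m) (2 * m)"
    and "b \<in> carrier_mat (2 * n + 1) (2 * n + 1)" "d \<in> carrier_mat (2 * n + 1) (2 * n + 1)"
  shows "orth_sum m n a b * orth_sum m n c d = orth_sum m n (a * c) (b * d)"
proof (rule eq_matI)
  let ?N = "2 * m + 2 * n + 1"
  fix i j assume "i < dim_row (orth_sum m n (a * c) (b * d))" "j < dim_col (orth_sum m n (a * c) (b * d))"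
  hence ij: "i < ?N" "j < ?N" by (auto simp: orth_sum_def)
  have "(orth_sum m n a b * orth_sum m n c d) $$ (i, j) =
      (\<Sum>k<?N. orth_sum m n a b $$ (i, k) * orth_sum m n c d $$ (k, j))"
    using ij by (simp add: orth_sum_def scalar_prod_def lessThan_atLeast0)
  also have "\<dots> = (\<Sum>k<2 * m. (if is_inner m n i then 0 else a $$ (outer_pos m n i, k)) *
                            (if is_inner m n j then 0 else c $$ (k, outer_pos m n j))) +
      (\<Sum>k<2 * n + 1. (if is_inner m n i then b $$ (i - m, k) else 0) *
                       (if is_inner m n j then d $$ (k, j - m) else 0))"
    unfolding sum_outer_inner
    by (intro arg_cong2[where f = "(+)"] sum.cong refl)
      (use ij in \<open>auto simp: orth_sum_def is_inner_def outer_pos_def\<close>)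
  also have "\<dots> = orth_sum m n (a * c) (b * d) $$ (i, j)"
  proof -
    have "outer_pos m n i < 2 * m" if "\<not> is_inner m n i" "i < ?N" for i
      using that by (auto simp: is_inner_def outer_pos_def)
    moreover have "i - m < 2 * n + 1" if "is_inner m n i" for i
      using that by (auto simp: is_inner_def)
    ultimately show ?thesis
      using ij assms by (auto simp: orth_sum_def scalar_prod_def lessThan_atLeast0 intro!: sum.cong)
  qed
  finally show "(orth_sum m n a b * orth_sum m n c d) $$ (i, j) = orth_sum m n (a * c) (b * d) $$ (i, j)" .
qed (auto simp: orth_sum_def)

lemma orth_sum_transpose:
  assumes "a \<in> carrier_mat (2 * m) (2 * m)" "b \<in> carrier_mat (2 * n + 1) (2 * n + 1)"
  shows "transpose_mat (orth_sum m n a b) = orth_sum m n (transpose_mat a) (transpose_mat b)"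
  by (rule eq_matI) (use assms in \<open>auto simp: orth_sum_def is_inner_def outer_pos_def\<close>)

lemma orth_sum_gram: "orth_sum m n (split_gram (2 * m)) (split_gram (2 * n + 1)) =
    split_gram (2 * m + 2 * n + 1)"
  by (rule eq_matI) (auto simp: orth_sum_def split_gram_def is_inner_def outer_pos_def)

lemma orth_sum_inject:
  assumes "a \<in> carrier_mat (2 * m) (2 * m)" "c \<in> carrier_mat (2 * m) (2 * m)"
    and "b \<in> carrier_mat (2 * n + 1) (2 * n + 1)" "d \<in> carrier_mat (2 * n + 1) (2 * n + 1)"
    and eq: "orth_sum m n a b = orth_sum m n c d"
  shows "a = c" "b = d"
proof -
  let ?o = "\<lambda>k. if k < m then k else k + (2 * n + 1)"
  have "a $$ (i, j) = c $$ (i, j)" if "i < 2 * m" "j < 2 * m" for i j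
    using arg_cong[OF eq, of "\<lambda>x. x $$ (?o i, ?o j)"] that
    by (auto simp: orth_sum_def is_inner_def outer_pos_def split: if_splits)
  thus "a = c" using assms by (intro eq_matI) auto
  have "b $$ (i, j) = d $$ (i, j)" if "i < 2 * n + 1" "j < 2 * n + 1" for i j
    using arg_cong[OF eq, of "\<lambda>x. x $$ (i + m, j + m)"] that
    by (auto simp: orth_sum_def is_inner_def)
  thus "b = d" using assms by (intro eq_matI) auto
qed

lemma orth_sum_mem_iff:
  assumes a: "a \<in> carrier_mat (2 * m) (2 * m)" and b: "b \<in> carrier_mat (2 * n + 1) (2 * n + 1)"
  shows "orth_sum m n a b \<in> carrier (split_orthogonal (2 * m + 2 * n + 1)) \<longleftrightarrow>
    a \<in> carrier (split_orthogonal (2 * m)) \<and> b \<in> carrier (split_orthogonal (2 * n + 1))"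
proof -
  let ?J = "split_gram (2 * m)" and ?L = "split_gram (2 * n + 1)"
  have J: "?J \<in> carrier_mat (2 * m) (2 * m)" "?L \<in> carrier_mat (2 * n + 1) (2 * n + 1)"
    by (auto simp: split_gram_def)
  have tr: "transpose_mat a \<in> carrier_mat (2 * m) (2 * m)"
    "transpose_mat b \<in> carrier_mat (2 * n + 1) (2 * n + 1)"
    using a b by auto
  have "transpose_mat (orth_sum m n a b) * split_gram (2 * m + 2 * n + 1) * orth_sum m n a b =
      orth_sum m n (transpose_mat a * ?J * a) (transpose_mat b * ?L * b)"
    unfolding orth_sum_gram[symmetric] orth_sum_transpose[OF a b]
    by (simp only: orth_sum_mult J tr a b mult_carrier_mat[OF tr(1) J(1)] mult_carrier_mat[OF tr(2) J(2)])
  moreover have "orth_sum m n (transpose_mat a * ?J * a) (transpose_mat b * ?L * b) =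
      split_gram (2 * m + 2 * n + 1) \<longleftrightarrow>
      transpose_mat a * ?J * a = ?J \<and> transpose_mat b * ?L * b = ?L"
    unfolding orth_sum_gram[symmetric]
  proof (intro iffI)
    assume eq: "orth_sum m n (transpose_mat a * ?J * a) (transpose_mat b * ?L * b) = orth_sum m n ?J ?L"
    have "transpose_mat a * ?J * a \<in> carrier_mat (2 * m) (2 * m)"
      "transpose_mat b * ?L * b \<in> carrier_mat (2 * n + 1) (2 * n + 1)"
      using mult_carrier_mat[OF mult_carrier_mat[OF tr(1) J(1)] a]
        mult_carrier_mat[OF mult_carrier_mat[OF tr(2) J(2)] b] by simp_all
    from orth_sum_inject[OF this(1) J(1) this(2) J(2) eq]
    show "transpose_mat a * ?J * a = ?J \<and> transpose_mat b * ?L * b = ?L" ..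
  qed (simp only:)
  ultimately show ?thesis
    using a b by (simp only: split_orthogonal_def partial_object.simps mem_Collect_eq orth_sum_carrier simp_thms)
qed

lemma diag_conj_index:
  fixes g :: "'a :: field mat" and s :: "nat \<Rightarrow> 'a"
  assumes g: "g \<in> carrier_mat N N" and ij: "i < N" "j < N"
  defines "D \<equiv> mat N N (\<lambda>(i, j). if i \<noteq> j then 0 else s i)"
  shows "(D * g * D) $$ (i, j) = s i * g $$ (i, j) * s j"
proof -
  have D: "D \<in> carrier_mat N N" by (simp add: D_def)
  have Dg: "(D * g) $$ (i, k) = s i * g $$ (i, k)" if "k < N" for k
  proof -
    have "(D * g) $$ (i, k) = (\<Sum>l = 0..<N. D $$ (i, l) * g $$ (l, k))"
      using g D ij that by (simp add: scalar_prod_def)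
    also have "\<dots> = (\<Sum>l = 0..<N. if l = i then s i * g $$ (i, k) else 0)"
      by (rule sum.cong) (use ij in \<open>auto simp: D_def\<close>)
    finally show ?thesis using ij by simp
  qed
  have "(D * g * D) $$ (i, j) = (\<Sum>l = 0..<N. (D * g) $$ (i, l) * D $$ (l, j))"
    using g D ij by (simp add: scalar_prod_def del: assoc_mult_mat)
  also have "\<dots> = (\<Sum>l = 0..<N. if l = j then s i * g $$ (i, j) * s j else 0)"
  proof (rule sum.cong)
    fix l assume "l \<in> {0..<N}"
    hence l: "l < N" by simp
    show "(D * g) $$ (i, l) * D $$ (l, j) = (if l = j then s i * g $$ (i, j) * s j else 0)"
      unfolding Dg[OF l] using l ij by (simp add: D_def)
  qed simp
  finally show ?thesis using ij by simp
qed

lemma split_orthogonal_product_symmetric: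
  assumes "(2 :: 'a :: field) \<noteq> 0"
  shows "(split_orthogonal_product m n :: 'a mat set) =
    {g \<in> carrier (split_orthogonal (2 * m + 2 * n + 1)). sign_mat m n * g * sign_mat m n = g}"
proof -
  let ?N = "2 * m + 2 * n + 1"
  let ?s = "\<lambda>i. if is_inner m n i then 1 else - 1 :: 'a"
  let ?o = "\<lambda>k. if k < m then k else k + (2 * n + 1)"
  have conj: "(sign_mat m n * g * sign_mat m n) $$ (i, j) = ?s i * g $$ (i, j) * ?s j"
    if "g \<in> carrier_mat ?N ?N" "i < ?N" "j < ?N" for g :: "'a mat" and i j
    unfolding sign_mat_def by (rule diag_conj_index[OF that])
  show ?thesis
  proof (intro equalityI subsetI)
    fix g :: "'a mat" assume "g \<in> split_orthogonal_product m n"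
    then obtain a b where g: "g = orth_sum m n a b"
      and ab: "a \<in> carrier (split_orthogonal (2 * m))" "b \<in> carrier (split_orthogonal (2 * n + 1))"
      by (auto simp: split_orthogonal_product_def)
    have "g \<in> carrier (split_orthogonal ?N)"
      using ab orth_sum_mem_iff[of a m b n] by (auto simp: g split_orthogonal_def)
    moreover have "sign_mat m n * g * sign_mat m n = g"
    proof (rule eq_matI)
      fix i j assume "i < dim_row g" "j < dim_col g"
      hence ij: "i < ?N" "j < ?N" by (simp_all add: g orth_sum_def)
      have "?s i * g $$ (i, j) * ?s j = g $$ (i, j)"
        using ij by (simp add: g orth_sum_def)
      thus "(sign_mat m n * g * sign_mat m n) $$ (i, j) = g $$ (i, j)"
        using conj[of g i j] ij by (simp only: g orth_sum_carrier)
    qed (simp_all add: sign_mat_def g orth_sum_def)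
    ultimately show "g \<in> {g \<in> carrier (split_orthogonal ?N). sign_mat m n * g * sign_mat m n = g}"
      by simp
  next
    fix g :: "'a mat"
    assume g: "g \<in> {g \<in> carrier (split_orthogonal ?N). sign_mat m n * g * sign_mat m n = g}"
    hence gc: "g \<in> carrier_mat ?N ?N" by (simp add: split_orthogonal_def)
    have off: "g $$ (i, j) = 0"
      if "i < ?N" "j < ?N" "is_inner m n i \<noteq> is_inner m n j" for i j
    proof -
      have "- g $$ (i, j) = g $$ (i, j)"
        using conj[OF gc, of i j] g that by (auto split: if_splits)
      hence "g $$ (i, j) = - g $$ (i, j)" by (rule sym)
      hence "g $$ (i, j) + g $$ (i, j) = 0" by (simp only: eq_neg_iff_add_eq_0)
      hence "2 * g $$ (i, j) = 0" by (simp only: mult_2)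
      thus ?thesis using assms by simp
    qed
    define a where "a = mat (2 * m) (2 * m) (\<lambda>(i, j). g $$ (?o i, ?o j))"
    define b where "b = mat (2 * n + 1) (2 * n + 1) (\<lambda>(i, j). g $$ (i + m, j + m))"
    have ab: "a \<in> carrier_mat (2 * m) (2 * m)" "b \<in> carrier_mat (2 * n + 1) (2 * n + 1)"
      by (simp_all add: a_def b_def)
    have g_eq: "g = orth_sum m n a b"
    proof (rule eq_matI)
      fix i j assume "i < dim_row (orth_sum m n a b)" "j < dim_col (orth_sum m n a b)"
      hence ij: "i < ?N" "j < ?N" by (simp_all add: orth_sum_def)
      have in_pos: "k - m < 2 * n + 1" "k - m + m = k" if "is_inner m n k" for k
        using that by (auto simp: is_inner_def)
      have out_pos: "outer_pos m n k < 2 * m" "?o (outer_pos m n k) = k"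
        if "\<not> is_inner m n k" "k < ?N" for k
        using that by (auto simp: is_inner_def outer_pos_def)
      consider "is_inner m n i" "is_inner m n j" | "\<not> is_inner m n i" "\<not> is_inner m n j"
        | "is_inner m n i \<noteq> is_inner m n j" by blast
      thus "g $$ (i, j) = orth_sum m n a b $$ (i, j)"
      proof cases
        case 1
        thus ?thesis using ij in_pos[of i] in_pos[of j] by (simp add: orth_sum_def b_def)
      next
        case 2
        have "a $$ (outer_pos m n i, outer_pos m n j) = g $$ (i, j)"
          by (simp only: a_def index_mat(1) prod.case out_pos[OF 2(1) ij(1)] out_pos[OF 2(2) ij(2)])
        thus ?thesis using ij 2 by (simp add: orth_sum_def)
      next
        case 3
        thus ?thesis using ij off[of i j] by (auto simp: orth_sum_def)
      qed
    qed (use gc in \<open>simp_all add: orth_sum_def\<close>)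
    have "orth_sum m n a b \<in> carrier (split_orthogonal ?N)"
      using g unfolding g_eq by blast
    hence "a \<in> carrier (split_orthogonal (2 * m)) \<and> b \<in> carrier (split_orthogonal (2 * n + 1))"
      unfolding orth_sum_mem_iff[OF ab] .
    thus "g \<in> split_orthogonal_product m n"
      unfolding split_orthogonal_product_def using g_eq by blast
  qed
qed

end

theory Submission
  imports Defs "Jordan_Normal_Form.Char_Poly" "HOL-Library.Function_Algebras"
begin

text \<open>Conjugating the diagonal sign matrix identifies \<open>G/K\<close> with the involutions in the orthogonal
  group whose \<open>-1\<close>-eigenspace has dimension \<open>2m\<close>, so double cosets are the conjugacy classes of
  these involutions under a Borel subgroup. By the Lie--Kolchin theorem a Borel subgroup is conjugate
  to the group of orthogonal upper triangular matrices with middle entry \<open>1\<close>. Given an involution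
  \<open>s\<close>, the standard isotropic flag has an adapted basis, indexed by the integers from \<open>-(m + n)\<close> to
  \<open>m + n\<close> and with the \<open>i\<close>-th vector dual to the \<open>-i\<close>-th, which \<open>s\<close> permutes up to signs at the fixed
  points: split off the \<open>s\<close>-stable nondegenerate span of the first basis vector \<open>p\<close>, of \<open>s p\<close> and of
  suitable dual vectors, and use induction. The permutation and the set of minus signs are unique;
  they are recorded by the core edges and the leaf edges of a minus-invariant matching, and the number
  of edges is the dimension of the \<open>-1\<close>-eigenspace. Conversely, since the field is algebraically closed, two involutive isometries are
  conjugate in the orthogonal group as soon as they have equal eigenvalue multiplicities.\<close>

section \<open>Frames adapted to a flag and an involution\<close>

text \<open>A connected group \<open>B\<close> has to be matched with groups that are not connected.
  On the side of \<open>B\<close>, the normal form is found inside the full stabilizer of the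
  standard flag, which exceeds \<open>std_borel\<close> only by the central element -1; changing the
  sign of a conjugating matrix does not change the conjugated involution. On the other side,
  \<open>K\<close> is built from full orthogonal groups, so it is the full centralizer of the sign
  matrix, and conjugacy of involutions can be settled in the orthogonal group without control over
  determinants.

  In triangularizing \<open>B\<close> the obstacle is that a common eigenvector may be anisotropic,
  whereas a flag compatible with the form needs an isotropic one. Connectedness resolves this. It
  acts through one fact: a polynomial function with finitely many values on a connected set is
  constant there. This makes weight spaces stable, fixes anisotropic eigenvectors, and forces middle
  entry 1 in the triangularized group.\<close>

locale quadratic_space = vector_space scale
  for scale :: "'a :: alg_closed_field \<Rightarrow> 'v :: ab_group_add \<Rightarrow> 'v" (infixr \<open>*s\<close> 75) +
  fixes \<beta> :: "'v \<Rightarrow> 'v \<Rightarrow> 'a"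
  assumes form_add: "\<beta> (x + y) z = \<beta> x z + \<beta> y z"
    and form_scale: "\<beta> (c *s x) z = c * \<beta> x z"
    and form_sym: "\<beta> x y = \<beta> y x"
    and two_nz: "(2 :: 'a) \<noteq> 0"
begin

lemma form_add_right: "\<beta> z (x + y) = \<beta> z x + \<beta> z y"
  by (metis form_add form_sym)

lemma form_scale_right: "\<beta> z (c *s x) = c * \<beta> z x"
  by (metis form_scale form_sym)

lemma form_zero [simp]: "\<beta> 0 z = 0" "\<beta> z 0 = 0"
  using form_scale[of 0 0 z] form_scale_right[of z 0 0] by simp_all

lemma form_minus: "\<beta> (- x) z = - \<beta> x z" "\<beta> z (- x) = - \<beta> z x"
  using form_add[of x "- x" z] form_add_right[of z x "- x"] by (simp_all add: eq_neg_iff_add_eq_0 add.commute)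

lemma form_diff: "\<beta> (x - y) z = \<beta> x z - \<beta> y z" "\<beta> z (x - y) = \<beta> z x - \<beta> z y"
  using form_add[of x "- y" z] form_add_right[of z x "- y"] by (simp_all add: form_minus)

lemmas form_simps = form_add form_add_right form_scale form_scale_right form_minus form_diff

lemma form_sum: "\<beta> (\<Sum>i\<in>A. f i) z = (\<Sum>i\<in>A. \<beta> (f i) z)"
  by (induction A rule: infinite_finite_induct) (simp_all add: form_add)

lemma form_sum_right: "\<beta> z (\<Sum>i\<in>A. f i) = (\<Sum>i\<in>A. \<beta> z (f i))"
  by (induction A rule: infinite_finite_induct) (simp_all add: form_add_right)

lemma form_span_zero: "x \<in> span S \<Longrightarrow> (\<And>y. y \<in> S \<Longrightarrow> \<beta> y z = 0) \<Longrightarrow> \<beta> x z = 0"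
  by (induction rule: span_induct_alt) (simp_all add: form_simps)

lemma subspace_orthogonal: "subspace {x. \<beta> x z = 0}"
  by (auto simp: subspace_def form_simps)

lemma sqrt_exists: "\<exists>y. y * y = (x :: 'a)"
  using nth_root_exists[of 2 x] by (auto simp: power2_eq_square)

text \<open>If \<open>x\<close> and \<open>y\<close> are isotropic, the norm of \<open>x + y\<close>
  is twice their product, which is non-zero because 2 is invertible. This supplies the anisotropic
  vector on which each Gram-Schmidt step depends.\<close>

lemma isotropic_polarization:
  assumes "\<beta> x y \<noteq> 0"
  shows "\<beta> x x \<noteq> 0 \<or> \<beta> y y \<noteq> 0 \<or> \<beta> (x + y) (x + y) \<noteq> 0"
proof -
  have "\<beta> (x + y) (x + y) = \<beta> x x + \<beta> y y + 2 * \<beta> x y"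
    by (simp add: form_simps form_sym[of y x])
  thus ?thesis using assms two_nz by auto
qed

end

locale involutive_isometry = quadratic_space +
  fixes s :: "'b \<Rightarrow> 'b"
  assumes s_add: "s (x + y) = s x + s y"
    and s_scale: "s (c *s x) = c *s s x"
    and s_invol: "s (s x) = x"
    and s_form: "\<beta> (s x) (s y) = \<beta> x y"
begin

lemma s_zero [simp]: "s 0 = 0"
  using s_scale[of 0 0] by simp

lemma s_minus: "s (- x) = - s x"
  using s_add[of x "- x"] by (simp add: eq_neg_iff_add_eq_0 add.commute)

lemma s_diff: "s (x - y) = s x - s y"
  using s_add[of x "- y"] by (simp add: s_minus)

lemmas s_simps = s_add s_scale s_minus s_diff s_invol

lemma s_adjoint: "\<beta> (s x) y = \<beta> x (s y)"
  by (metis s_form s_invol)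

lemma s_span: "x \<in> span S \<Longrightarrow> (\<And>y. y \<in> S \<Longrightarrow> s y \<in> span T) \<Longrightarrow> s x \<in> span T"
  by (induction rule: span_induct_alt) (auto simp: s_simps span_add span_scale span_zero)

text \<open>The dual vectors of a weak frame are only triangular with respect to each other. This is what
  survives when a block is split off, so no orthogonalization is needed before the induction.\<close>

definition weak_frame :: "int set \<Rightarrow> (int \<Rightarrow> 'b) \<Rightarrow> bool" where
  "weak_frame I e \<longleftrightarrow> finite I \<and> (\<forall>i\<in>I. - i \<in> I) \<and> (\<forall>i\<in>I. \<forall>j\<in>I. i + j < 0 \<longrightarrow> \<beta> (e i) (e j) = 0) \<and>
    (\<forall>i\<in>I. \<beta> (e i) (e (- i)) \<noteq> 0)"

definition flag :: "int set \<Rightarrow> (int \<Rightarrow> 'b) \<Rightarrow> int \<Rightarrow> 'b set" where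
  "flag I e i = span (e ` {k \<in> I. k \<le> i})"

text \<open>A sign on a 2-cycle of \<open>w\<close> can be absorbed by rescaling the two vectors, so
  only fixed points carry an invariant sign and \<open>\<epsilon>\<close> is 1 elsewhere.
  Compatibility with negation reflects that \<open>s\<close> is an isometry: a dual vector moves
  along with its partner.\<close>

definition normal_frame ::
    "int set \<Rightarrow> (int \<Rightarrow> 'b) \<Rightarrow> (int \<Rightarrow> int) \<Rightarrow> (int \<Rightarrow> 'a) \<Rightarrow> bool" where
  "normal_frame D u w \<epsilon> \<longleftrightarrow>
     (\<forall>i\<in>D. w i \<in> D \<and> w (w i) = i \<and> w (- i) = - w i \<and> (\<epsilon> i = 1 \<or> \<epsilon> i = - 1) \<and>
        \<epsilon> (- i) = \<epsilon> i \<and> (w i \<noteq> i \<longrightarrow> \<epsilon> i = 1) \<and> s (u i) = \<epsilon> i *s u (w i)) \<and>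
     (\<forall>i\<in>D. \<forall>j\<in>D. \<beta> (u i) (u j) = (if i + j = 0 then 1 else 0))"

section \<open>Linear algebra of a flag with triangular duality\<close>

lemma flag_mono: "i \<le> j \<Longrightarrow> flag I e i \<subseteq> flag I e j"
  unfolding flag_def by (rule span_mono) auto

lemma flag_base: "i \<in> I \<Longrightarrow> i \<le> j \<Longrightarrow> e i \<in> flag I e j"
  unfolding flag_def by (rule span_base) auto

lemma flag_orthogonal:
  assumes "weak_frame I e" "x \<in> flag I e i" "y \<in> flag I e j" "i + j < 0"
  shows "\<beta> x y = 0"
proof (rule form_span_zero[OF assms(2)[unfolded flag_def]])
  fix z assume "z \<in> e ` {k \<in> I. k \<le> i}"
  then obtain k where k: "k \<in> I" "k \<le> i" "z = e k" by auto
  have "\<beta> y z = 0"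
  proof (rule form_span_zero[OF assms(3)[unfolded flag_def]])
    fix z' assume "z' \<in> e ` {k \<in> I. k \<le> j}"
    then obtain l where "l \<in> I" "l \<le> j" "z' = e l" by auto
    thus "\<beta> z' z = 0" using k assms(1,4) by (auto simp: weak_frame_def)
  qed
  thus "\<beta> z y = 0" by (simp add: form_sym)
qed

lemma flag_leading_term:
  assumes I: "finite I" and x: "x \<in> flag I e i" and i: "i \<in> I"
  obtains c y where "x = c *s e i + y" "y \<in> flag I e (i - 1)"
proof -
  have "{k \<in> I. k \<le> i} = insert i {k \<in> I. k \<le> i - 1}" using i by auto
  hence "x \<in> span (insert (e i) (e ` {k \<in> I. k \<le> i - 1}))"
    using x by (simp add: flag_def)
  then obtain c where "x - c *s e i \<in> span (e ` {k \<in> I. k \<le> i - 1})"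
    using span_breakdown_eq by blast
  thus thesis using that[of c "x - c *s e i"] by (simp add: flag_def)
qed

text \<open>Take the least \<open>j\<close> in \<open>I\<close> whose flag space contains
  \<open>x\<close>. Pairing with \<open>e (- j)\<close> kills everything below index
  \<open>j\<close> and leaves the leading coefficient times a non-zero number.\<close>

lemma flag_top_index:
  assumes wf: "weak_frame I e" and x: "x \<in> span (e ` I)" "x \<noteq> 0"
  obtains j where "j \<in> I" "x \<in> flag I e j" "\<beta> x (e (- j)) \<noteq> 0"
proof -
  have fin: "finite I" and neg: "\<And>i. i \<in> I \<Longrightarrow> - i \<in> I" using wf by (auto simp: weak_frame_def)
  let ?A = "{j \<in> I. x \<in> flag I e j}"
  have ne: "I \<noteq> {}" using x by (auto simp: span_empty)
  have "{k \<in> I. k \<le> Max I} = I" using fin by auto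
  hence "Max I \<in> ?A" using x fin ne by (auto simp: flag_def)
  hence A: "finite ?A" "?A \<noteq> {}" using fin by auto
  define j where "j = Min ?A"
  have j: "j \<in> I" "x \<in> flag I e j" using Min_in[OF A] by (auto simp: j_def)
  obtain c y where cy: "x = c *s e j + y" "y \<in> flag I e (j - 1)"
    using flag_leading_term[OF fin j(2,1)] .
  have "c \<noteq> 0"
  proof
    assume "c = 0"
    hence xj: "x \<in> flag I e (j - 1)" using cy by simp
    \<comment> \<open>The index set may have gaps once blocks have been split off, so
      \<open>j - 1\<close> need not be an index. The flag space at \<open>j - 1\<close> is already
      the one at \<open>l\<close>, the largest index below \<open>j\<close>, and that contradicts
      the choice of \<open>j\<close>.\<close>
    let ?L = "{k \<in> I. k \<le> j - 1}"
    have Lne: "?L \<noteq> {}"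
    proof
      assume "?L = {}"
      thus False using xj x(2) unfolding flag_def by (simp only: image_empty span_empty singleton_iff)
    qed
    have fL: "finite ?L" using fin by simp
    define l where "l = Max ?L"
    have l: "l \<in> I" "l \<le> j - 1" using Max_in[OF fL Lne] by (auto simp: l_def)
    have "{k \<in> I. k \<le> l} = ?L" using l Max_ge[OF fL] by (fastforce simp: l_def)
    hence "l \<in> ?A" using xj l by (simp add: flag_def)
    hence "j \<le> l" using A by (simp add: j_def)
    thus False using l by simp
  qed
  moreover have "\<beta> y (e (- j)) = 0"
    using flag_orthogonal[OF wf cy(2) flag_base[of "- j" I "- j"]] neg[OF j(1)] by simp
  moreover have "\<beta> (e j) (e (- j)) \<noteq> 0" using wf j by (auto simp: weak_frame_def)
  ultimately have "\<beta> x (e (- j)) \<noteq> 0" by (simp add: cy form_simps)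
  thus thesis using that j by blast
qed


lemma frame_nonzero: "weak_frame I e \<Longrightarrow> i \<in> I \<Longrightarrow> e i \<noteq> 0"
  by (auto simp: weak_frame_def)

text \<open>The vector \<open>p\<close> spans the bottom of the flag, and the index \<open>j\<close>
  at which \<open>s p\<close> enters the flag decides the shape of the block. For
  \<open>j = a\<close> it is an eigenvector with a dual eigenvector, for \<open>j = - a\<close> the
  pair \<open>p\<close>, \<open>s p\<close> is hyperbolic up to scale, and otherwise the block has
  dimension four, with two dual vectors that \<open>s\<close> exchanges. The case
  \<open>a = 0\<close> is the one-dimensional middle.\<close>

lemma normal_block_exists:
  assumes wf: "weak_frame I e" and stab: "\<And>i. i \<in> I \<Longrightarrow> s (e i) \<in> span (e ` I)" and ne: "I \<noteq> {}"
  obtains D u w \<epsilon> where "D \<subseteq> I" "D \<noteq> {}" "\<And>i. i \<in> D \<Longrightarrow> - i \<in> D"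
    "\<And>i. i \<in> D \<Longrightarrow> u i \<in> flag I e i" "normal_frame D u w \<epsilon>"
proof -
  have fin: "finite I" and neg: "\<And>i. i \<in> I \<Longrightarrow> - i \<in> I" using wf by (auto simp: weak_frame_def)
  define a where "a = Min I"
  have aI: "a \<in> I" using fin ne by (simp add: a_def)
  have a_le: "a \<le> i" if "i \<in> I" for i using fin that by (simp add: a_def)
  have le_a: "i \<le> - a" if "i \<in> I" for i using a_le[OF neg[OF that]] by simp
  have a0: "a \<le> 0" using le_a[OF aI] by simp
  define p where "p = e a"
  have pF: "p \<in> flag I e a" by (simp add: p_def flag_base aI)
  have top: "flag I e (- a) = span (e ` I)"
  proof -
    have "{k \<in> I. k \<le> - a} = I" using le_a by auto
    thus ?thesis by (simp add: flag_def)
  qed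
  have stab': "s x \<in> span (e ` I)" if "x \<in> span (e ` I)" for x
    using that by (rule s_span) (use stab in auto)
  have p_nz: "p \<noteq> 0" using frame_nonzero[OF wf aI] by (simp add: p_def)
  have "s p \<noteq> 0" using p_nz s_invol[of p] by auto
  then obtain j where j: "j \<in> I" "s p \<in> flag I e j" "\<beta> (s p) (e (- j)) \<noteq> 0"
    using flag_top_index[OF wf, of "s p"] stab[OF aI] unfolding p_def by blast
  have pp: "\<beta> p p = 0" if "a < 0" using flag_orthogonal[OF wf pF pF] that by simp
  have low: "flag I e a = span {p}"
  proof -
    have "{k \<in> I. k \<le> a} = {a}" using a_le aI by force
    thus ?thesis by (simp add: flag_def p_def)
  qed
  consider "a = 0" | "a < 0" "j = a" | "a < 0" "j = - a" | "a < 0" "a < j" "j < - a"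
    using a_le[OF j(1)] le_a[OF j(1)] a0 by linarith
  thus thesis
  proof cases
    case 1
    have "j = a" using a_le[OF j(1)] le_a[OF j(1)] 1 by simp
    then obtain c where c: "s p = c *s p" using j(2) low by (auto simp: span_singleton)
    have q: "\<beta> p p \<noteq> 0" using wf aI 1 by (auto simp: weak_frame_def p_def)
    have "c * c * \<beta> p p = \<beta> p p" using s_form[of p p] by (simp add: c form_simps)
    hence "c * c = 1" using q by simp
    hence c1: "c = 1 \<or> c = - 1" by (rule square_eq_1_iff[THEN iffD1])
    obtain y where y: "y * y = \<beta> p p" using sqrt_exists by blast
    have "inverse y * (inverse y * (y * y)) = 1" using y q by (auto simp: field_simps)
    hence gram: "\<beta> (inverse y *s p) (inverse y *s p) = 1"
      by (simp add: form_simps y)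
    show thesis
      by (rule that[of "{0}" "\<lambda>_. inverse y *s p" "\<lambda>i. i" "\<lambda>_. c"])
        (use 1 aI pF gram c c1 in \<open>auto simp: normal_frame_def s_simps flag_def span_scale mult.commute\<close>)
  next
    case 2
    then obtain c where c: "s p = c *s p" using j(2) low by (auto simp: span_singleton)
    have "c *s c *s p = p" using s_invol[of p] by (simp add: c s_simps)
    hence "(c * c - 1) *s p = 0" by (simp add: scale_left_diff_distrib)
    hence cc: "c * c = 1" using p_nz by simp
    hence c1: "c = 1 \<or> c = - 1" by (rule square_eq_1_iff[THEN iffD1])
    have bz: "\<beta> p (e (- a)) \<noteq> 0" using wf aI by (auto simp: weak_frame_def p_def)
    define x where "x = inverse (\<beta> p (e (- a))) *s e (- a)"
    have xS: "x \<in> span (e ` I)" unfolding x_def by (intro span_scale span_base) (use neg aI in auto)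
    have px: "\<beta> p x = 1" using bz by (simp add: x_def form_simps)
    have psx: "\<beta> p (s x) = c" using s_adjoint[of p x] by (simp add: c form_simps px)
    \<comment> \<open>This is the projection of \<open>x\<close> to the \<open>c\<close>-eigenspace
      of \<open>s\<close>. It stays dual to \<open>p\<close> since \<open>p\<close> lies in that
      eigenspace, so that \<open>p\<close> pairs with \<open>s x\<close> to
      \<open>c\<close>.\<close>
    define f0 where "f0 = inverse 2 *s (x + c *s s x)"
    have f0: "f0 \<in> span (e ` I)" unfolding f0_def by (intro span_scale span_add xS stab')
    have sf0: "s f0 = c *s f0"
      by (simp add: f0_def s_simps scale_right_distrib cc mult.left_commute mult.assoc[symmetric] add.commute)
    have pf0: "\<beta> p f0 = 1" using two_nz by (simp add: f0_def form_simps px psx cc)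
    \<comment> \<open>The norm of \<open>f0\<close> is removed by a multiple of \<open>p\<close>,
      which is isotropic, has product 1 with \<open>f0\<close> and lies in the same
      eigenspace.\<close>
    define f where "f = f0 - (\<beta> f0 f0 / 2) *s p"
    have fS: "f \<in> span (e ` I)"
      unfolding f_def p_def by (intro span_diff span_scale f0 span_base) (use aI in auto)
    have sf: "s f = c *s f" by (simp add: f_def s_simps sf0 c scale_right_diff_distrib mult.commute)
    have pf: "\<beta> p f = 1" using pp[OF 2(1)] by (simp add: f_def form_simps pf0)
    hence fp: "\<beta> f p = 1" by (simp add: form_sym[of f p])
    have ff: "\<beta> f f = 0"
      using two_nz pp[OF 2(1)] by (simp add: f_def form_simps pf0 form_sym[of f0 p])
    show thesis
      by (rule that[of "{a, - a}" "\<lambda>i. if i = a then p else f" "\<lambda>i. i" "\<lambda>_. c"])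
        (use 2 aI neg pF fS pp ff pf fp sf c c1 top in \<open>auto simp: normal_frame_def\<close>)
  next
    case 3
    have q: "\<beta> p (s p) \<noteq> 0" using j(3) 3 by (simp add: p_def form_sym)
    \<comment> \<open>Both vectors must be scaled by the same factor in order to remain exchanged by
      \<open>s\<close>, so a square root is required.\<close>
    obtain t where t: "t * t = inverse (\<beta> p (s p))" using sqrt_exists by blast
    have one: "\<beta> (t *s p) (t *s s p) = 1" "\<beta> (t *s s p) (t *s p) = 1"
      using q by (simp_all add: form_simps mult.assoc[symmetric] t form_sym[of "s p" p])
    have nil: "\<beta> (t *s p) (t *s p) = 0" "\<beta> (t *s s p) (t *s s p) = 0"
      using pp[OF 3(1)] by (simp_all add: form_simps s_form)
    have mem: "t *s p \<in> flag I e a" "t *s s p \<in> flag I e (- a)"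
      using pF j(2) 3 by (auto simp: flag_def span_scale)
    show thesis
      by (rule that[of "{a, - a}" "\<lambda>i. if i = a then t *s p else t *s s p" "\<lambda>i. - i" "\<lambda>_. 1"])
        (use 3 aI neg mem one nil in \<open>auto simp: normal_frame_def s_simps\<close>)
  next
    case 4
    have spsp: "\<beta> (s p) (s p) = 0" using pp[OF 4(1)] by (simp add: s_form)
    have psp: "\<beta> p (s p) = 0" "\<beta> (s p) p = 0"
      using flag_orthogonal[OF wf pF j(2)] 4 by (simp_all add: form_sym[of "s p" p])
    \<comment> \<open>A vector with leading index 0 has as its norm the square of the leading
      coefficient times the norm of \<open>e 0\<close>, hence is anisotropic, while
      \<open>s p\<close> is isotropic. Consequently \<open>a\<close>, \<open>- a\<close>,
      \<open>j\<close>, \<open>- j\<close> are four distinct indices.\<close>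
    have j0: "j \<noteq> 0"
    proof
      assume j_eq: "j = 0"
      obtain d y where dy: "s p = d *s e 0 + y" "y \<in> flag I e (0 - 1)"
        using flag_leading_term[OF fin, of "s p" e 0] j j_eq by auto
      have e0: "e 0 \<in> flag I e 0" using flag_base[of 0 I 0 e] j j_eq by simp
      have "\<beta> y (e 0) = 0" "\<beta> y y = 0"
        using flag_orthogonal[OF wf dy(2) e0] flag_orthogonal[OF wf dy(2) dy(2)] by simp_all
      hence "\<beta> (s p) (s p) = d * (d * \<beta> (e 0) (e 0))" "\<beta> (s p) (e 0) = d * \<beta> (e 0) (e 0)"
        by (simp_all add: dy(1) form_simps form_sym[of "e 0" y])
      thus False using j(3) j_eq spsp by simp
    qed
    define f1 where "f1 = inverse (\<beta> (s p) (e (- j))) *s e (- j)"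
    have f1F: "f1 \<in> flag I e (- j)"
      using flag_base[OF neg[OF j(1)], of "- j" e] by (simp add: f1_def flag_def span_scale)
    have f1_sp: "\<beta> (s p) f1 = 1" "\<beta> f1 (s p) = 1" using j(3) by (simp_all add: f1_def form_simps form_sym[of _ "s p"])
    have f1_p: "\<beta> p f1 = 0" "\<beta> f1 p = 0"
      using flag_orthogonal[OF wf pF f1F] 4 by (simp_all add: form_sym[of f1 p])
    have sf1: "\<beta> (s p) (s f1) = 0" "\<beta> (s f1) (s p) = 0" "\<beta> p (s f1) = 1" "\<beta> (s f1) p = 1"
      using s_adjoint[of p f1] s_adjoint[of f1 p] by (simp_all add: s_form f1_p f1_sp)
    \<comment> \<open>Two products have to be killed, \<open>f1\<close> with itself and
      \<open>f1\<close> with \<open>s f1\<close>. Since \<open>f1\<close> is dual to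
      \<open>s p\<close> and \<open>s f1\<close> is dual to \<open>p\<close>, subtracting
      \<open>q *s s p\<close> lowers the first by \<open>2 * q\<close> and subtracting
      \<open>r *s p\<close> lowers the second by \<open>2 * r\<close>.\<close>
    define q r where "q = \<beta> f1 f1 / 2" and "r = \<beta> f1 (s f1) / 2"
    have qr: "\<beta> f1 f1 = q + q" "\<beta> f1 (s f1) = r + r"
      using two_nz by (simp_all add: q_def r_def field_simps)
    have qr': "\<beta> (s f1) (s f1) = q + q" "\<beta> (s f1) f1 = r + r"
      by (simp_all add: s_form qr form_sym[of "s f1" f1])
    define f where "f = f1 - q *s s p - r *s p"
    have fF: "f \<in> flag I e (- j)"
    proof -
      have "p \<in> flag I e (- j)" using pF flag_mono[of a "- j"] 4 by auto
      \<comment> \<open>For negative \<open>j\<close> the vector \<open>s p\<close> lies low enough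
        in the flag. For positive \<open>j\<close> it does not, but then \<open>f1\<close> lies in a
        totally isotropic flag space and the coefficient \<open>q\<close> is 0.\<close>
      moreover have "q *s s p \<in> flag I e (- j)"
      proof (cases "j < 0")
        case True
        hence "s p \<in> flag I e (- j)" using j(2) flag_mono[of j "- j" I e] by auto
        thus ?thesis by (simp add: flag_def span_scale)
      next
        case False
        hence "q = 0" using flag_orthogonal[OF wf f1F f1F] j0 by (simp add: q_def)
        thus ?thesis by (simp add: flag_def span_zero)
      qed
      ultimately show ?thesis
        using f1F unfolding f_def flag_def by (blast intro: span_diff span_scale)
    qed
    have sf: "s f = s f1 - q *s p - r *s s p" by (simp add: f_def s_simps)
    have sfS: "s f \<in> flag I e (- a)"
      using stab'[of f] fF flag_mono[of "- j" "- a" I e] 4 by (auto simp: top)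
    note facts = psp spsp pp[OF 4(1)] f1_sp f1_p sf1 qr qr'
    have gram: "\<beta> f f = 0" "\<beta> f (s f) = 0" "\<beta> (s f) f = 0" "\<beta> (s f) (s f) = 0"
      "\<beta> p f = 0" "\<beta> f p = 0" "\<beta> (s p) f = 1" "\<beta> f (s p) = 1"
      "\<beta> p (s f) = 1" "\<beta> (s f) p = 1" "\<beta> (s p) (s f) = 0" "\<beta> (s f) (s p) = 0"
      unfolding sf unfolding f_def by (simp_all add: form_simps facts)
    let ?u = "\<lambda>i. if i = a then p else if i = j then s p else if i = - j then f else s f"
    let ?w = "\<lambda>i. if i = a then j else if i = j then a else if i = - j then - a else - j"
    show thesis
    proof (rule that[of "{a, - a, j, - j}" ?u ?w "\<lambda>_. 1"])
      show "normal_frame {a, - a, j, - j} ?u ?w (\<lambda>_. 1)"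
        unfolding normal_frame_def using 4 j0 by (auto simp: gram psp spsp pp s_invol)
    qed (use 4 j aI neg pF fF sfS j0 in auto)
  qed
qed

text \<open>The remaining vectors are projected to the orthogonal complement of the block, which is
  \<open>s\<close>-stable because the block is. Only those \<open>u d\<close> with
  \<open>d \<le> i\<close> occur in the correction of \<open>e i\<close>, so the projection respects
  the flag. It alters products only for index sums above 0, about which a weak frame says
  nothing.\<close>

lemma normal_frame_split:
  assumes wf: "weak_frame I e" and stab: "\<And>i. i \<in> I \<Longrightarrow> s (e i) \<in> span (e ` I)"
    and DI: "D \<subseteq> I" and Dneg: "\<And>i. i \<in> D \<Longrightarrow> - i \<in> D"
    and uF: "\<And>i. i \<in> D \<Longrightarrow> u i \<in> flag I e i" and nf: "normal_frame D u w \<epsilon>"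
    and e'_def: "\<And>k. e' k = e k - (\<Sum>d\<in>D. \<beta> (e k) (u (- d)) *s u d)"
  shows "weak_frame (I - D) e'" "\<And>i. i \<in> I - D \<Longrightarrow> s (e' i) \<in> span (e' ` (I - D))"
    "\<And>i. i \<in> I - D \<Longrightarrow> e' i \<in> flag I e i"
    "\<And>i d. i \<in> I \<Longrightarrow> d \<in> D \<Longrightarrow> \<beta> (e' i) (u d) = 0"
proof -
  have fin: "finite I" and neg: "\<And>i. i \<in> I \<Longrightarrow> - i \<in> I" using wf by (auto simp: weak_frame_def)
  have finD: "finite D" using fin DI finite_subset by blast
  have gram: "\<And>i j. i \<in> D \<Longrightarrow> j \<in> D \<Longrightarrow> \<beta> (u i) (u j) = (if i + j = 0 then 1 else 0)"
    using nf by (simp add: normal_frame_def)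
  have eF: "e i \<in> flag I e i" if "i \<in> I" for i using that by (simp add: flag_base)
  have ortho: "\<beta> (e' i) (u d) = 0" if "i \<in> I" "d \<in> D" for i d
  proof -
    have "(\<Sum>d'\<in>D. \<beta> (e i) (u (- d')) * \<beta> (u d') (u d)) =
        (\<Sum>d'\<in>D. if d' = - d then \<beta> (e i) (u d) else 0)"
      by (rule sum.cong) (use that in \<open>auto simp: gram\<close>)
    also have "\<dots> = \<beta> (e i) (u d)" using finD Dneg[OF that(2)] by simp
    finally show ?thesis by (simp add: e'_def form_simps form_sum)
  qed
  thus "\<And>i d. i \<in> I \<Longrightarrow> d \<in> D \<Longrightarrow> \<beta> (e' i) (u d) = 0" .
  have zero: "\<beta> (e i) (u d) = 0" if "i \<in> I" "d \<in> D" "i + d < 0" for i d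
    using flag_orthogonal[OF wf eF[OF that(1)] uF[OF that(2)] that(3)] .
  have e'F: "e' i \<in> flag I e i" if i: "i \<in> I" for i
  proof -
    have "\<beta> (e i) (u (- d)) *s u d \<in> flag I e i" if d: "d \<in> D" for d
    proof (cases "d \<le> i")
      case True
      thus ?thesis using uF[OF d] flag_mono[of d i I e] unfolding flag_def by (blast intro: span_scale)
    next
      case False
      thus ?thesis using zero[OF i Dneg[OF d]] by (simp add: flag_def span_zero)
    qed
    thus ?thesis using eF[OF i] unfolding e'_def flag_def by (intro span_diff span_sum)
  qed
  thus "\<And>i. i \<in> I - D \<Longrightarrow> e' i \<in> flag I e i" by blast
  \<comment> \<open>Since \<open>k\<close> and \<open>- l\<close> lie outside \<open>D\<close>, they
    differ from \<open>d\<close>. Together with \<open>k + l \<le> 0\<close> this leaves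
    \<open>k < d\<close> or \<open>l < - d\<close>, and in either case one factor vanishes.\<close>
  have gram': "\<beta> (e' k) (e' l) = \<beta> (e k) (e l)" if kl: "k \<in> I - D" "l \<in> I - D" "k + l \<le> 0" for k l
  proof -
    have "\<beta> (e k) (u (- d)) * \<beta> (u d) (e l) = 0" if d: "d \<in> D" for d
    proof -
      have "k \<noteq> d" "l \<noteq> - d" using kl d Dneg by auto
      hence "k + - d < 0 \<or> l + d < 0" using kl(3) by linarith
      thus ?thesis using zero[of k "- d"] zero[of l d] kl d Dneg by (auto simp: form_sym[of _ "e l"])
    qed
    hence "\<beta> (e' k) (e l) = \<beta> (e k) (e l)"
      by (simp add: e'_def form_simps form_sum sum.neutral)
    moreover have "\<beta> (e' k) (\<Sum>d\<in>D. \<beta> (e l) (u (- d)) *s u d) = 0"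
      using kl ortho by (simp add: form_sum_right form_simps)
    ultimately show ?thesis by (subst (2) e'_def) (simp add: form_simps)
  qed
  show "weak_frame (I - D) e'"
    unfolding weak_frame_def
  proof (intro conjI ballI impI)
    fix i assume i: "i \<in> I - D"
    show mi: "- i \<in> I - D" using i neg Dneg[of "- i"] by auto
    show "\<beta> (e' i) (e' (- i)) \<noteq> 0" using gram'[OF i mi] wf i by (auto simp: weak_frame_def)
  next
    fix i j assume "i \<in> I - D" "j \<in> I - D" "i + j < 0"
    thus "\<beta> (e' i) (e' j) = 0" using gram'[of i j] wf by (auto simp: weak_frame_def)
  qed (use fin in simp)
  let ?T = "u ` D \<union> e' ` (I - D)"
  \<comment> \<open>Induction upwards along the finite index set. For \<open>i\<close> in
    \<open>D\<close> the vector \<open>u i\<close> can be solved for \<open>e i\<close>: its leading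
    coefficient is non-zero, because \<open>u (- i)\<close> is orthogonal to all lower terms and yet
    has product 1 with \<open>u i\<close>.\<close>
  have e_in: "e i \<in> span ?T" if "i \<in> I" for i
    using that
  proof (induction "nat (i - Min I)" arbitrary: i rule: less_induct)
    case less
    have lower: "x \<in> span ?T" if "x \<in> flag I e (i - 1)" for x
    proof -
      have "e k \<in> span ?T" if "k \<in> I" "k \<le> i - 1" for k
        using that less.prems Min_le[OF fin that(1)] by (intro less.hyps) auto
      hence "e ` {k \<in> I. k \<le> i - 1} \<subseteq> span ?T" by auto
      thus ?thesis using that span_mono[of _ "span ?T"] unfolding flag_def by (auto simp: span_span)
    qed
    show ?case
    proof (cases "i \<in> D")
      case False
      have "(\<Sum>d\<in>D. \<beta> (e i) (u (- d)) *s u d) \<in> span ?T"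
        by (intro span_sum span_scale span_base) auto
      moreover have "e' i \<in> span ?T" by (rule span_base) (use False less in auto)
      ultimately have "e' i + (\<Sum>d\<in>D. \<beta> (e i) (u (- d)) *s u d) \<in> span ?T" by (rule span_add[rotated])
      thus ?thesis by (simp add: e'_def)
    next
      case True
      obtain c y where cy: "u i = c *s e i + y" "y \<in> flag I e (i - 1)"
        using flag_leading_term[OF fin uF[OF True]] less DI True by blast
      have "\<beta> (u i) (u (- i)) = 1" using gram Dneg True by simp
      moreover have "\<beta> y (u (- i)) = 0"
        using flag_orthogonal[OF wf cy(2) uF[OF Dneg[OF True]]] by simp
      ultimately have c: "c \<noteq> 0" by (auto simp: cy form_simps)
      have "u i - y \<in> span ?T"
        by (intro span_diff lower cy(2) span_base) (use True in auto)
      hence "inverse c *s (u i - y) \<in> span ?T" by (rule span_scale)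
      thus ?thesis using c by (simp add: cy)
    qed
  qed
  have inT: "span (e ` I) \<subseteq> span ?T"
    using span_mono[of "e ` I" "span ?T"] e_in by (auto simp: span_span)
  fix i assume i: "i \<in> I - D"
  have sI: "s x \<in> span (e ` I)" if "x \<in> span (e ` I)" for x
    using that by (rule s_span) (use stab in auto)
  have "flag I e i \<subseteq> span (e ` I)" unfolding flag_def by (rule span_mono) auto
  hence "s (e' i) \<in> span ?T" using e'F[of i] i sI inT by auto
  then obtain x y where xy: "s (e' i) = x + y" "x \<in> span (u ` D)" "y \<in> span (e' ` (I - D))"
    by (auto simp: span_Un)
  have y0: "\<beta> y (u d) = 0" if "d \<in> D" for d
    using xy(3) by (rule form_span_zero) (use ortho that in auto)
  \<comment> \<open>The block component of \<open>s (e' i)\<close> is orthogonal to the block, as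
    \<open>s\<close> is self-adjoint and maps the block to itself. Its expansion in the dual basis
    of the block then has only zero coefficients.\<close>
  have x0: "\<beta> x (u d) = 0" if d: "d \<in> D" for d
  proof -
    have "s (u d) = \<epsilon> d *s u (w d)" "w d \<in> D" using nf d by (auto simp: normal_frame_def)
    hence "\<beta> (s (e' i)) (u d) = 0" using i ortho by (simp add: s_adjoint form_simps)
    thus ?thesis using y0[OF d] by (simp add: xy form_simps)
  qed
  have "x = (\<Sum>d\<in>D. \<beta> x (u (- d)) *s u d)"
    using xy(2)
  proof (induction rule: span_induct_alt)
    case (step c z y)
    then obtain d where d: "d \<in> D" "z = u d" by auto
    have "(\<Sum>d'\<in>D. \<beta> z (u (- d')) *s u d') = (\<Sum>d'\<in>D. if d' = d then u d else 0)"
      by (rule sum.cong) (use d gram Dneg in auto)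
    hence "z = (\<Sum>d'\<in>D. \<beta> z (u (- d')) *s u d')" using d finD by simp
    moreover have "(\<Sum>d\<in>D. \<beta> (c *s z + y) (u (- d)) *s u d) =
        c *s (\<Sum>d\<in>D. \<beta> z (u (- d)) *s u d) + (\<Sum>d\<in>D. \<beta> y (u (- d)) *s u d)"
      by (simp add: form_simps scale_left_distrib sum.distrib scale_sum_right)
    ultimately show ?case using step by simp
  qed simp
  hence "x = 0" using x0 Dneg by simp
  thus "s (e' i) \<in> span (e' ` (I - D))" using xy by simp
qed

text \<open>Induction on the number of indices. Vectors found later remain adapted to the original
  flag, because each \<open>e' k\<close> stays in the \<open>k\<close>-th flag space and so do the
  spans of such vectors.\<close>

theorem normal_frame_exists:
  assumes "weak_frame I e" and "\<And>i. i \<in> I \<Longrightarrow> s (e i) \<in> span (e ` I)"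
  shows "\<exists>u w \<epsilon>. (\<forall>i\<in>I. u i \<in> flag I e i) \<and> normal_frame I u w \<epsilon>"
  using assms
proof (induction "card I" arbitrary: I e rule: less_induct)
  case less
  note wf = less.prems(1) and stab = less.prems(2)
  show ?case
  proof (cases "I = {}")
    case True
    thus ?thesis by (auto simp: normal_frame_def)
  next
    case False
    obtain D u w \<epsilon> where D: "D \<subseteq> I" "D \<noteq> {}" "\<And>i. i \<in> D \<Longrightarrow> - i \<in> D"
      and uF: "\<And>i. i \<in> D \<Longrightarrow> u i \<in> flag I e i" and nf: "normal_frame D u w \<epsilon>"
      using normal_block_exists[OF wf stab False] by blast
    define e' where "e' k = e k - (\<Sum>d\<in>D. \<beta> (e k) (u (- d)) *s u d)" for k
    have wf': "weak_frame (I - D) e'"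
      and stab': "\<And>i. i \<in> I - D \<Longrightarrow> s (e' i) \<in> span (e' ` (I - D))"
      and e'F: "\<And>i. i \<in> I - D \<Longrightarrow> e' i \<in> flag I e i"
      and ortho: "\<And>i d. i \<in> I \<Longrightarrow> d \<in> D \<Longrightarrow> \<beta> (e' i) (u d) = 0"
      using normal_frame_split[OF wf _ D(1) _ _ nf e'_def] stab D(3) uF by blast+
    have fin: "finite I" using wf by (simp add: weak_frame_def)
    have "card (I - D) < card I" using D fin by (intro psubset_card_mono) auto
    with wf' stab' obtain u' w' \<epsilon>' where
      u'F: "\<And>i. i \<in> I - D \<Longrightarrow> u' i \<in> flag (I - D) e' i" and nf': "normal_frame (I - D) u' w' \<epsilon>'"
      using less.hyps[of "I - D" e'] by blast
    let ?u = "\<lambda>i. if i \<in> D then u i else u' i" and ?w = "\<lambda>i. if i \<in> D then w i else w' i"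
      and ?\<epsilon> = "\<lambda>i. if i \<in> D then \<epsilon> i else \<epsilon>' i"
    have negD: "- i \<in> D \<longleftrightarrow> i \<in> D" for i using D(3)[of i] D(3)[of "- i"] by auto
    have perp: "\<beta> (u' i) (u d) = 0" if "i \<in> I - D" "d \<in> D" for i d
      by (rule form_span_zero[OF u'F[OF that(1), unfolded flag_def]]) (use ortho that in auto)
    have "normal_frame I ?u ?w ?\<epsilon>"
      unfolding normal_frame_def
    proof (intro conjI ballI)
      fix i j assume ij: "i \<in> I" "j \<in> I"
      show "\<beta> (?u i) (?u j) = (if i + j = 0 then 1 else 0)"
      proof (cases "i \<in> D \<longleftrightarrow> j \<in> D")
        case True
        thus ?thesis using ij nf nf' by (auto simp: normal_frame_def)
      next
        case False
        moreover have "i + j \<noteq> 0"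
        proof
          assume "i + j = 0"
          hence "j = - i" by simp
          thus False using False negD by simp
        qed
        ultimately show ?thesis using ij perp by (auto simp: form_sym[of "u _"])
      qed
    next
      fix i assume i: "i \<in> I"
      show "?w i \<in> I" "?w (?w i) = i" "?w (- i) = - ?w i" "?\<epsilon> i = 1 \<or> ?\<epsilon> i = - 1"
        "?\<epsilon> (- i) = ?\<epsilon> i" "?w i \<noteq> i \<longrightarrow> ?\<epsilon> i = 1" "s (?u i) = ?\<epsilon> i *s ?u (?w i)"
        using nf nf' D(1) i by (cases "i \<in> D"; auto simp: normal_frame_def negD)+
    qed
    moreover have "?u i \<in> flag I e i" if i: "i \<in> I" for i
    proof (cases "i \<in> D")
      case False
      have "e' ` {k \<in> I - D. k \<le> i} \<subseteq> flag I e i" using e'F flag_mono by blast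
      hence "flag (I - D) e' i \<subseteq> flag I e i"
        unfolding flag_def using span_mono by (metis span_span)
      thus ?thesis using u'F[of i] False i by auto
    qed (use uF in auto)
    ultimately show ?thesis by (intro exI conjI ballI) auto
  qed
qed


text \<open>Gram-Schmidt with one eigenvector at a time. The orthogonal complement of those already
  found is \<open>s\<close>-stable and still nondegenerate, so it contains an anisotropic vector,
  and one of the two eigencomponents of that vector is anisotropic as well.\<close>

theorem orthonormal_eigenbasis_exists:
  assumes fin: "finite E" and ind: "independent E"
    and nondeg: "\<And>x. x \<in> span E \<Longrightarrow> x \<noteq> 0 \<Longrightarrow> \<exists>y\<in>span E. \<beta> x y \<noteq> 0"
    and stab: "\<And>x. x \<in> E \<Longrightarrow> s x \<in> span E"
  shows "\<exists>u \<eta>. (\<forall>i<card E. u i \<in> span E \<and> s (u i) = \<eta> i *s u i \<and> (\<eta> i = 1 \<or> \<eta> i = - 1)) \<and>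
    (\<forall>i<card E. \<forall>j<card E. \<beta> (u i) (u j) = (if i = j then 1 else 0))"
proof -
  have sE: "s x \<in> span E" if "x \<in> span E" for x
    using that by (rule s_span) (use stab in auto)
  let ?P = "\<lambda>k u \<eta>. (\<forall>i<k. u i \<in> span E \<and> s (u i) = \<eta> i *s u i \<and> (\<eta> i = 1 \<or> \<eta> i = - 1)) \<and>
    (\<forall>i<k. \<forall>j<k. \<beta> (u i) (u j) = (if i = j then 1 else 0))"
  have "\<exists>u \<eta>. ?P k u \<eta>" if "k \<le> card E" for k :: nat
    using that
  proof (induction k)
    case (Suc k)
    hence "k \<le> card E" by simp
    from Suc.IH[OF this] obtain u \<eta> where P: "?P k u \<eta>" by (elim exE)
    hence u: "\<And>i. i < k \<Longrightarrow> u i \<in> span E \<and> s (u i) = \<eta> i *s u i \<and> (\<eta> i = 1 \<or> \<eta> i = - 1)"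
      and gram: "\<And>i j. i < k \<Longrightarrow> j < k \<Longrightarrow> \<beta> (u i) (u j) = (if i = j then 1 else 0)"
      by blast+
    define proj where "proj x = (\<Sum>i<k. \<beta> x (u i) *s u i)" for x
    have projE: "proj x \<in> span E" for x
      unfolding proj_def by (intro span_sum span_scale) (use u in auto)
    have perp: "\<beta> (x - proj x) (u j) = 0" if "j < k" for x j
    proof -
      have "(\<Sum>i<k. \<beta> x (u i) * \<beta> (u i) (u j)) = (\<Sum>i<k. if i = j then \<beta> x (u j) else 0)"
        by (rule sum.cong) (use that gram in auto)
      thus ?thesis using that by (simp add: proj_def form_simps form_sum)
    qed
    have "\<not> E \<subseteq> span (u ` {..<k})"
    proof
      assume "E \<subseteq> span (u ` {..<k})"
      hence "card E \<le> card (u ` {..<k})" using independent_span_bound[OF _ ind] by blast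
      also have "\<dots> \<le> k" using card_image_le[of "{..<k}" u] by simp
      finally show False using Suc.prems by simp
    qed
    then obtain x0 where x0: "x0 \<in> E" "x0 \<notin> span (u ` {..<k})" by blast
    define x where "x = x0 - proj x0"
    have "proj x0 \<in> span (u ` {..<k})"
      unfolding proj_def by (intro span_sum span_scale span_base) auto
    hence "x \<noteq> 0" using x0 by (auto simp: x_def)
    moreover have xE: "x \<in> span E" using x0 projE by (auto simp: x_def intro: span_diff span_base)
    ultimately obtain y0 where y0: "y0 \<in> span E" "\<beta> x y0 \<noteq> 0" using nondeg by blast
    define y where "y = y0 - proj y0"
    have yE: "y \<in> span E" using y0 projE by (auto simp: y_def intro: span_diff)
    have xp: "\<beta> x (u i) = 0" "\<beta> y (u i) = 0" if "i < k" for i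
      using perp[OF that] by (simp_all add: x_def y_def)
    have "\<beta> x (proj y0) = 0" using xp by (simp add: proj_def form_sum_right form_simps)
    hence "\<beta> x y \<noteq> 0" using y0 by (simp add: y_def form_simps)
    hence "\<beta> x x \<noteq> 0 \<or> \<beta> y y \<noteq> 0 \<or> \<beta> (x + y) (x + y) \<noteq> 0" by (rule isotropic_polarization)
    moreover have "\<beta> (x + y) (u i) = 0" if "i < k" for i using xp[OF that] by (simp add: form_add)
    ultimately obtain z where z: "\<beta> z z \<noteq> 0" "z \<in> span E" "\<And>i. i < k \<Longrightarrow> \<beta> z (u i) = 0"
      using xE yE xp span_add[OF xE yE] by metis
    have sz: "\<beta> (s z) (u i) = 0" if "i < k" for i
      using z(3) u that by (simp add: s_adjoint form_simps)
    \<comment> \<open>Parallelogram identity: the two norms add up to four times the non-zero norm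
      of \<open>z\<close>, so they cannot both vanish.\<close>
    have "\<beta> (z + s z) (z + s z) + \<beta> (z - s z) (z - s z) = 2 * 2 * \<beta> z z"
      by (simp add: form_simps s_form algebra_simps)
    moreover have "2 * 2 * \<beta> z z \<noteq> 0" using z two_nz by (metis mult_eq_0_iff)
    ultimately have "\<beta> (z + s z) (z + s z) \<noteq> 0 \<or> \<beta> (z - s z) (z - s z) \<noteq> 0" by (metis add_0)
    then obtain v c where v: "\<beta> v v \<noteq> 0" "v \<in> span E" "\<And>i. i < k \<Longrightarrow> \<beta> v (u i) = 0"
      and c: "s v = c *s v" "c = 1 \<or> c = - 1"
    proof (elim disjE)
      assume "\<beta> (z + s z) (z + s z) \<noteq> 0"
      thus thesis using that[of "z + s z" 1] z sz sE
        by (auto simp: form_simps s_simps add.commute intro: span_add)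
    next
      assume "\<beta> (z - s z) (z - s z) \<noteq> 0"
      thus thesis using that[of "z - s z" "- 1"] z sz sE
        by (auto simp: form_simps s_simps intro: span_diff)
    qed
    obtain t where t: "t * t = \<beta> v v" using sqrt_exists by blast
    define v' where "v' = inverse t *s v"
    have "inverse t * (inverse t * (t * t)) = 1" using t v by (auto simp: field_simps)
    hence v': "\<beta> v' v' = 1" "v' \<in> span E" "\<And>i. i < k \<Longrightarrow> \<beta> v' (u i) = 0" "s v' = c *s v'"
      using v c by (auto simp: v'_def form_simps t span_scale s_simps mult.commute)
    show ?case
      by (rule exI[of _ "u(k := v')"], rule exI[of _ "\<eta>(k := c)"])
        (use u gram v' c in \<open>auto simp: less_Suc_eq form_sym[of "u _" v']\<close>)
  qed auto
  thus ?thesis by blast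
qed

end

section \<open>Coordinates\<close>

text \<open>Vectors of every dimension live in one space of sequences, so that spans and dimensions
  come from a single vector space; dimension \<open>d\<close> means the span of the first
  \<open>d\<close> unit vectors.\<close>

definition fscale :: "'a :: field \<Rightarrow> (nat \<Rightarrow> 'a) \<Rightarrow> nat \<Rightarrow> 'a" where
  "fscale c x = (\<lambda>i. c * x i)"

interpretation fv: vector_space fscale
  by unfold_locales (auto simp: fscale_def fun_eq_iff algebra_simps)

definition unit_fv :: "nat \<Rightarrow> nat \<Rightarrow> 'a :: field" where
  "unit_fv k = (\<lambda>i. if i = k then 1 else 0)"

definition split_form :: "nat \<Rightarrow> (nat \<Rightarrow> 'a :: field) \<Rightarrow> (nat \<Rightarrow> 'a) \<Rightarrow> 'a" where
  "split_form N x y = (\<Sum>k<N. x k * y (N - 1 - k))"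

text \<open>Coordinates from \<open>N\<close> on are kept rather than set to 0, so that the unit
  matrix acts as the identity and an involutive matrix as an involution on all sequences.\<close>

definition act :: "nat \<Rightarrow> 'a :: field mat \<Rightarrow> (nat \<Rightarrow> 'a) \<Rightarrow> nat \<Rightarrow> 'a" where
  "act N A x = (\<lambda>i. if i < N then \<Sum>k<N. A $$ (i, k) * x k else x i)"

lemma fv_sum_apply: "(\<Sum>i\<in>A. f i) k = (\<Sum>i\<in>A. f i (k :: nat))" for f :: "'b \<Rightarrow> nat \<Rightarrow> 'a :: field"
  by (induction A rule: infinite_finite_induct) simp_all

lemma sum_reflect: "(\<Sum>k<N. f (N - 1 - k)) = (\<Sum>k<N. f k)" for f :: "nat \<Rightarrow> 'a :: comm_monoid_add"
  by (rule sum.reindex_bij_witness[of _ "\<lambda>k. N - 1 - k" "\<lambda>k. N - 1 - k"]) auto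

lemma split_form_sym: "split_form N x y = split_form N y x"
  unfolding split_form_def
  by (subst sum_reflect[symmetric]) (auto intro!: sum.cong)

lemma quadratic_space_split_form:
  assumes "(2 :: 'a :: alg_closed_field) \<noteq> 0"
  shows "quadratic_space fscale (split_form N :: (nat \<Rightarrow> 'a) \<Rightarrow> _)"
proof
  show "split_form N x y = split_form N y x" for x y :: "nat \<Rightarrow> 'a" by (rule split_form_sym)
qed (use assms in \<open>auto simp: split_form_def fscale_def algebra_simps sum.distrib sum_distrib_left\<close>)

lemma split_form_unit: "j < N \<Longrightarrow> split_form N x (unit_fv j) = x (N - 1 - j)"
proof -
  assume j: "j < N"
  have "split_form N x (unit_fv j) = (\<Sum>k<N. if k = N - 1 - j then x k else 0)"
    unfolding split_form_def by (rule sum.cong) (use j in \<open>auto simp: unit_fv_def\<close>)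
  thus ?thesis using j by simp
qed

lemma span_unit_iff: "x \<in> fv.span (unit_fv ` {..<N}) \<longleftrightarrow> (\<forall>i\<ge>N. x i = 0)" for x :: "nat \<Rightarrow> 'a :: field"
proof
  assume "x \<in> fv.span (unit_fv ` {..<N})"
  thus "\<forall>i\<ge>N. x i = 0"
    by (induction rule: fv.span_induct_alt) (auto simp: fscale_def unit_fv_def)
next
  assume *: "\<forall>i\<ge>N. x i = 0"
  have "x = (\<Sum>k<N. fscale (x k) (unit_fv k))"
  proof
    fix i
    have "(\<Sum>k<N. fscale (x k) (unit_fv k)) i = (\<Sum>k<N. if k = i then x i else 0)"
      unfolding fv_sum_apply by (rule sum.cong) (auto simp: fscale_def unit_fv_def)
    thus "x i = (\<Sum>k<N. fscale (x k) (unit_fv k)) i" using * by auto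
  qed
  also have "\<dots> \<in> fv.span (unit_fv ` {..<N})"
    by (intro fv.span_sum fv.span_scale fv.span_base) auto
  finally show "x \<in> fv.span (unit_fv ` {..<N})" .
qed

lemma inj_unit_fv: "inj (unit_fv :: nat \<Rightarrow> nat \<Rightarrow> 'a :: field)"
  by (auto simp: inj_def unit_fv_def fun_eq_iff)

lemma independent_unit: "fv.independent (unit_fv ` {..<N} :: (nat \<Rightarrow> 'a :: field) set)"
proof (induction N)
  case (Suc N)
  have "(unit_fv N :: nat \<Rightarrow> 'a) \<notin> fv.span (unit_fv ` {..<N})"
    unfolding span_unit_iff by (auto simp: unit_fv_def)
  thus ?case using Suc by (simp add: lessThan_Suc fv.independent_insert)
qed (simp add: fv.independent_empty)

text \<open>On all sequences the form has a radical, the sequences supported from \<open>N\<close>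
  on. Inside the coordinate space a non-zero coordinate is detected by the unit vector at the
  mirrored position.\<close>

lemma split_form_nondegenerate:
  fixes x :: "nat \<Rightarrow> 'a :: field"
  assumes "x \<in> fv.span (unit_fv ` {..<N})" "x \<noteq> 0"
  shows "\<exists>y\<in>fv.span (unit_fv ` {..<N}). split_form N x y \<noteq> 0"
proof -
  obtain i where i: "x i \<noteq> 0" using assms(2) by (auto simp: fun_eq_iff)
  hence "i < N" using assms(1) unfolding span_unit_iff by (meson not_less)
  hence "split_form N x (unit_fv (N - 1 - i)) \<noteq> 0" using i by (simp add: split_form_unit)
  thus ?thesis using \<open>i < N\<close> by (intro bexI[of _ "unit_fv (N - 1 - i)"] fv.span_base) auto
qed

lemma act_mult:
  assumes "A \<in> carrier_mat N N" "B \<in> carrier_mat N N"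
  shows "act N (A * B) x = act N A (act N B x)"
proof
  fix i
  show "act N (A * B) x i = act N A (act N B x) i"
  proof (cases "i < N")
    case True
    have "act N (A * B) x i = (\<Sum>k<N. (\<Sum>l<N. A $$ (i, l) * B $$ (l, k)) * x k)"
      unfolding act_def using True assms by (auto simp: scalar_prod_def lessThan_atLeast0 intro!: sum.cong)
    also have "\<dots> = (\<Sum>l<N. \<Sum>k<N. A $$ (i, l) * (B $$ (l, k) * x k))"
      by (subst sum.swap) (simp add: sum_distrib_right mult.assoc)
    also have "\<dots> = act N A (act N B x) i"
      unfolding act_def using True by (auto simp: sum_distrib_left intro!: sum.cong)
    finally show ?thesis .
  qed (simp add: act_def)
qed

lemma act_one: "act N (1\<^sub>m N) x = x"
proof
  fix i
  have "(\<Sum>k<N. 1\<^sub>m N $$ (i, k) * x k) = (\<Sum>k<N. if k = i then x i else 0)" if "i < N"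
    by (rule sum.cong) (use that in auto)
  thus "act N (1\<^sub>m N) x i = x i" by (simp add: act_def)
qed

lemma act_add: "act N A (x + y) = act N A x + act N A y"
  by (auto simp: act_def fun_eq_iff algebra_simps sum.distrib)

lemma act_scale: "act N A (fscale c x) = fscale c (act N A x)"
  by (auto simp: act_def fscale_def fun_eq_iff sum_distrib_left mult.left_commute)

lemma act_unit: "j < N \<Longrightarrow> i < N \<Longrightarrow> act N A (unit_fv j) i = A $$ (i, j)"
proof -
  assume "j < N" "i < N"
  moreover have "(\<Sum>k<N. A $$ (i, k) * unit_fv j k) = (\<Sum>k<N. if k = j then A $$ (i, j) else 0)"
    by (rule sum.cong) (auto simp: unit_fv_def)
  ultimately show ?thesis by (simp add: act_def)
qed

lemma act_span: "x \<in> fv.span (unit_fv ` {..<N}) \<Longrightarrow> act N A x \<in> fv.span (unit_fv ` {..<N})"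
  by (simp add: span_unit_iff act_def)

section \<open>The split orthogonal group\<close>

abbreviation orth :: "nat \<Rightarrow> 'a :: field mat set" where
  "orth N \<equiv> carrier (split_orthogonal N)"

lemma sq_mat:
  fixes A B C :: "'a :: field mat"
  shows "A \<in> carrier_mat N N \<Longrightarrow> B \<in> carrier_mat N N \<Longrightarrow> A * B \<in> carrier_mat N N"
    "A \<in> carrier_mat N N \<Longrightarrow> B \<in> carrier_mat N N \<Longrightarrow> C \<in> carrier_mat N N \<Longrightarrow> A * B * C = A * (B * C)"
    "A \<in> carrier_mat N N \<Longrightarrow> 1\<^sub>m N * A = A" "A \<in> carrier_mat N N \<Longrightarrow> A * 1\<^sub>m N = A"
    "A \<in> carrier_mat N N \<Longrightarrow> transpose_mat A \<in> carrier_mat N N"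
    "A \<in> carrier_mat N N \<Longrightarrow> B \<in> carrier_mat N N \<Longrightarrow>
      transpose_mat (A * B) = transpose_mat B * transpose_mat A"
  by (auto intro: transpose_mult)

lemma sq_mult_index:
  fixes A B :: "'a :: field mat"
  assumes "A \<in> carrier_mat N N" "B \<in> carrier_mat N N" "i < N" "j < N"
  shows "(A * B) $$ (i, j) = (\<Sum>k<N. A $$ (i, k) * B $$ (k, j))"
  using assms by (simp add: scalar_prod_def lessThan_atLeast0)

lemma split_gram_carrier [simp]: "split_gram N \<in> carrier_mat N N"
  by (simp add: split_gram_def)

lemma orthD: "g \<in> orth N \<Longrightarrow> g \<in> carrier_mat N N"
  "g \<in> orth N \<Longrightarrow> transpose_mat g * split_gram N * g = split_gram N"
  by (simp_all add: split_orthogonal_def)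

lemma gram_mult_index:
  fixes A :: "'a :: field mat"
  assumes "A \<in> carrier_mat N M" "i < N" "j < M"
  shows "(split_gram N * A) $$ (i, j) = A $$ (N - 1 - i, j)"
proof -
  have "(split_gram N * A) $$ (i, j) = (\<Sum>k<N. split_gram N $$ (i, k) * A $$ (k, j))"
    using assms by (simp add: scalar_prod_def lessThan_atLeast0 split_gram_def)
  also have "\<dots> = (\<Sum>k<N. if k = N - 1 - i then A $$ (N - 1 - i, j) else 0)"
    by (rule sum.cong) (use assms in \<open>auto simp: split_gram_def\<close>)
  finally show ?thesis using assms by simp
qed

lemma mult_gram_index:
  fixes A :: "'a :: field mat"
  assumes "A \<in> carrier_mat M N" "i < M" "j < N"
  shows "(A * split_gram N) $$ (i, j) = A $$ (i, N - 1 - j)"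
proof -
  have "(A * split_gram N) $$ (i, j) = (\<Sum>k<N. A $$ (i, k) * split_gram N $$ (k, j))"
    using assms by (simp add: scalar_prod_def lessThan_atLeast0 split_gram_def)
  also have "\<dots> = (\<Sum>k<N. if k = N - 1 - j then A $$ (i, N - 1 - j) else 0)"
    by (rule sum.cong) (use assms in \<open>auto simp: split_gram_def\<close>)
  finally show ?thesis using assms by simp
qed

lemma gram_gram: "split_gram N * split_gram N = (1\<^sub>m N :: 'a :: field mat)"
proof (rule eq_matI)
  fix i j assume "i < dim_row (1\<^sub>m N :: 'a mat)" "j < dim_col (1\<^sub>m N :: 'a mat)"
  hence ij: "i < N" "j < N" by simp_all
  show "(split_gram N * split_gram N) $$ (i, j) = (1\<^sub>m N :: 'a mat) $$ (i, j)"
    unfolding gram_mult_index[OF split_gram_carrier ij] using ij by (auto simp: split_gram_def)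
qed (simp_all add: split_gram_def)

lemma gram_transpose: "transpose_mat (split_gram N) = (split_gram N :: 'a :: field mat)"
  by (rule eq_matI) (auto simp: split_gram_def add.commute)

lemma gram_matrix_index:
  fixes A B :: "'a :: field mat"
  assumes "A \<in> carrier_mat N N" "B \<in> carrier_mat N N" "i < N" "j < N"
  shows "(transpose_mat A * split_gram N * B) $$ (i, j) =
    split_form N (\<lambda>k. A $$ (k, i)) (\<lambda>k. B $$ (k, j))"
proof -
  have tA: "transpose_mat A \<in> carrier_mat N N" using assms by simp
  have "(transpose_mat A * split_gram N * B) $$ (i, j) =
      (\<Sum>k<N. (transpose_mat A * split_gram N) $$ (i, k) * B $$ (k, j))"
    by (rule sq_mult_index) (use assms tA in \<open>simp_all add: sq_mat\<close>)
  also have "\<dots> = (\<Sum>k<N. A $$ (N - 1 - k, i) * B $$ (k, j))"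
    by (rule sum.cong) (use assms in \<open>auto simp: mult_gram_index[OF tA assms(3)]\<close>)
  also have "\<dots> = (\<Sum>k<N. A $$ (N - 1 - (N - 1 - k), i) * B $$ (N - 1 - k, j))"
    by (rule sum_reflect[symmetric])
  also have "\<dots> = split_form N (\<lambda>k. A $$ (k, i)) (\<lambda>k. B $$ (k, j))"
    unfolding split_form_def by (rule sum.cong) auto
  finally show ?thesis .
qed

lemma orth_iff:
  fixes A :: "'a :: field mat"
  assumes A: "A \<in> carrier_mat N N"
  shows "A \<in> orth N \<longleftrightarrow> (\<forall>i<N. \<forall>j<N.
    split_form N (\<lambda>k. A $$ (k, i)) (\<lambda>k. A $$ (k, j)) = (if i + j + 1 = N then 1 else 0))"
proof -
  have "A \<in> orth N \<longleftrightarrow> (\<forall>i<N. \<forall>j<N. (transpose_mat A * split_gram N * A) $$ (i, j) =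
      (split_gram N :: 'a mat) $$ (i, j))"
  proof (intro iffI allI impI)
    assume *: "\<forall>i<N. \<forall>j<N. (transpose_mat A * split_gram N * A) $$ (i, j) = (split_gram N :: 'a mat) $$ (i, j)"
    have "transpose_mat A * split_gram N * A = split_gram N"
      by (rule eq_matI) (use A * in \<open>simp_all add: split_gram_def del: index_mult_mat(1)\<close>)
    thus "A \<in> orth N" using A by (simp add: split_orthogonal_def)
  qed (simp only: orthD(2))
  moreover have "(split_gram N :: 'a mat) $$ (i, j) = (if i + j + 1 = N then 1 else 0)" if "i < N" "j < N" for i j
    using that by (simp add: split_gram_def)
  ultimately show ?thesis by (simp only: gram_matrix_index[OF A A] cong: imp_cong)
qed

lemma split_form_cong:
  "(\<And>k. k < N \<Longrightarrow> x k = x' k) \<Longrightarrow> (\<And>k. k < N \<Longrightarrow> y k = y' k) \<Longrightarrow> split_form N x y = split_form N x' y'"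
  unfolding split_form_def by (rule sum.cong) auto

lemma split_form_sums:
  fixes f g :: "nat \<Rightarrow> nat \<Rightarrow> 'a :: field"
  shows "split_form N (\<lambda>i. \<Sum>k<M. f k i * x k) (\<lambda>i. \<Sum>l<M. g l i * y l) =
    (\<Sum>k<M. \<Sum>l<M. x k * y l * split_form N (f k) (g l))"
proof -
  have "split_form N (\<lambda>i. \<Sum>k<M. f k i * x k) (\<lambda>i. \<Sum>l<M. g l i * y l) =
      (\<Sum>i<N. \<Sum>k<M. \<Sum>l<M. x k * y l * (f k i * g l (N - 1 - i)))"
    unfolding split_form_def sum_product by (intro sum.cong refl) (simp add: mult_ac)
  also have "\<dots> = (\<Sum>k<M. \<Sum>l<M. \<Sum>i<N. x k * y l * (f k i * g l (N - 1 - i)))"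
    by (subst sum.swap, rule sum.cong[OF refl], rule sum.swap)
  finally show ?thesis by (simp add: split_form_def sum_distrib_left)
qed

lemma split_form_act:
  fixes A :: "'a :: field mat"
  assumes "A \<in> orth N"
  shows "split_form N (act N A x) (act N A y) = split_form N x y"
proof -
  have "split_form N (act N A x) (act N A y) =
      split_form N (\<lambda>i. \<Sum>k<N. A $$ (i, k) * x k) (\<lambda>i. \<Sum>k<N. A $$ (i, k) * y k)"
    by (rule split_form_cong) (simp_all add: act_def)
  also have "\<dots> = (\<Sum>k<N. \<Sum>l<N. x k * y l * (if k + l + 1 = N then 1 else 0))"
    unfolding split_form_sums using assms orth_iff[OF orthD(1)[OF assms]] by (intro sum.cong refl) auto
  also have "\<dots> = (\<Sum>k<N. \<Sum>l<N. if l = N - 1 - k then x k * y l else 0)"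
    by (intro sum.cong refl) auto
  also have "\<dots> = split_form N x y"
    unfolding split_form_def by (intro sum.cong refl) simp
  finally show ?thesis .
qed

text \<open>The inverse of an isometry is its adjoint. Entrywise it is the reflection of the matrix
  in the antidiagonal, hence linear in the entries and compatible with upper triangular
  shape.\<close>

definition orth_inv :: "nat \<Rightarrow> 'a :: field mat \<Rightarrow> 'a mat" where
  "orth_inv N g = split_gram N * transpose_mat g * split_gram N"

lemma orth_inv_carrier [simp]: "g \<in> carrier_mat N N \<Longrightarrow> orth_inv N g \<in> carrier_mat N N"
  by (simp add: orth_inv_def sq_mat)

lemma orth_inv_index:
  assumes "g \<in> carrier_mat N N" "i < N" "j < N"
  shows "orth_inv N g $$ (i, j) = g $$ (N - 1 - j, N - 1 - i)"
proof -
  have "split_gram N * transpose_mat g \<in> carrier_mat N N" using assms by (simp add: sq_mat)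
  moreover have "transpose_mat g \<in> carrier_mat N N" using assms by simp
  ultimately show ?thesis
    using assms by (simp add: orth_inv_def mult_gram_index gram_mult_index)
qed

lemma orth_inv_left:
  assumes "g \<in> orth N"
  shows "orth_inv N g * g = 1\<^sub>m N"
proof -
  have g: "g \<in> carrier_mat N N" "transpose_mat g \<in> carrier_mat N N" using orthD[OF assms] by auto
  have "orth_inv N g * g = split_gram N * (transpose_mat g * split_gram N * g)"
    unfolding orth_inv_def using g by (simp add: sq_mat[where N = N])
  thus ?thesis by (simp add: orthD(2)[OF assms] gram_gram)
qed

lemma orth_inv_right:
  assumes "g \<in> orth N"
  shows "g * orth_inv N g = 1\<^sub>m N"
  using mat_mult_left_right_inverse[OF _ _ orth_inv_left[OF assms]] orthD(1)[OF assms] by simp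

lemma orth_mult:
  assumes "g \<in> orth N" "h \<in> orth N"
  shows "g * h \<in> orth N"
proof -
  have g: "g \<in> carrier_mat N N" "transpose_mat g \<in> carrier_mat N N" using orthD[OF assms(1)] by auto
  have h: "h \<in> carrier_mat N N" "transpose_mat h \<in> carrier_mat N N" using orthD[OF assms(2)] by auto
  have "transpose_mat (g * h) * split_gram N * (g * h) =
      transpose_mat h * (transpose_mat g * split_gram N * g) * h"
    using g h by (simp only: sq_mat[where N = N] split_gram_carrier)
  thus ?thesis
    using g h by (simp add: split_orthogonal_def orthD(2)[OF assms(1)] orthD(2)[OF assms(2)] sq_mat[where N = N])
qed

lemma orth_one: "1\<^sub>m N \<in> orth N"
  by (simp add: split_orthogonal_def sq_mat[where N = N])

lemma orth_inv_orth:
  assumes "g \<in> orth N"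
  shows "orth_inv N g \<in> orth N"
proof -
  have g: "g \<in> carrier_mat N N" "transpose_mat g \<in> carrier_mat N N" using orthD[OF assms] by auto
  have "transpose_mat (orth_inv N g) = split_gram N * g * split_gram N"
    using g by (simp only: orth_inv_def gram_transpose sq_mat[where N = N] split_gram_carrier transpose_transpose)
  hence "transpose_mat (orth_inv N g) * split_gram N * orth_inv N g =
      split_gram N * (g * ((split_gram N * split_gram N) * orth_inv N g))"
    using g by (simp only: sq_mat[where N = N] split_gram_carrier orth_inv_carrier)
  also have "\<dots> = split_gram N"
    using g by (simp only: gram_gram orth_inv_right[OF assms] sq_mat[where N = N] split_gram_carrier orth_inv_carrier)
  finally show ?thesis using g by (simp add: split_orthogonal_def)
qed

lemma split_orthogonal_simps [simp]:
  "x \<otimes>\<^bsub>split_orthogonal N\<^esub> y = x * y" "\<one>\<^bsub>split_orthogonal N\<^esub> = 1\<^sub>m N"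
  by (simp_all add: split_orthogonal_def)

lemma split_orthogonal_group: "group (split_orthogonal N :: 'a :: field mat monoid)"
proof (rule groupI)
  fix x :: "'a mat" assume x: "x \<in> orth N"
  show "\<exists>y\<in>orth N. y \<otimes>\<^bsub>split_orthogonal N\<^esub> x = \<one>\<^bsub>split_orthogonal N\<^esub>"
    using orth_inv_orth[OF x] orth_inv_left[OF x] by auto
next
  fix x y z :: "'a mat" assume "x \<in> orth N" "y \<in> orth N" "z \<in> orth N"
  thus "x \<otimes>\<^bsub>split_orthogonal N\<^esub> y \<otimes>\<^bsub>split_orthogonal N\<^esub> z =
      x \<otimes>\<^bsub>split_orthogonal N\<^esub> (y \<otimes>\<^bsub>split_orthogonal N\<^esub> z)"
    using sq_mat(2)[OF orthD(1)[of x N] orthD(1)[of y N] orthD(1)[of z N]] by simp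
next
  fix x :: "'a mat" assume "x \<in> orth N"
  thus "\<one>\<^bsub>split_orthogonal N\<^esub> \<otimes>\<^bsub>split_orthogonal N\<^esub> x = x"
    using sq_mat(3)[OF orthD(1)[of x N]] by simp
qed (simp_all add: orth_mult orth_one)

lemma split_orthogonal_inv:
  assumes "g \<in> orth N"
  shows "inv\<^bsub>split_orthogonal N\<^esub> g = orth_inv N g"
  using group.inv_equality[OF split_orthogonal_group] orth_inv_left[OF assms] orth_inv_orth[OF assms] assms
  by simp

lemma involutive_isometry_act:
  fixes S :: "'a :: alg_closed_field mat"
  assumes "(2 :: 'a) \<noteq> 0" and S: "S \<in> orth N" "S * S = 1\<^sub>m N"
  shows "involutive_isometry fscale (split_form N) (act N S)"
proof -
  interpret quadratic_space fscale "split_form N :: (nat \<Rightarrow> 'a) \<Rightarrow> _"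
    by (rule quadratic_space_split_form[OF assms(1)])
  show ?thesis
  proof
    show "act N S (act N S x) = x" for x
      using act_mult[OF orthD(1)[OF S(1)] orthD(1)[OF S(1)], of x] S(2) by (simp add: act_one)
  qed (simp_all add: act_add act_scale split_form_act[OF S(1)])
qed

section \<open>Clans and the normal form of involutions\<close>

definition centred :: "nat \<Rightarrow> int set" where
  "centred r = {- int r..int r}"

text \<open>In a clan \<open>(w, L)\<close> the involution \<open>w\<close> pairs the ends of the core edges of a matching, and \<open>L\<close>
  consists of the indices of its leaf edges. Requiring \<open>w\<close> to be the identity outside the index set
  makes the pair unique.\<close>

definition is_clan :: "nat \<Rightarrow> (int \<Rightarrow> int) \<Rightarrow> int set \<Rightarrow> bool" where
  "is_clan r w L \<longleftrightarrow> (\<forall>i\<in>centred r. w i \<in> centred r \<and> w (w i) = i \<and> w (- i) = - w i) \<and>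
     (\<forall>i. i \<notin> centred r \<longrightarrow> w i = i) \<and> L \<subseteq> {i \<in> centred r. w i = i} \<and> (\<forall>i\<in>L. - i \<in> L)"

definition clan_size :: "nat \<Rightarrow> (int \<Rightarrow> int) \<Rightarrow> int set \<Rightarrow> nat" where
  "clan_size r w L = card L + card {i \<in> centred r. i < w i}"

text \<open>The sign is attached to the column. For a clan, \<open>L\<close> consists of fixed
  points of \<open>w\<close>, so reading it off the row gives the same sign.\<close>

definition clan_mat :: "nat \<Rightarrow> (int \<Rightarrow> int) \<Rightarrow> int set \<Rightarrow> 'a :: field mat" where
  "clan_mat r w L = mat (2 * r + 1) (2 * r + 1) (\<lambda>(i, j).
     if int i - int r = w (int j - int r) then if int j - int r \<in> L then - 1 else 1 else 0)"

text \<open>The middle entry of an upper triangular isometry squares to 1. Fixing the value 1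
  discards the coset of -1 and makes the group connected.\<close>

definition std_borel :: "nat \<Rightarrow> 'a :: field mat set" where
  "std_borel r = {b \<in> orth (2 * r + 1). (\<forall>i<2 * r + 1. \<forall>j<i. b $$ (i, j) = 0) \<and> b $$ (r, r) = 1}"

definition pos :: "nat \<Rightarrow> int \<Rightarrow> nat" where
  "pos r i = nat (i + int r)"

lemma pos_simps:
  "i \<in> centred r \<Longrightarrow> int (pos r i) = i + int r" "i \<in> centred r \<Longrightarrow> pos r i < 2 * r + 1"
  "i \<in> centred r \<Longrightarrow> int (pos r i) - int r = i"
  "pos r (int k - int r) = k" "k < 2 * r + 1 \<longleftrightarrow> int k - int r \<in> centred r"
  by (auto simp: centred_def pos_def)

lemma pos_eq_iff: "x \<in> centred r \<Longrightarrow> int k - int r = x \<longleftrightarrow> k = pos r x"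
  by (auto simp: centred_def pos_def)

lemma centred_uminus: "- i \<in> centred r \<longleftrightarrow> i \<in> centred r"
  by (auto simp: centred_def)

lemma finite_centred [simp]: "finite (centred r)"
  by (simp add: centred_def)

section \<open>Clan matrices as signed permutation matrices\<close>

lemma clan_mat_carrier [simp]: "clan_mat r w L \<in> carrier_mat (2 * r + 1) (2 * r + 1)"
  by (simp add: clan_mat_def)

lemma mult_clan_mat_index:
  fixes A :: "'a :: field mat"
  assumes A: "A \<in> carrier_mat (2 * r + 1) (2 * r + 1)" and ij: "i < 2 * r + 1" "j < 2 * r + 1"
    and w: "w (int j - int r) \<in> centred r"
  shows "(A * clan_mat r w L) $$ (i, j) =
    (if int j - int r \<in> L then - 1 else 1) * A $$ (i, pos r (w (int j - int r)))"
proof -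
  have "(A * clan_mat r w L) $$ (i, j) = (\<Sum>k<2 * r + 1. A $$ (i, k) * clan_mat r w L $$ (k, j))"
    by (rule sq_mult_index[OF A clan_mat_carrier ij])
  also have "\<dots> = (\<Sum>k<2 * r + 1. if k = pos r (w (int j - int r))
      then (if int j - int r \<in> L then - 1 else 1) * A $$ (i, pos r (w (int j - int r))) else 0)"
  proof (rule sum.cong)
    fix k assume "k \<in> {..<2 * r + 1}"
    moreover have "int k - int r = w (int j - int r) \<longleftrightarrow> k = pos r (w (int j - int r))"
      by (rule pos_eq_iff[OF w])
    ultimately show "A $$ (i, k) * clan_mat r w L $$ (k, j) = (if k = pos r (w (int j - int r))
      then (if int j - int r \<in> L then - 1 else 1) * A $$ (i, pos r (w (int j - int r))) else 0)"
      using ij by (auto simp: clan_mat_def)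
  qed simp
  finally show ?thesis using pos_simps(2)[OF w] by simp
qed

lemma clan_mat_mult_index:
  fixes A :: "'a :: field mat"
  assumes clan: "is_clan r w L" and A: "A \<in> carrier_mat (2 * r + 1) (2 * r + 1)"
    and ij: "i < 2 * r + 1" "j < 2 * r + 1"
  shows "(clan_mat r w L * A) $$ (i, j) =
    (if int i - int r \<in> L then - 1 else 1) * A $$ (pos r (w (int i - int r)), j)"
proof -
  have i: "int i - int r \<in> centred r" using ij pos_simps(5) by blast
  hence w: "w (int i - int r) \<in> centred r" "w (w (int i - int r)) = int i - int r"
    using clan by (auto simp: is_clan_def)
  have "(clan_mat r w L * A) $$ (i, j) = (\<Sum>k<2 * r + 1. clan_mat r w L $$ (i, k) * A $$ (k, j))"
    by (rule sq_mult_index[OF clan_mat_carrier A ij])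
  also have "\<dots> = (\<Sum>k<2 * r + 1. if k = pos r (w (int i - int r))
      then (if int i - int r \<in> L then - 1 else 1) * A $$ (pos r (w (int i - int r)), j) else 0)"
  proof (rule sum.cong)
    fix k assume "k \<in> {..<2 * r + 1}"
    hence k: "k < 2 * r + 1" "int k - int r \<in> centred r" using pos_simps(5)[of k r] by auto
    have "int i - int r = w (int k - int r) \<longleftrightarrow> k = pos r (w (int i - int r))"
    proof
      assume "int i - int r = w (int k - int r)"
      hence "w (int i - int r) = int k - int r" using clan k(2) by (simp add: is_clan_def)
      thus "k = pos r (w (int i - int r))" by (simp add: pos_simps)
    next
      assume "k = pos r (w (int i - int r))"
      thus "int i - int r = w (int k - int r)" using w by (simp add: pos_simps)
    qed
    moreover have "int k - int r \<in> L \<longleftrightarrow> int i - int r \<in> L" if "int i - int r = w (int k - int r)"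
      using clan that w k by (auto simp: is_clan_def)
    ultimately show "clan_mat r w L $$ (i, k) * A $$ (k, j) = (if k = pos r (w (int i - int r))
      then (if int i - int r \<in> L then - 1 else 1) * A $$ (pos r (w (int i - int r)), j) else 0)"
      using ij k by (auto simp: clan_mat_def)
  qed simp
  finally show ?thesis using pos_simps(2)[OF w(1)] by simp
qed

lemma clan_mat_invol:
  assumes "is_clan r w L"
  shows "clan_mat r w L * clan_mat r w L = (1\<^sub>m (2 * r + 1) :: 'a :: field mat)"
proof (rule eq_matI)
  fix i j assume "i < dim_row (1\<^sub>m (2 * r + 1) :: 'a mat)" "j < dim_col (1\<^sub>m (2 * r + 1) :: 'a mat)"
  hence ij: "i < 2 * r + 1" "j < 2 * r + 1" by auto
  have j: "int j - int r \<in> centred r" using ij(2) by (simp only: pos_simps(5))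
  hence w: "w (int j - int r) \<in> centred r" "w (w (int j - int r)) = int j - int r"
    "int j - int r \<in> L \<Longrightarrow> w (int j - int r) = int j - int r"
    "w (int j - int r) \<in> L \<Longrightarrow> w (int j - int r) = int j - int r"
    using assms by (auto simp: is_clan_def)
  have "(clan_mat r w L * clan_mat r w L) $$ (i, j) = (if int j - int r \<in> L then - 1 else 1) *
      (clan_mat r w L :: 'a mat) $$ (i, pos r (w (int j - int r)))"
    by (rule mult_clan_mat_index[where w = w, OF clan_mat_carrier ij w(1)])
  also have "\<dots> = (1\<^sub>m (2 * r + 1) :: 'a mat) $$ (i, j)"
    using ij w pos_simps(2)[OF w(1)] by (auto simp: clan_mat_def pos_simps(3)[OF w(1)])
  finally show "(clan_mat r w L * clan_mat r w L) $$ (i, j) = (1\<^sub>m (2 * r + 1) :: 'a mat) $$ (i, j)" .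
qed (simp_all add: clan_mat_def)

lemma clan_mat_orth:
  assumes clan: "is_clan r w L"
  shows "(clan_mat r w L :: 'a :: field mat) \<in> orth (2 * r + 1)"
  unfolding orth_iff[OF clan_mat_carrier]
proof (intro allI impI)
  let ?N = "2 * r + 1"
  fix i j assume ij: "i < ?N" "j < ?N"
  let ?c = "\<lambda>j. if int j - int r \<in> L then - 1 else 1 :: 'a"
  have c: "int i - int r \<in> centred r" "int j - int r \<in> centred r"
    using ij by (simp_all only: pos_simps(5))
  hence w: "w (int i - int r) \<in> centred r" "w (int j - int r) \<in> centred r"
    using clan by (auto simp: is_clan_def)
  have "split_form ?N (\<lambda>k. (clan_mat r w L :: 'a mat) $$ (k, i)) (\<lambda>k. clan_mat r w L $$ (k, j)) =
      (\<Sum>k<?N. if k = pos r (w (int i - int r)) then ?c i * clan_mat r w L $$ (?N - 1 - pos r (w (int i - int r)), j) else 0)"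
    unfolding split_form_def
  proof (rule sum.cong)
    fix k assume "k \<in> {..<?N}"
    moreover have "int k - int r = w (int i - int r) \<longleftrightarrow> k = pos r (w (int i - int r))"
      by (rule pos_eq_iff[OF w(1)])
    ultimately show "(clan_mat r w L :: 'a mat) $$ (k, i) * clan_mat r w L $$ (?N - 1 - k, j) =
        (if k = pos r (w (int i - int r)) then ?c i * clan_mat r w L $$ (?N - 1 - pos r (w (int i - int r)), j) else 0)"
      using ij by (auto simp: clan_mat_def)
  qed simp
  also have "\<dots> = ?c i * clan_mat r w L $$ (?N - 1 - pos r (w (int i - int r)), j)"
    using pos_simps(2)[OF w(1)] by simp
  also have "\<dots> = (if - w (int i - int r) = w (int j - int r) then ?c i * ?c j else 0)"
  proof -
    have "?N - 1 - pos r (w (int i - int r)) < ?N" by simp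
    moreover have "int (?N - 1 - pos r (w (int i - int r))) - int r = - w (int i - int r)"
      using pos_simps(1,2)[OF w(1)] by linarith
    ultimately show ?thesis using ij by (simp add: clan_mat_def)
  qed
  also have "\<dots> = (if i + j + 1 = ?N then 1 else 0)"
  proof -
    have "w (- (int i - int r)) = - w (int i - int r)"
      using clan c unfolding is_clan_def by blast
    hence "- w (int i - int r) = w (int j - int r) \<longleftrightarrow> - (int i - int r) = int j - int r"
      using clan c centred_uminus[of "int i - int r" r] unfolding is_clan_def by metis
    moreover have "- (int i - int r) = int j - int r \<longleftrightarrow> i + j + 1 = ?N" by linarith
    moreover have "?c i * ?c j = 1" if "- (int i - int r) = int j - int r"
    proof -
      have "int j - int r \<in> L \<longleftrightarrow> int i - int r \<in> L"
        using clan that unfolding is_clan_def by (metis minus_minus)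
      thus ?thesis by simp
    qed
    ultimately show ?thesis by simp
  qed
  finally show "split_form ?N (\<lambda>k. (clan_mat r w L :: 'a mat) $$ (k, i)) (\<lambda>k. clan_mat r w L $$ (k, j)) =
      (if i + j + 1 = ?N then 1 else 0)" .
qed

text \<open>In the product of the columns \<open>i\<close> and \<open>N - 1 - i\<close>,
  triangularity demands \<open>k \<le> i\<close> from one factor and \<open>k \<ge> i\<close> from
  the other, so a single term remains.\<close>

lemma upper_triangular_diag_nonzero:
  fixes b :: "'a :: field mat"
  assumes b: "b \<in> orth N" and up: "\<And>i j. i < N \<Longrightarrow> j < i \<Longrightarrow> b $$ (i, j) = 0" and i: "i < N"
  shows "b $$ (i, i) * b $$ (N - 1 - i, N - 1 - i) = 1"
proof -
  have "1 = split_form N (\<lambda>k. b $$ (k, i)) (\<lambda>k. b $$ (k, N - 1 - i))"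
    using b i unfolding orth_iff[OF orthD(1)[OF b]] by simp
  also have "\<dots> = (\<Sum>k<N. if k = i then b $$ (i, i) * b $$ (N - 1 - i, N - 1 - i) else 0)"
    unfolding split_form_def
  proof (rule sum.cong)
    fix k assume "k \<in> {..<N}"
    thus "b $$ (k, i) * b $$ (N - 1 - k, N - 1 - i) =
        (if k = i then b $$ (i, i) * b $$ (N - 1 - i, N - 1 - i) else 0)"
      using up[of k i] up[of "N - 1 - k" "N - 1 - i"] i by (cases k i rule: linorder_cases) auto
  qed simp
  finally show ?thesis using i by simp
qed

text \<open>The relation equates, up to sign, the non-zero diagonal entry of \<open>b\<close> at
  \<open>w j\<close> with its entry in row \<open>w' (w j)\<close> and column \<open>j\<close>.
  Triangularity gives \<open>w' (w j) \<le> j\<close>. The same inequality at \<open>- j\<close>,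
  with compatibility under negation, turns this into equality.\<close>

lemma clan_mat_unique:
  fixes b :: "'a :: field mat"
  assumes two: "(2 :: 'a) \<noteq> 0"
    and clan: "is_clan r w L" "is_clan r w' L'"
    and b: "b \<in> std_borel r" and eq: "b * clan_mat r w L = clan_mat r w' L' * b"
  shows "w = w'" "L = L'"
proof -
  let ?N = "2 * r + 1"
  have bO: "b \<in> orth ?N" and up: "\<And>i j. i < ?N \<Longrightarrow> j < i \<Longrightarrow> b $$ (i, j) = 0"
    using b by (auto simp: std_borel_def)
  note bc = orthD(1)[OF bO]
  have diag: "b $$ (i, i) \<noteq> 0" if "i < ?N" for i
    using upper_triangular_diag_nonzero[OF bO up that] by auto
  have entries: "(if j \<in> L then - 1 else 1) * b $$ (pos r i, pos r (w j)) =
      (if i \<in> L' then - 1 else 1) * b $$ (pos r (w' i), pos r j)"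
    if "i \<in> centred r" "j \<in> centred r" for i j
    using mult_clan_mat_index[OF bc pos_simps(2)[OF that(1)] pos_simps(2)[OF that(2)], of w L]
      clan_mat_mult_index[OF clan(2) bc pos_simps(2)[OF that(1)] pos_simps(2)[OF that(2)]]
      that clan(1) eq by (auto simp: pos_simps(3) is_clan_def)
  have le: "w' (w j) \<le> j" if "j \<in> centred r" for j
  proof -
    have wj: "w j \<in> centred r" using clan that by (auto simp: is_clan_def)
    hence ww: "w' (w j) \<in> centred r" using clan by (auto simp: is_clan_def)
    have "b $$ (pos r (w' (w j)), pos r j) \<noteq> 0"
      using entries[OF wj that] diag[OF pos_simps(2)[OF wj]] by (auto split: if_splits)
    hence "\<not> pos r j < pos r (w' (w j))" using up[OF pos_simps(2)[OF ww]] by blast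
    thus ?thesis using pos_simps(1)[OF that] pos_simps(1)[OF ww] by linarith
  qed
  have bij: "w' (w (w (w' j))) = j" "w (w' j) \<in> centred r" if "j \<in> centred r" for j
    using that clan by (auto simp: is_clan_def)
  have fix': "w' (w j) = j" if "j \<in> centred r" for j
  proof -
    have mem: "w' (w j) \<in> centred r" "- j \<in> centred r" "w j \<in> centred r" "w' (w (- j)) = - w' (w j)"
      using clan that centred_uminus[of j r] by (auto simp: is_clan_def)
    show ?thesis using le[OF that] le[OF mem(2)] mem(4) by linarith
  qed
  have ww: "w j = w' j" if "j \<in> centred r" for j
    using fix'[OF that] that clan by (metis is_clan_def)
  show "w = w'"
  proof
    fix j show "w j = w' j" using ww[of j] clan by (cases "j \<in> centred r") (auto simp: is_clan_def)
  qed
  have one: "(1 :: 'a) \<noteq> - 1" using two by (metis add.right_inverse one_add_one)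
  \<comment> \<open>At a fixed point the relation compares two signs in front of the same non-zero
    diagonal entry, and 1 differs from -1.\<close>
  have "j \<in> L \<longleftrightarrow> j \<in> L'" if "j \<in> centred r" "w j = j" for j
    using entries[OF that(1,1)] ww[OF that(1)] that(2) diag[OF pos_simps(2)[OF that(1)]] one
    by (auto split: if_splits)
  thus "L = L'" using clan \<open>w = w'\<close> by (auto simp: is_clan_def)
qed

lemma orth_uminus: "b \<in> orth N \<Longrightarrow> - b \<in> orth N" for b :: "'a :: field mat"
proof -
  assume b: "b \<in> orth N"
  note bc = orthD(1)[OF b]
  have "split_form N (\<lambda>k. (- b) $$ (k, i)) (\<lambda>k. (- b) $$ (k, j)) =
      split_form N (\<lambda>k. b $$ (k, i)) (\<lambda>k. b $$ (k, j))" if "i < N" "j < N" for i j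
    unfolding split_form_def by (rule sum.cong) (use bc that in auto)
  thus ?thesis using b bc orth_iff[OF bc] orth_iff[of "- b" N] by simp
qed

text \<open>An adapted frame only yields an upper triangular isometry. The sign can be corrected
  afterwards, because -1 is central and conjugation does not see it.\<close>

lemma std_borel_sign:
  fixes b :: "'a :: field mat"
  assumes b: "b \<in> orth (2 * r + 1)" and up: "\<And>i j. i < 2 * r + 1 \<Longrightarrow> j < i \<Longrightarrow> b $$ (i, j) = 0"
  shows "b \<in> std_borel r \<or> - b \<in> std_borel r"
proof -
  have "b $$ (r, r) * b $$ (r, r) = 1"
    using upper_triangular_diag_nonzero[OF b up, of r] by simp
  hence "b $$ (r, r) = 1 \<or> b $$ (r, r) = - 1" by (rule square_eq_1_iff[THEN iffD1])
  thus ?thesis using b orth_uminus[OF b] up orthD(1)[OF b] by (auto simp: std_borel_def)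
qed

text \<open>The vectors of a normal frame become the columns of \<open>b\<close>: their Gram matrix
  says that \<open>b\<close> is an isometry, adaptedness to the flag says that it is upper
  triangular, and the action of \<open>s\<close> on them is the clan matrix.\<close>

theorem clan_normal_form:
  fixes S :: "'a :: alg_closed_field mat"
  assumes two: "(2 :: 'a) \<noteq> 0" and S: "S \<in> orth (2 * r + 1)" "S * S = 1\<^sub>m (2 * r + 1)"
  obtains b w L where "b \<in> std_borel r" "is_clan r w L" "S * b = b * clan_mat r w L"
proof -
  define N where N: "N = 2 * r + 1"
  note S = S[folded N]
  note Sc = orthD(1)[OF S(1)]
  interpret involutive_isometry fscale "split_form N" "act N S"
    by (rule involutive_isometry_act[OF two S])
  let ?I = "centred r" and ?e = "\<lambda>i. unit_fv (pos r i) :: nat \<Rightarrow> 'a"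
  have posN: "pos r i < N" if "i \<in> ?I" for i using pos_simps(2)[OF that] by (simp only: N)
  have c: "int j - int r \<in> ?I" if "j < N" for j using that by (simp only: pos_simps(5) N)
  \<comment> \<open>Initial segments of the centred index set turn into standard coordinate
    subspaces, so membership in a flag space amounts to vanishing below the diagonal.\<close>
  have img: "?e ` {k \<in> ?I. k \<le> i} = unit_fv ` {..<pos r i + 1}" if "i \<in> ?I" for i
  proof -
    have eq: "pos r ` {k \<in> ?I. k \<le> i} = {..<pos r i + 1}"
    proof (intro equalityI subsetI)
      fix k assume "k \<in> {..<pos r i + 1}"
      hence k: "k \<le> pos r i" by simp
      hence "int k \<le> i + int r" using pos_simps(1)[OF that] by linarith
      moreover have "i \<le> int r" using that by (simp add: centred_def)
      ultimately have "int k - int r \<in> {k \<in> ?I. k \<le> i}" by (auto simp: centred_def)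
      thus "k \<in> pos r ` {k \<in> ?I. k \<le> i}" by (rule rev_image_eqI) (simp add: pos_simps(4))
    qed (auto simp: pos_def)
    have "?e ` {k \<in> ?I. k \<le> i} = unit_fv ` pos r ` {k \<in> ?I. k \<le> i}"
      by (rule image_image[symmetric])
    also note eq
    finally show ?thesis .
  qed
  have imgI: "?e ` ?I = unit_fv ` {..<N}"
  proof -
    have "{k \<in> ?I. k \<le> int r} = ?I" by (auto simp: centred_def)
    moreover have "pos r (int r) + 1 = N" by (simp add: pos_def N)
    ultimately show ?thesis using img[of "int r"] by (simp add: centred_def)
  qed
  have dual: "N - 1 - pos r i = pos r (- i)" if "i \<in> ?I" for i
    using that by (auto simp: pos_def centred_def N)
  have unit_gram: "split_form N (?e i) (?e j) = (if i + j = 0 then 1 else 0)" if "i \<in> ?I" "j \<in> ?I" for i j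
  proof -
    have "split_form N (?e i) (?e j) = (if pos r (- j) = pos r i then 1 else 0)"
      unfolding split_form_unit[OF posN[OF that(2)]] dual[OF that(2)] by (simp add: unit_fv_def)
    also have "pos r (- j) = pos r i \<longleftrightarrow> i + j = 0" using that by (auto simp: pos_def centred_def)
    finally show ?thesis .
  qed
  have wf: "weak_frame ?I ?e"
    using unit_gram centred_uminus by (auto simp: weak_frame_def)
  have stab: "act N S (?e i) \<in> fv.span (?e ` ?I)" if "i \<in> ?I" for i
    unfolding imgI by (intro act_span fv.span_base imageI) (use posN[OF that] in simp)
  from normal_frame_exists[OF wf stab] obtain u w \<epsilon> where
    uF: "\<And>i. i \<in> ?I \<Longrightarrow> u i \<in> flag ?I ?e i" and nf: "normal_frame ?I u w \<epsilon>"
    by blast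
  have low: "u i k = 0" if "i \<in> ?I" "k > pos r i" for i k
    using uF[OF that(1)] img[OF that(1)] that(2) by (simp add: flag_def span_unit_iff)
  define b where "b = mat N N (\<lambda>(k, j). u (int j - int r) k)"
  have bc: "b \<in> carrier_mat N N" by (simp add: b_def)
  have bO: "b \<in> orth N"
    unfolding orth_iff[OF bc]
  proof (intro allI impI)
    fix i j assume ij: "i < N" "j < N"
    have "split_form N (\<lambda>k. b $$ (k, i)) (\<lambda>k. b $$ (k, j)) =
        split_form N (u (int i - int r)) (u (int j - int r))"
      by (rule split_form_cong) (use ij in \<open>auto simp: b_def\<close>)
    also have "\<dots> = (if (int i - int r) + (int j - int r) = 0 then 1 else 0)"
      using nf c[OF ij(1)] c[OF ij(2)] by (simp add: normal_frame_def)
    also have "(int i - int r) + (int j - int r) = 0 \<longleftrightarrow> i + j + 1 = N" unfolding N by linarith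
    finally show "split_form N (\<lambda>k. b $$ (k, i)) (\<lambda>k. b $$ (k, j)) = (if i + j + 1 = N then 1 else 0)" .
  qed
  have up: "b $$ (i, j) = 0" if "i < N" "j < i" for i j
    using low[OF c, of j i] that by (simp add: b_def pos_simps(4))
  define w' where "w' = (\<lambda>i. if i \<in> ?I then w i else i)"
  define L where "L = {i \<in> ?I. \<epsilon> i = - 1}"
  have one: "(1 :: 'a) \<noteq> - 1" using two by (metis add.right_inverse one_add_one)
  have clan: "is_clan r w' L"
    using nf one centred_uminus by (auto simp: is_clan_def w'_def L_def normal_frame_def)
  have eq: "S * b = b * clan_mat r w' L"
  proof (rule eq_matI)
    fix i j assume "i < dim_row (b * clan_mat r w' L)" "j < dim_col (b * clan_mat r w' L)"
    hence ij: "i < N" "j < N" by (simp_all add: b_def clan_mat_def N)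
    let ?j = "int j - int r"
    have wj: "w' ?j \<in> ?I" using clan c[OF ij(2)] by (simp add: is_clan_def)
    have "(S * b) $$ (i, j) = act N S (u ?j) i"
      unfolding sq_mult_index[OF Sc bc ij] act_def using ij by (auto simp: b_def intro!: sum.cong)
    also have "\<dots> = \<epsilon> ?j * u (w' ?j) i"
      using nf c[OF ij(2)] by (simp add: normal_frame_def w'_def fscale_def)
    also have "\<epsilon> ?j = (if ?j \<in> L then - 1 else 1)"
      using nf c[OF ij(2)] by (auto simp: L_def normal_frame_def)
    also have "u (w' ?j) i = b $$ (i, pos r (w' ?j))"
      using ij posN[OF wj] pos_simps(3)[OF wj] by (simp add: b_def)
    finally show "(S * b) $$ (i, j) = (b * clan_mat r w' L) $$ (i, j)"
      unfolding mult_clan_mat_index[where w = w', OF bc[unfolded N] ij[unfolded N] wj] .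
  qed (use Sc bc in \<open>simp_all add: clan_mat_def N\<close>)
  from std_borel_sign[OF bO[unfolded N] up[unfolded N]] show thesis
  proof
    assume "b \<in> std_borel r" thus thesis using that clan eq by blast
  next
    assume "- b \<in> std_borel r"
    moreover have "S * (- b) = - b * clan_mat r w' L"
      using Sc bc eq clan_mat_carrier[of r w' L, where 'a = 'a, folded N]
      by simp
    ultimately show thesis using that clan by blast
  qed
qed

text \<open>An invertible matrix has a non-zero term in the Leibniz expansion of its determinant.
  Along the permutation of that term, comparing the entries \<open>(i, p i)\<close> of both sides of
  the intertwining relation lets the non-zero entry of \<open>Q\<close> cancel.\<close>

lemma diag_similar_count:
  fixes Q :: "'a :: field mat"
  assumes Q: "Q \<in> carrier_mat N N" "Q' \<in> carrier_mat N N" "Q' * Q = 1\<^sub>m N"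
    and eq: "mat N N (\<lambda>(i, j). if i = j then \<eta> i else 0) * Q = Q * mat N N (\<lambda>(i, j). if i = j then \<eta>' i else 0)"
  obtains \<pi> where "bij_betw \<pi> {..<N} {..<N}" "\<And>i. i < N \<Longrightarrow> \<eta> i = \<eta>' (\<pi> i)"
proof -
  have "det Q' * det Q = 1" using det_mult[OF Q(2,1)] Q(3) by simp
  hence "det Q \<noteq> 0" by auto
  hence "\<exists>p\<in>{p. p permutes {0..<N}}. signof p * (\<Prod>i = 0..<N. Q $$ (i, p i)) \<noteq> 0"
    unfolding det_def'[OF Q(1)] by (meson sum.not_neutral_contains_not_neutral)
  then obtain p where p: "p permutes {0..<N}" "(\<Prod>i = 0..<N. Q $$ (i, p i)) \<noteq> 0" by auto
  have nz: "Q $$ (i, p i) \<noteq> 0" if "i < N" for i using p(2) that by auto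
  have bij: "bij_betw p {..<N} {..<N}" using p(1) by (simp add: permutes_imp_bij lessThan_atLeast0)
  have "\<eta> i = \<eta>' (p i)" if i: "i < N" for i
  proof -
    have pi: "p i < N" using bij i by (auto simp: bij_betw_def)
    have "(\<Sum>k<N. (if i = k then \<eta> i else 0) * Q $$ (k, p i)) =
        (\<Sum>k<N. Q $$ (i, k) * (if k = p i then \<eta>' k else 0))"
      using arg_cong[OF eq, of "\<lambda>M. M $$ (i, p i)"] Q(1) i pi
      by (subst (asm) (1 2) sq_mult_index[where N = N]) auto
    moreover have "(\<Sum>k<N. (if i = k then \<eta> i else 0) * Q $$ (k, p i)) =
        (\<Sum>k<N. if i = k then \<eta> i * Q $$ (i, p i) else 0)"
      by (rule sum.cong) auto
    moreover have "(\<Sum>k<N. Q $$ (i, k) * (if k = p i then \<eta>' k else 0)) =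
        (\<Sum>k<N. if k = p i then \<eta>' (p i) * Q $$ (i, p i) else 0)"
      by (rule sum.cong) auto
    ultimately show ?thesis using i pi nz[OF i] by simp
  qed
  thus thesis using that bij by blast
qed

section \<open>Conjugacy of involutions\<close>

definition dmat :: "nat \<Rightarrow> (nat \<Rightarrow> 'a :: field) \<Rightarrow> 'a mat" where
  "dmat N \<eta> = mat N N (\<lambda>(i, j). if i = j then \<eta> i else 0)"

lemma dmat_carrier [simp]: "dmat N \<eta> \<in> carrier_mat N N"
  by (simp add: dmat_def)

lemma dmat_mult_index:
  assumes "A \<in> carrier_mat N N" "i < N" "j < N"
  shows "(dmat N \<eta> * A) $$ (i, j) = \<eta> i * A $$ (i, j)" "(A * dmat N \<eta>) $$ (i, j) = A $$ (i, j) * \<eta> j"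
proof -
  have "(dmat N \<eta> * A) $$ (i, j) = (\<Sum>k<N. if k = i then \<eta> i * A $$ (i, j) else 0)"
    unfolding sq_mult_index[OF dmat_carrier assms]
    by (rule sum.cong) (use assms in \<open>auto simp: dmat_def\<close>)
  thus "(dmat N \<eta> * A) $$ (i, j) = \<eta> i * A $$ (i, j)" using assms by simp
  have "(A * dmat N \<eta>) $$ (i, j) = (\<Sum>k<N. if k = j then A $$ (i, j) * \<eta> j else 0)"
    unfolding sq_mult_index[OF assms(1) dmat_carrier assms(2,3)]
    by (rule sum.cong) (use assms in \<open>auto simp: dmat_def\<close>)
  thus "(A * dmat N \<eta>) $$ (i, j) = A $$ (i, j) * \<eta> j" using assms by simp
qed

lemma similar_mat_intertwineI:
  fixes A B :: "'a :: field mat"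
  assumes "A \<in> carrier_mat N N" "B \<in> carrier_mat N N" "Q \<in> carrier_mat N N" "Q' \<in> carrier_mat N N"
    and inv: "Q' * Q = 1\<^sub>m N" and eq: "A * Q = Q * B"
  shows "similar_mat A B"
proof -
  have inv': "Q * Q' = 1\<^sub>m N" using mat_mult_left_right_inverse[OF assms(4,3) inv] .
  have "A = A * (Q * Q')" using assms(1) inv' by simp
  also have "\<dots> = A * Q * Q'" using sq_mat(2)[OF assms(1,3,4)] by simp
  also have "\<dots> = Q * B * Q'" by (simp only: eq)
  finally have "similar_mat_wit A B Q Q'"
    using assms inv' by (auto simp: similar_mat_wit_def Let_def)
  thus ?thesis by (auto simp: similar_mat_def)
qed

lemma similar_mat_intertwineE:
  fixes A B :: "'a :: field mat"
  assumes "similar_mat A B" "A \<in> carrier_mat N N"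
  obtains Q Q' where "Q \<in> carrier_mat N N" "Q' \<in> carrier_mat N N" "Q' * Q = 1\<^sub>m N" "Q * Q' = 1\<^sub>m N"
    "A * Q = Q * B" "B \<in> carrier_mat N N"
proof -
  obtain Q Q' where w: "similar_mat_wit A B Q Q'" using assms(1) by (auto simp: similar_mat_def)
  hence c: "Q \<in> carrier_mat N N" "Q' \<in> carrier_mat N N" "B \<in> carrier_mat N N"
    and e: "Q * Q' = 1\<^sub>m N" "Q' * Q = 1\<^sub>m N" "A = Q * B * Q'"
    using assms(2) by (auto simp: similar_mat_wit_def Let_def)
  have "A * Q = Q * B" unfolding e(3) using c e(2) by (simp add: sq_mat[where N = N])
  thus thesis using that c e by blast
qed

lemma dmat_similar_iff:
  fixes \<eta> \<eta>' :: "nat \<Rightarrow> 'a :: field"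
  shows "similar_mat (dmat N \<eta>) (dmat N \<eta>') \<longleftrightarrow>
    (\<exists>\<pi>. bij_betw \<pi> {..<N} {..<N} \<and> (\<forall>i<N. \<eta> i = \<eta>' (\<pi> i)))"
proof
  assume "similar_mat (dmat N \<eta>) (dmat N \<eta>')"
  then obtain Q Q' where Q: "Q \<in> carrier_mat N N" "Q' \<in> carrier_mat N N" "Q' * Q = 1\<^sub>m N"
    "dmat N \<eta> * Q = Q * dmat N \<eta>'" by (rule similar_mat_intertwineE[OF _ dmat_carrier])
  obtain \<pi> where "bij_betw \<pi> {..<N} {..<N}" "\<And>i. i < N \<Longrightarrow> \<eta> i = \<eta>' (\<pi> i)"
    using diag_similar_count[OF Q(1-3) Q(4)[unfolded dmat_def]] by blast
  thus "\<exists>\<pi>. bij_betw \<pi> {..<N} {..<N} \<and> (\<forall>i<N. \<eta> i = \<eta>' (\<pi> i))" by blast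
next
  assume "\<exists>\<pi>. bij_betw \<pi> {..<N} {..<N} \<and> (\<forall>i<N. \<eta> i = \<eta>' (\<pi> i))"
  then obtain \<pi> where \<pi>: "bij_betw \<pi> {..<N} {..<N}" "\<forall>i<N. \<eta> i = \<eta>' (\<pi> i)" by blast
  define Q :: "'a mat" where "Q = mat N N (\<lambda>(i, j). if j = \<pi> i then 1 else 0)"
  have Q: "Q \<in> carrier_mat N N" by (simp add: Q_def)
  have lt: "\<pi> i < N" if "i < N" for i using \<pi>(1) that by (auto simp: bij_betw_def)
  have "Q * transpose_mat Q = 1\<^sub>m N"
  proof (rule eq_matI)
    fix i j assume "i < dim_row (1\<^sub>m N :: 'a mat)" "j < dim_col (1\<^sub>m N :: 'a mat)"
    hence ij: "i < N" "j < N" by auto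
    have "(Q * transpose_mat Q) $$ (i, j) = (\<Sum>k<N. if k = \<pi> i then (if \<pi> i = \<pi> j then 1 else 0) else 0)"
      unfolding sq_mult_index[OF Q sq_mat(5)[OF Q] ij]
      by (rule sum.cong) (use ij in \<open>auto simp: Q_def\<close>)
    also have "\<dots> = (if \<pi> i = \<pi> j then 1 else 0)" using lt[OF ij(1)] by simp
    also have "\<pi> i = \<pi> j \<longleftrightarrow> i = j" using \<pi>(1) ij by (auto simp: bij_betw_def inj_on_def)
    finally show "(Q * transpose_mat Q) $$ (i, j) = (1\<^sub>m N :: 'a mat) $$ (i, j)" using ij by simp
  qed (use Q in auto)
  hence "transpose_mat Q * Q = 1\<^sub>m N"
    using mat_mult_left_right_inverse[OF Q sq_mat(5)[OF Q]] by blast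
  moreover have "dmat N \<eta> * Q = Q * dmat N \<eta>'"
  proof (rule eq_matI)
    fix i j assume "i < dim_row (Q * dmat N \<eta>')" "j < dim_col (Q * dmat N \<eta>')"
    hence ij: "i < N" "j < N" using Q by (auto simp: dmat_def)
    show "(dmat N \<eta> * Q) $$ (i, j) = (Q * dmat N \<eta>') $$ (i, j)"
      unfolding dmat_mult_index[OF Q ij] using \<pi>(2) ij by (auto simp: Q_def)
  qed (use Q in \<open>auto simp: dmat_def\<close>)
  ultimately show "similar_mat (dmat N \<eta>) (dmat N \<eta>')"
    by (intro similar_mat_intertwineI[of _ N _ Q "transpose_mat Q"]) (use Q in \<open>auto simp: sq_mat\<close>)
qed

lemma dmat_sign_similar_iff:
  fixes \<eta> \<eta>' :: "nat \<Rightarrow> 'a :: field"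
  assumes two: "(2 :: 'a) \<noteq> 0"
    and \<eta>: "\<And>i. i < N \<Longrightarrow> \<eta> i = (if i \<in> A then - 1 else 1)"
    and \<eta>': "\<And>i. i < N \<Longrightarrow> \<eta>' i = (if i \<in> A' then - 1 else 1)"
    and A: "A \<subseteq> {..<N}" "A' \<subseteq> {..<N}"
  shows "similar_mat (dmat N \<eta>) (dmat N \<eta>') \<longleftrightarrow> card A = card A'"
proof -
  have one: "(1 :: 'a) \<noteq> - 1" using two by (metis add.right_inverse one_add_one)
  show ?thesis
    unfolding dmat_similar_iff
  proof
    assume "\<exists>\<pi>. bij_betw \<pi> {..<N} {..<N} \<and> (\<forall>i<N. \<eta> i = \<eta>' (\<pi> i))"
    then obtain \<pi> where \<pi>: "bij_betw \<pi> {..<N} {..<N}" "\<And>i. i < N \<Longrightarrow> \<eta> i = \<eta>' (\<pi> i)" by blast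
    have iff: "i \<in> A \<longleftrightarrow> \<pi> i \<in> A'" if "i < N" for i
    proof -
      have "\<pi> i < N" using \<pi>(1) that by (auto simp: bij_betw_def)
      thus ?thesis using \<pi>(2)[OF that] \<eta>[OF that] \<eta>'[of "\<pi> i"] one by (auto split: if_splits)
    qed
    have "\<pi> ` A = A'"
    proof (intro equalityI subsetI)
      fix j assume "j \<in> A'"
      then obtain i where "i < N" "j = \<pi> i" using A(2) \<pi>(1) by (auto simp: bij_betw_def)
      thus "j \<in> \<pi> ` A" using iff \<open>j \<in> A'\<close> by blast
    qed (use A iff in auto)
    moreover have "inj_on \<pi> A" using inj_on_subset \<pi>(1) A(1) unfolding bij_betw_def by blast
    ultimately show "card A = card A'" using card_image[of \<pi> A] by simp
  next
    assume eq: "card A = card A'"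
    have fin: "finite A" "finite A'" using A finite_subset by auto
    have "card ({..<N} - A) = card ({..<N} - A')"
      using eq A fin by (simp add: card_Diff_subset)
    then obtain f g where f: "bij_betw f A A'" and g: "bij_betw g ({..<N} - A) ({..<N} - A')"
      using eq fin finite_same_card_bij[of A A'] finite_same_card_bij[of "{..<N} - A" "{..<N} - A'"] by auto
    define \<pi> where "\<pi> i = (if i \<in> A then f i else g i)" for i
    have "bij_betw \<pi> (A \<union> ({..<N} - A)) (A' \<union> ({..<N} - A'))"
      unfolding \<pi>_def by (rule bij_betw_disjoint_Un[OF f g]) auto
    hence bij: "bij_betw \<pi> {..<N} {..<N}" using A by (simp add: Un_absorb1)
    have "\<eta> i = \<eta>' (\<pi> i)" if i: "i < N" for i
    proof -
      have "\<pi> i \<in> A' \<longleftrightarrow> i \<in> A" using f g i by (auto simp: \<pi>_def bij_betw_def)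
      moreover have "\<pi> i < N" using bij i by (auto simp: bij_betw_def)
      ultimately show ?thesis using \<eta>[OF i] \<eta>' by auto
    qed
    thus "\<exists>\<pi>. bij_betw \<pi> {..<N} {..<N} \<and> (\<forall>i<N. \<eta> i = \<eta>' (\<pi> i))" using bij by blast
  qed
qed

lemma orthonormal_diagonalization:
  fixes S :: "'a :: alg_closed_field mat"
  assumes two: "(2 :: 'a) \<noteq> 0" and S: "S \<in> orth N" "S * S = 1\<^sub>m N"
  obtains P \<eta> where "P \<in> carrier_mat N N" "transpose_mat P * split_gram N * P = 1\<^sub>m N" "S * P = P * dmat N \<eta>"
proof -
  note Sc = orthD(1)[OF S(1)]
  interpret involutive_isometry fscale "split_form N" "act N S"
    by (rule involutive_isometry_act[OF two S])
  let ?E = "unit_fv ` {..<N} :: (nat \<Rightarrow> 'a) set"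
  have card: "card ?E = N" using card_image[OF inj_on_subset[OF inj_unit_fv subset_UNIV], of "{..<N}"] by simp
  have "\<exists>u \<eta>. (\<forall>i<card ?E. u i \<in> fv.span ?E \<and> act N S (u i) = fscale (\<eta> i) (u i) \<and> (\<eta> i = 1 \<or> \<eta> i = - 1)) \<and>
    (\<forall>i<card ?E. \<forall>j<card ?E. split_form N (u i) (u j) = (if i = j then 1 else 0))"
    by (rule orthonormal_eigenbasis_exists)
      (use independent_unit split_form_nondegenerate act_span[OF fv.span_base, of _ N S] in auto)
  then obtain u \<eta> where u: "\<And>i. i < N \<Longrightarrow> act N S (u i) = fscale (\<eta> i) (u i)"
    and gram: "\<And>i j. i < N \<Longrightarrow> j < N \<Longrightarrow> split_form N (u i) (u j) = (if i = j then 1 else 0)"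
    unfolding card by blast
  define P where "P = mat N N (\<lambda>(i, j). u j i)"
  have P: "P \<in> carrier_mat N N" by (simp add: P_def)
  have "transpose_mat P * split_gram N * P = 1\<^sub>m N"
  proof (rule eq_matI)
    fix i j assume "i < dim_row (1\<^sub>m N :: 'a mat)" "j < dim_col (1\<^sub>m N :: 'a mat)"
    hence ij: "i < N" "j < N" by auto
    have "split_form N (\<lambda>k. P $$ (k, i)) (\<lambda>k. P $$ (k, j)) = split_form N (u i) (u j)"
      by (rule split_form_cong) (use ij in \<open>auto simp: P_def\<close>)
    thus "(transpose_mat P * split_gram N * P) $$ (i, j) = 1\<^sub>m N $$ (i, j)"
      unfolding gram_matrix_index[OF P P ij] using gram[OF ij] ij by simp
  qed (use P in auto)
  moreover have "S * P = P * dmat N \<eta>"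
  proof (rule eq_matI)
    fix i j assume "i < dim_row (P * dmat N \<eta>)" "j < dim_col (P * dmat N \<eta>)"
    hence ij: "i < N" "j < N" using P by (auto simp: dmat_def)
    have "(S * P) $$ (i, j) = act N S (u j) i"
      unfolding sq_mult_index[OF Sc P ij] act_def using ij by (auto simp: P_def intro!: sum.cong)
    thus "(S * P) $$ (i, j) = (P * dmat N \<eta>) $$ (i, j)"
      unfolding dmat_mult_index[OF P ij] u[OF ij(2)] using ij by (simp add: P_def fscale_def)
  qed (use Sc P in \<open>auto simp: dmat_def\<close>)
  ultimately show thesis using that P by blast
qed

text \<open>Both involutions are diagonalized in orthonormal rather than hyperbolic bases, since an
  orthonormal basis stays orthonormal under every permutation of its vectors. After a permutation
  that aligns the eigenvalues, the change of basis is an isometry intertwining \<open>S\<close> and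
  \<open>S'\<close>.\<close>

lemma orth_conjugate_of_similar:
  fixes S S' :: "'a :: alg_closed_field mat"
  assumes two: "(2 :: 'a) \<noteq> 0" and S: "S \<in> orth N" "S * S = 1\<^sub>m N"
    and S': "S' \<in> orth N" "S' * S' = 1\<^sub>m N" and sim: "similar_mat S S'"
  obtains g where "g \<in> orth N" "S * g = g * S'"
proof -
  note Sc = orthD(1)[OF S(1)] and S'c = orthD(1)[OF S'(1)]
  let ?J = "split_gram N :: 'a mat"
  obtain P \<eta> where P: "P \<in> carrier_mat N N" "transpose_mat P * ?J * P = 1\<^sub>m N" "S * P = P * dmat N \<eta>"
    using orthonormal_diagonalization[OF two S] .
  obtain P' \<eta>' where P': "P' \<in> carrier_mat N N" "transpose_mat P' * ?J * P' = 1\<^sub>m N" "S' * P' = P' * dmat N \<eta>'"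
    using orthonormal_diagonalization[OF two S'] .
  have "similar_mat S (dmat N \<eta>)"
    by (rule similar_mat_intertwineI[OF Sc dmat_carrier P(1) _ P(2,3)]) (use P in \<open>simp add: sq_mat\<close>)
  moreover have "similar_mat S' (dmat N \<eta>')"
    by (rule similar_mat_intertwineI[OF S'c dmat_carrier P'(1) _ P'(2,3)]) (use P' in \<open>simp add: sq_mat\<close>)
  ultimately have "similar_mat (dmat N \<eta>) (dmat N \<eta>')"
    using sim by (meson similar_mat_sym similar_mat_trans)
  then obtain \<pi> where \<pi>: "bij_betw \<pi> {..<N} {..<N}" "\<And>i. i < N \<Longrightarrow> \<eta> i = \<eta>' (\<pi> i)"
    unfolding dmat_similar_iff by blast
  have lt: "\<pi> i < N" if "i < N" for i using \<pi>(1) that by (auto simp: bij_betw_def)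
  define R where "R = mat N N (\<lambda>(i, j). P' $$ (i, \<pi> j))"
  have R: "R \<in> carrier_mat N N" "transpose_mat R \<in> carrier_mat N N" by (simp_all add: R_def)
  have R1: "transpose_mat R * ?J * R = 1\<^sub>m N"
  proof (rule eq_matI)
    fix i j assume "i < dim_row (1\<^sub>m N :: 'a mat)" "j < dim_col (1\<^sub>m N :: 'a mat)"
    hence ij: "i < N" "j < N" by auto
    have "(transpose_mat R * ?J * R) $$ (i, j) = (transpose_mat P' * ?J * P') $$ (\<pi> i, \<pi> j)"
      unfolding gram_matrix_index[OF R(1,1) ij] gram_matrix_index[OF P'(1,1) lt[OF ij(1)] lt[OF ij(2)]]
      by (rule split_form_cong) (use ij in \<open>auto simp: R_def\<close>)
    also have "\<dots> = (if \<pi> i = \<pi> j then 1 else 0)" unfolding P'(2) using lt ij by simp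
    also have "\<pi> i = \<pi> j \<longleftrightarrow> i = j" using \<pi>(1) ij by (auto simp: bij_betw_def inj_on_def)
    finally show "(transpose_mat R * ?J * R) $$ (i, j) = 1\<^sub>m N $$ (i, j)" using ij by simp
  qed (use R in auto)
  have R2: "S' * R = R * dmat N \<eta>"
  proof (rule eq_matI)
    fix i j assume "i < dim_row (R * dmat N \<eta>)" "j < dim_col (R * dmat N \<eta>)"
    hence ij: "i < N" "j < N" using R by (auto simp: dmat_def)
    have "(S' * R) $$ (i, j) = (S' * P') $$ (i, \<pi> j)"
      unfolding sq_mult_index[OF S'c R(1) ij] sq_mult_index[OF S'c P'(1) ij(1) lt[OF ij(2)]]
      using ij by (simp add: R_def)
    thus "(S' * R) $$ (i, j) = (R * dmat N \<eta>) $$ (i, j)"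
      unfolding P'(3) dmat_mult_index[OF R(1) ij] dmat_mult_index[OF P'(1) ij(1) lt[OF ij(2)]]
      using ij \<pi>(2) by (simp add: R_def)
  qed (use S'c R in \<open>auto simp: dmat_def\<close>)
  \<comment> \<open>Orthonormality of the columns of \<open>R\<close> for the split form says
    exactly that this matrix is the inverse of \<open>R\<close>.\<close>
  define R' where "R' = transpose_mat R * ?J"
  have R'c: "R' \<in> carrier_mat N N" using R by (simp add: R'_def sq_mat)
  have inv: "R' * R = 1\<^sub>m N" "R * R' = 1\<^sub>m N"
    using R1 mat_mult_left_right_inverse[OF R'c R(1)] by (simp_all add: R'_def)
  have R'S': "R' * S' = dmat N \<eta> * R'"
  proof -
    have "R' * S' = R' * S' * (R * R')" using R'c S'c inv by (simp add: sq_mat)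
    also have "\<dots> = R' * (S' * R) * R'" using R'c S'c R by (simp only: sq_mat[where N = N])
    also have "\<dots> = (R' * R) * dmat N \<eta> * R'" unfolding R2 sq_mat(2)[OF R'c R(1) dmat_carrier] ..
    finally show ?thesis using R'c inv dmat_carrier by (simp add: sq_mat(3)[where N = N])
  qed
  define g where "g = P * R'"
  have gc: "g \<in> carrier_mat N N" using P R'c by (simp add: g_def sq_mat)
  have "S * g = (S * P) * R'" unfolding g_def sq_mat(2)[OF Sc P(1) R'c] ..
  also have "\<dots> = P * (dmat N \<eta> * R')" unfolding P(3) by (rule sq_mat(2)[OF P(1) dmat_carrier R'c])
  also have "\<dots> = g * S'" unfolding R'S'[symmetric] g_def sq_mat(2)[OF P(1) R'c S'c] ..
  finally have eq: "S * g = g * S'" .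
  have tR': "transpose_mat R' = ?J * R"
    unfolding R'_def using R by (simp add: sq_mat(6)[where N = N] gram_transpose)
  have "transpose_mat g * ?J * g = transpose_mat R' * (transpose_mat P * ?J * P) * R'"
    unfolding g_def using P(1) R'c by (simp only: sq_mat[where N = N] split_gram_carrier)
  also have "\<dots> = ?J * (R * R')"
    unfolding P(2) tR' using R R'c by (simp only: sq_mat[where N = N] split_gram_carrier)
  also have "\<dots> = ?J" unfolding inv by (simp add: sq_mat(4)[where N = N])
  finally have "g \<in> orth N" using gc by (simp add: split_orthogonal_def)
  thus thesis using that eq by blast
qed

text \<open>A 2-cycle contributes the sum and the difference of its two unit vectors, with
  eigenvalues 1 and -1. The value -1 is placed at the larger end, so \<open>A\<close> collects the
  leaf indices and the larger end of each 2-cycle.\<close>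

lemma clan_mat_similar:
  fixes r :: nat
  assumes two: "(2 :: 'a :: field) \<noteq> 0" and clan: "is_clan r w L"
  defines "A \<equiv> {i. i < 2 * r + 1 \<and> (int i - int r \<in> L \<or> w (int i - int r) < int i - int r)}"
  shows "similar_mat (clan_mat r w L :: 'a mat) (dmat (2 * r + 1) (\<lambda>i. if i \<in> A then - 1 else 1))"
    and "card A = clan_size r w L"
proof -
  define N where N: "N = 2 * r + 1"
  define f where "f j = pos r (w (int j - int r))" for j
  have c: "int j - int r \<in> centred r" if "j < N" for j using that by (simp only: pos_simps(5) N)
  have wc: "w (int j - int r) \<in> centred r" if "j < N" for j using clan c[OF that] by (simp add: is_clan_def)
  have fN: "f j < N" if "j < N" for j using pos_simps(2)[OF wc[OF that]] by (simp add: f_def N)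
  have fi: "int (f j) - int r = w (int j - int r)" if "j < N" for j
    unfolding f_def by (rule pos_simps(3)[OF wc[OF that]])
  have ff: "f (f j) = j" if "j < N" for j
    using fi[OF fN[OF that]] fi[OF that] clan c[OF that] by (simp add: is_clan_def)
  have feq: "w (int j - int r) = int j - int r \<longleftrightarrow> f j = j" if "j < N" for j
    using fi[OF that] by linarith
  have fless: "w (int j - int r) < int j - int r \<longleftrightarrow> f j < j" if "j < N" for j
    using fi[OF that] by linarith
  have Lf: "f j = j" if "j < N" "int j - int r \<in> L" for j
    using clan that feq[OF that(1)] by (auto simp: is_clan_def)
  let ?S = "clan_mat r w L :: 'a mat" and ?W = "clan_mat r w {} :: 'a mat"
  have Sc: "?S \<in> carrier_mat N N" and Wc: "?W \<in> carrier_mat N N" by (simp_all only: N clan_mat_carrier)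
  \<comment> \<open>The eigenbasis in closed form: on a 2-cycle \<open>Q\<close> has rows
    \<open>(1, 1)\<close> and \<open>(1, -1)\<close>, and at a fixed point it is 1.\<close>
  define \<sigma> \<nu> :: "nat \<Rightarrow> 'a" where "\<sigma> j = (if f j < j then - 1 else 1)" and "\<nu> j = (if f j = j then 0 else 1)" for j
  define Q where "Q = dmat N \<sigma> + ?W * dmat N \<nu>"
  have WD: "?W * dmat N \<nu> \<in> carrier_mat N N" using Wc by (simp add: sq_mat)
  have Qc: "Q \<in> carrier_mat N N" unfolding Q_def using WD by simp
  have S_index: "?S $$ (i, j) = (if i = f j then if int j - int r \<in> L then - 1 else 1 else 0)"
    "?W $$ (i, j) = (if i = f j then 1 else 0)" if "i < N" "j < N" for i j
    using that pos_eq_iff[OF wc[OF that(2)], of i] by (simp_all add: clan_mat_def f_def N)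
  have AQ: "(B * Q) $$ (i, j) = B $$ (i, j) * \<sigma> j + B $$ (i, f j) * \<nu> j"
    if B: "B \<in> carrier_mat N N" and ij: "i < N" "j < N" for B i j
  proof -
    have BW: "B * ?W \<in> carrier_mat N N" using B Wc by (simp add: sq_mat)
    have "(B * ?W) $$ (i, j) = B $$ (i, f j)"
      using mult_clan_mat_index[where w = w and L = "{}" and i = i and j = j, OF B[unfolded N]] ij wc[OF ij(2)]
      by (simp add: f_def N)
    hence "(B * ?W * dmat N \<nu>) $$ (i, j) = B $$ (i, f j) * \<nu> j"
      unfolding dmat_mult_index[OF BW ij] by simp
    moreover have "B * Q = B * dmat N \<sigma> + B * ?W * dmat N \<nu>"
      unfolding Q_def using B Wc WD
      by (simp add: mult_add_distrib_mat[of _ N N _ N] sq_mat(2)[where N = N])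
    moreover have "(B * dmat N \<sigma>) $$ (i, j) = B $$ (i, j) * \<sigma> j" by (rule dmat_mult_index[OF B ij])
    ultimately show ?thesis using B Wc ij BW by (simp add: sq_mat dmat_def)
  qed
  have Q_index: "Q $$ (i, j) = (if i = j then \<sigma> j else 0) + (if i = f j then \<nu> j else 0)" if "i < N" "j < N" for i j
  proof -
    have "dmat N \<sigma> $$ (i, j) = (if i = j then \<sigma> j else 0)" using that by (simp add: dmat_def)
    thus ?thesis
      unfolding Q_def
      using that dmat_mult_index(2)[OF Wc that, of \<nu>] carrier_matD[OF WD] S_index(2)[OF that] by simp
  qed
  \<comment> \<open>The square of \<open>Q\<close> is diagonal, 2 on each 2-cycle and 1 at fixed
    points. Thus \<open>Q\<close> is its own inverse up to diagonal scaling, and the hypothesis on 2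
    makes the scaling possible.\<close>
  define \<rho> :: "nat \<Rightarrow> 'a" where "\<rho> j = (if f j = j then 1 else 2)" for j
  have QQ: "(Q * Q) $$ (i, j) = (if i = j then \<rho> j else 0)" if ij: "i < N" "j < N" for i j
    unfolding AQ[OF Qc ij] Q_index[OF ij] Q_index[OF ij(1) fN[OF ij(2)]]
    using ff[OF ij(2)] by (auto simp: \<sigma>_def \<nu>_def \<rho>_def)
  have \<rho>: "\<rho> j \<noteq> 0" for j using two by (simp add: \<rho>_def)
  define Q' where "Q' = dmat N (\<lambda>i. inverse (\<rho> i)) * Q"
  have Q'c: "Q' \<in> carrier_mat N N" using Qc by (simp add: Q'_def sq_mat)
  have QQc: "Q * Q \<in> carrier_mat N N" using Qc by (simp add: sq_mat)
  have "Q' * Q = 1\<^sub>m N"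
  proof (rule eq_matI)
    fix i j assume "i < dim_row (1\<^sub>m N :: 'a mat)" "j < dim_col (1\<^sub>m N :: 'a mat)"
    hence ij: "i < N" "j < N" by auto
    have "(Q' * Q) $$ (i, j) = inverse (\<rho> i) * (Q * Q) $$ (i, j)"
      unfolding Q'_def sq_mat(2)[OF dmat_carrier Qc Qc] dmat_mult_index[OF QQc ij] ..
    thus "(Q' * Q) $$ (i, j) = 1\<^sub>m N $$ (i, j)" using QQ[OF ij] ij \<rho> by simp
  qed (use Q'c Qc in auto)
  moreover have "?S * Q = Q * dmat N (\<lambda>i. if i \<in> A then - 1 else 1)"
  proof (rule eq_matI)
    fix i j assume "i < dim_row (Q * dmat N (\<lambda>i. if i \<in> A then - 1 else 1))"
      "j < dim_col (Q * dmat N (\<lambda>i. if i \<in> A then - 1 else 1))"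
    hence ij: "i < N" "j < N" using Qc by (auto simp: dmat_def)
    have A: "j \<in> A \<longleftrightarrow> int j - int r \<in> L \<or> f j < j"
      using ij fless by (simp add: A_def N)
    have L: "int (f j) - int r \<in> L \<longleftrightarrow> int j - int r \<in> L"
      using Lf[OF ij(2)] Lf[OF fN[OF ij(2)]] ff[OF ij(2)] by auto
    have "f j \<noteq> j \<Longrightarrow> int j - int r \<notin> L" using Lf[OF ij(2)] by blast
    thus "(?S * Q) $$ (i, j) = (Q * dmat N (\<lambda>i. if i \<in> A then - 1 else 1)) $$ (i, j)"
      unfolding AQ[OF Sc ij] dmat_mult_index[OF Qc ij] Q_index[OF ij] S_index[OF ij] S_index(1)[OF ij(1) fN[OF ij(2)]] A L
      using ff[OF ij(2)] by (auto simp: \<sigma>_def \<nu>_def)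
  qed (use Sc Qc in \<open>auto simp: dmat_def\<close>)
  ultimately show "similar_mat ?S (dmat (2 * r + 1) (\<lambda>i. if i \<in> A then - 1 else 1))"
    using similar_mat_intertwineI[OF Sc dmat_carrier Qc Q'c] by (simp only: N)
  let ?B = "{i \<in> centred r. w i < i}" and ?C = "{i \<in> centred r. i < w i}"
  have "bij_betw (\<lambda>i. int i - int r) A (L \<union> ?B)"
    by (rule bij_betw_byWitness[where f' = "pos r"])
      (use clan in \<open>auto simp: A_def pos_simps(1,3,4) pos_simps(5)[unfolded] is_clan_def centred_def pos_def\<close>)
  hence "card A = card (L \<union> ?B)" by (rule bij_betw_same_card)
  also have "\<dots> = card L + card ?B"
  proof (rule card_Un_disjoint)
    show "finite L" using clan finite_subset[of L "centred r"] by (auto simp: is_clan_def)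
  qed (use clan in \<open>auto simp: is_clan_def\<close>)
  \<comment> \<open>The map \<open>w\<close> exchanges the larger and the smaller ends of the
    2-cycles.\<close>
  also have "card ?B = card ?C"
    by (rule bij_betw_same_card[of w], rule bij_betw_byWitness[where f' = w])
      (use clan in \<open>auto simp: is_clan_def\<close>)
  finally show "card A = clan_size r w L" by (simp add: clan_size_def)
qed

section \<open>Clans and matchings\<close>

definition clan_edges :: "nat \<Rightarrow> (int \<Rightarrow> int) \<Rightarrow> int set \<Rightarrow> corona_vertex set set" where
  "clan_edges r w L = (\<lambda>i. {Core i, Core (w i)}) ` {i \<in> centred r. w i \<noteq> i} \<union> (\<lambda>i. {Core i, Leaf i}) ` L"

lemma clan_edges_iff:
  assumes "is_clan r w L"
  shows "i \<noteq> j \<Longrightarrow> {Core i, Core j} \<in> clan_edges r w L \<longleftrightarrow> i \<in> centred r \<and> w i = j"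
    and "{Core i, Leaf i} \<in> clan_edges r w L \<longleftrightarrow> i \<in> L"
  using assms by (auto simp: clan_edges_def is_clan_def doubleton_eq_iff)

lemma clan_edges_inject:
  assumes c: "is_clan r w L" "is_clan r w' L'" and eq: "clan_edges r w L = clan_edges r w' L'"
  shows "w = w'" "L = L'"
proof -
  show "L = L'" using clan_edges_iff(2)[OF c(1)] clan_edges_iff(2)[OF c(2)] eq by blast
  show "w = w'"
  proof
    fix i show "w i = w' i"
      using clan_edges_iff(1)[OF c(1), of i] clan_edges_iff(1)[OF c(2), of i] eq c
      by (metis is_clan_def)
  qed
qed

text \<open>A core edge is produced by both of its ends; keeping only the end with
  \<open>i < w i\<close> counts it once.\<close>

lemma clan_edges_card:
  assumes "is_clan r w L"
  shows "card (clan_edges r w L) = clan_size r w L"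
proof -
  let ?C = "{i \<in> centred r. i < w i}"
  have "(\<lambda>i. {Core i, Core (w i)}) ` {i \<in> centred r. w i \<noteq> i} = (\<lambda>i. {Core i, Core (w i)}) ` ?C"
  proof (intro equalityI subsetI)
    fix e assume "e \<in> (\<lambda>i. {Core i, Core (w i)}) ` {i \<in> centred r. w i \<noteq> i}"
    then obtain i where i: "i \<in> centred r" "w i \<noteq> i" "e = {Core i, Core (w i)}" by auto
    have "e = {Core (w i), Core (w (w i))}" "w i \<in> centred r" "w (w i) = i"
      using i assms by (auto simp: is_clan_def)
    moreover have "i \<in> ?C \<or> w i \<in> ?C" using i calculation(2,3) by auto
    ultimately show "e \<in> (\<lambda>i. {Core i, Core (w i)}) ` ?C" using i(3) by blast
  qed auto
  hence eq: "clan_edges r w L = (\<lambda>i. {Core i, Core (w i)}) ` ?C \<union> (\<lambda>i. {Core i, Leaf i}) ` L"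
    by (simp add: clan_edges_def)
  have finL: "finite L" using assms finite_subset[of L "centred r"] by (auto simp: is_clan_def)
  have "card (clan_edges r w L) = card ((\<lambda>i. {Core i, Core (w i)}) ` ?C) + card ((\<lambda>i. {Core i, Leaf i}) ` L)"
    unfolding eq by (rule card_Un_disjoint) (use finL in \<open>auto simp: doubleton_eq_iff\<close>)
  also have "card ((\<lambda>i. {Core i, Core (w i)}) ` ?C) = card ?C"
    by (rule card_image) (auto simp: inj_on_def doubleton_eq_iff)
  also have "card ((\<lambda>i. {Core i, Leaf i}) ` L) = card L"
    by (rule card_image) (auto simp: inj_on_def doubleton_eq_iff)
  finally show ?thesis by (simp add: clan_size_def)
qed

lemma minus_edges_invol: "minus_edges (minus_edges M) = M"
proof -
  have "minus_vertex (minus_vertex v) = v" for v by (cases v) auto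
  hence "(\<lambda>e. minus_vertex ` e) ((\<lambda>e. minus_vertex ` e) e) = e" for e by (simp add: image_image)
  thus ?thesis by (simp add: minus_edges_def image_image)
qed

lemma clan_edges_matching:
  assumes clan: "is_clan r w L"
  shows "r_matching (clan_size r w L) (corona_edges (centred r)) (clan_edges r w L)"
    and "minus_edges (clan_edges r w L) = clan_edges r w L"
proof -
  have "finite L" using clan finite_subset[of L "centred r"] by (auto simp: is_clan_def)
  moreover have "pairwise disjnt (clan_edges r w L)"
  proof -
    \<comment> \<open>Disjointness is proved by recovering an edge from any one of its vertices, so
      that two edges with a common vertex coincide.\<close>
    define edge_at where "edge_at v = (case v of
      Core i \<Rightarrow> if w i \<noteq> i then {Core i, Core (w i)} else {Core i, Leaf i} | Leaf i \<Rightarrow> {Core i, Leaf i})" for v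
    have edge_at: "e = edge_at v"
      if "e \<in> clan_edges r w L" "v \<in> e" for e v
    proof -
      from that(1) consider i where "i \<in> centred r" "w i \<noteq> i" "w (w i) = i" "e = {Core i, Core (w i)}"
        | i where "w i = i" "e = {Core i, Leaf i}"
        using clan by (auto simp: clan_edges_def is_clan_def)
      thus ?thesis by cases (use that(2) in \<open>auto simp: insert_commute edge_at_def\<close>)
    qed
    hence "e = e'" if "e \<in> clan_edges r w L" "e' \<in> clan_edges r w L" "v \<in> e" "v \<in> e'" for e e' v
      using edge_at[OF that(1,3)] edge_at[OF that(2,4)] by simp
    thus ?thesis unfolding pairwise_def disjnt_def by blast
  qed
  moreover have "clan_edges r w L \<subseteq> corona_edges (centred r)"
    using clan unfolding clan_edges_def corona_edges_def is_clan_def by (auto 0 3)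
  ultimately show "r_matching (clan_size r w L) (corona_edges (centred r)) (clan_edges r w L)"
    using clan_edges_card[OF clan] by (simp add: r_matching_def clan_edges_def)
  have sub: "minus_edges (clan_edges r w L) \<subseteq> clan_edges r w L"
  proof
    fix e assume "e \<in> minus_edges (clan_edges r w L)"
    then obtain e' where e': "e' \<in> clan_edges r w L" "e = minus_vertex ` e'" by (auto simp: minus_edges_def)
    from e'(1) consider i where "i \<in> centred r" "w i \<noteq> i" "e' = {Core i, Core (w i)}"
      | i where "i \<in> L" "e' = {Core i, Leaf i}" by (auto simp: clan_edges_def)
    thus "e \<in> clan_edges r w L"
    proof cases
      case 1
      hence "- i \<in> centred r" "w (- i) = - w i" using clan centred_uminus by (auto simp: is_clan_def)
      thus ?thesis using clan_edges_iff(1)[OF clan, of "- i" "- w i"] 1 e'(2) by simp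
    next
      case 2
      hence "- i \<in> L" using clan by (simp add: is_clan_def)
      thus ?thesis using clan_edges_iff(2)[OF clan, of "- i"] 2 e'(2) by simp
    qed
  qed
  hence "minus_edges (minus_edges (clan_edges r w L)) \<subseteq> minus_edges (clan_edges r w L)"
    unfolding minus_edges_def by blast
  thus "minus_edges (clan_edges r w L) = clan_edges r w L" using sub by (simp add: minus_edges_invol)
qed

lemma matching_is_clan_edges:
  assumes M: "r_matching k (corona_edges (centred r)) M" and inv: "minus_edges M = M"
  obtains w L where "is_clan r w L" "M = clan_edges r w L"
proof -
  have sub: "M \<subseteq> corona_edges (centred r)" and disj: "pairwise disjnt M"
    using M by (auto simp: r_matching_def)
  have meet: "e = e'" if "e \<in> M" "e' \<in> M" "v \<in> e" "v \<in> e'" for e e' v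
    using disj that by (auto simp: pairwise_def disjnt_def)
  have uniq: "j = k" if "{Core i, Core j} \<in> M" "{Core i, Core k} \<in> M" for i j k
    using meet[OF that, of "Core i"] by (auto simp: doubleton_eq_iff)
  have memc: "i \<in> centred r \<and> j \<in> centred r \<and> i \<noteq> j" if "{Core i, Core j} \<in> M" for i j
    using subsetD[OF sub that] by (auto simp: corona_edges_def doubleton_eq_iff)
  have neg: "minus_vertex ` e \<in> M" if "e \<in> M" for e
    using inv that by (auto simp: minus_edges_def)
  \<comment> \<open>The choice is unambiguous, as a matching has at most one core edge at a given
    vertex. An index without a core edge is fixed, whether it has a leaf edge or is
    unmatched.\<close>
  define w where "w i = (if \<exists>j. {Core i, Core j} \<in> M then SOME j. {Core i, Core j} \<in> M else i)" for i
  define L where "L = {i. {Core i, Leaf i} \<in> M}"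
  have w_eq: "w i = j" if "{Core i, Core j} \<in> M" for i j
  proof -
    have "{Core i, Core (w i)} \<in> M" using someI[of "\<lambda>j. {Core i, Core j} \<in> M" j] that by (auto simp: w_def)
    thus ?thesis using uniq that by blast
  qed
  have w_in: "{Core i, Core (w i)} \<in> M" if "w i \<noteq> i" for i
    using that w_eq by (metis w_def)
  have wfix: "w i = i" if "{Core i, Leaf i} \<in> M" for i
    using meet[OF that w_in, where v = "Core i"] by (auto simp: doubleton_eq_iff)
  have clan: "is_clan r w L"
    unfolding is_clan_def
  proof (intro conjI ballI allI impI subsetI)
    fix i assume i: "i \<in> centred r"
    show "w i \<in> centred r" using w_in[of i] memc i by (cases "w i = i") auto
    show "w (w i) = i" using w_in[of i] w_eq[of "w i" i] by (cases "w i = i") (auto simp: insert_commute)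
  next
    fix i :: int
    show "w (- i) = - w i"
    proof (cases "w i = i")
      case False
      thus ?thesis using neg[OF w_in[OF False]] w_eq by simp
    next
      \<comment> \<open>If \<open>- i\<close> had a core edge, the mirror image of that edge would
        be a core edge at \<open>i\<close>.\<close>
      case True
      show ?thesis
      proof (rule ccontr)
        assume "w (- i) \<noteq> - w i"
        hence "{Core (- i), Core (w (- i))} \<in> M" using w_in True by simp
        hence "{Core i, Core (- w (- i))} \<in> M" using neg by fastforce
        thus False using w_eq True memc by metis
      qed
    qed
  next
    fix i assume "i \<notin> centred r"
    thus "w i = i" using w_in memc by blast
  next
    fix i assume "i \<in> L"
    hence i: "{Core i, Leaf i} \<in> M" by (simp add: L_def)
    thus "i \<in> {i \<in> centred r. w i = i}"
      using subsetD[OF sub i] wfix by (auto simp: corona_edges_def doubleton_eq_iff)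
    show "- i \<in> L" using neg[OF i] by (simp add: L_def)
  qed
  have "M = clan_edges r w L"
  proof (intro equalityI subsetI)
    fix e assume e: "e \<in> M"
    with sub consider i j where "e = {Core i, Core j}" | i where "e = {Core i, Leaf i}"
      by (auto simp: corona_edges_def)
    thus "e \<in> clan_edges r w L"
    proof cases
      case 1
      thus ?thesis using e memc w_eq clan_edges_iff(1)[OF clan, of i j] by blast
    next
      case 2
      thus ?thesis using e clan_edges_iff(2)[OF clan] by (simp add: L_def)
    qed
  next
    fix e assume "e \<in> clan_edges r w L"
    thus "e \<in> M" using w_in by (auto simp: clan_edges_def L_def)
  qed
  thus thesis using that clan by blast
qed

theorem clans_bij_matchings:
  "bij_betw (\<lambda>(w, L). clan_edges (m + n) w L)
    {(w, L). is_clan (m + n) w L \<and> clan_size (m + n) w L = 2 * m} (minus_invariant_matchings m n)"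
proof -
  have I: "{- int (m + n)..int (m + n)} = centred (m + n)" by (simp add: centred_def)
  show ?thesis
    unfolding bij_betw_def
  proof (intro conjI equalityI subsetI)
    show "inj_on (\<lambda>(w, L). clan_edges (m + n) w L) {(w, L). is_clan (m + n) w L \<and> clan_size (m + n) w L = 2 * m}"
      unfolding inj_on_def by clarsimp (metis clan_edges_inject)
  next
    fix M assume "M \<in> (\<lambda>(w, L). clan_edges (m + n) w L) ` {(w, L). is_clan (m + n) w L \<and> clan_size (m + n) w L = 2 * m}"
    then obtain w L where "M = clan_edges (m + n) w L" "is_clan (m + n) w L" "clan_size (m + n) w L = 2 * m" by auto
    thus "M \<in> minus_invariant_matchings m n"
      using clan_edges_matching[of "m + n" w L] unfolding minus_invariant_matchings_def I by simp
  next
    fix M assume "M \<in> minus_invariant_matchings m n"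
    hence M: "r_matching (2 * m) (corona_edges (centred (m + n))) M" "minus_edges M = M"
      unfolding minus_invariant_matchings_def I by auto
    obtain w L where wL: "is_clan (m + n) w L" "M = clan_edges (m + n) w L"
      using matching_is_clan_edges[OF M] .
    hence "clan_size (m + n) w L = 2 * m"
      using M(1) clan_edges_card[OF wL(1)] by (simp add: r_matching_def)
    thus "M \<in> (\<lambda>(w, L). clan_edges (m + n) w L) ` {(w, L). is_clan (m + n) w L \<and> clan_size (m + n) w L = 2 * m}"
      using wL by auto
  qed
qed

section \<open>The Zariski topology\<close>

text \<open>Over a finite field the product of all \<open>x - a\<close>, plus 1, would be a
  polynomial of positive degree without roots. Infinity guarantees that non-zero polynomials have
  points where they do not vanish.\<close>

lemma infinite_UNIV_alg_closed: "infinite (UNIV :: 'a :: alg_closed_field set)"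
proof
  assume fin: "finite (UNIV :: 'a set)"
  define p where "p = (\<Prod>a\<in>(UNIV :: 'a set). [:- a, 1:]) + 1"
  have deg: "degree (\<Prod>a\<in>(UNIV :: 'a set). [:- a, 1:]) = card (UNIV :: 'a set)"
    by (subst degree_prod_eq_sum_degree) auto
  hence "degree p = card (UNIV :: 'a set)"
    unfolding p_def using fin by (subst degree_add_eq_left) (auto simp: card_gt_0_iff)
  hence "degree p > 0" using fin by (simp add: card_gt_0_iff)
  then obtain x where "poly p x = 0" using alg_closed_imp_poly_has_root by blast
  moreover have "poly p x = 1" using fin by (simp add: p_def poly_prod)
  ultimately show False by simp
qed

lemma topspace_mat_zariski [simp]: "topspace (mat_zariski N) = carrier_mat N N"
proof
  show "topspace (mat_zariski N) \<subseteq> (carrier_mat N N :: 'a :: field mat set)"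
    unfolding mat_zariski_def topology_generated_by_topspace by blast
  have "openin (mat_zariski N) {x \<in> carrier_mat N N. (\<lambda>_. 1 :: 'a) x \<noteq> 0}"
    unfolding mat_zariski_def
    by (rule topology_generated_by_Basis, rule CollectI, rule exI[of _ "\<lambda>_. 1"]) (simp add: poly_funs.const)
  thus "carrier_mat N N \<subseteq> topspace (mat_zariski N :: 'a mat topology)" using openin_subset by fastforce
qed

text \<open>The generating sets are already a base, since the product of two polynomials cuts out
  the intersection of their principal open sets.\<close>

lemma openin_mat_zariski_iff:
  "openin (mat_zariski N) U \<longleftrightarrow> U \<subseteq> carrier_mat N N \<and>
     (\<forall>x\<in>U. \<exists>f\<in>poly_funs N. f x \<noteq> 0 \<and> {y \<in> carrier_mat N N. f y \<noteq> 0} \<subseteq> (U :: 'a :: field mat set))"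
    (is "_ \<longleftrightarrow> ?R U")
proof
  assume "openin (mat_zariski N) U"
  hence "generate_topology_on {{x \<in> carrier_mat N N. f x \<noteq> (0 :: 'a)} | f. f \<in> poly_funs N} U"
    unfolding mat_zariski_def openin_topology_generated_by_iff .
  thus "?R U"
  proof induction
    case (Int a b)
    show ?case
    proof (intro conjI ballI)
      fix x assume "x \<in> a \<inter> b"
      then obtain f g where fg: "f \<in> poly_funs N" "f x \<noteq> 0" "{y \<in> carrier_mat N N. f y \<noteq> 0} \<subseteq> a"
        "g \<in> poly_funs N" "g x \<noteq> 0" "{y \<in> carrier_mat N N. g y \<noteq> 0} \<subseteq> b"
        using Int by blast
      thus "\<exists>f\<in>poly_funs N. f x \<noteq> 0 \<and> {y \<in> carrier_mat N N. f y \<noteq> 0} \<subseteq> a \<inter> b"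
        by (intro bexI[of _ "\<lambda>x. f x * g x"] poly_funs.mult) auto
    qed (use Int in auto)
  next
    case (UN K)
    show ?case
    proof (intro conjI ballI)
      fix x assume "x \<in> \<Union>K"
      then obtain k where "k \<in> K" "x \<in> k" by blast
      thus "\<exists>f\<in>poly_funs N. f x \<noteq> 0 \<and> {y \<in> carrier_mat N N. f y \<noteq> 0} \<subseteq> \<Union>K"
      proof -
        have "k \<subseteq> \<Union>K" using \<open>k \<in> K\<close> by blast
        moreover obtain f where "f \<in> poly_funs N" "f x \<noteq> 0" "{y \<in> carrier_mat N N. f y \<noteq> 0} \<subseteq> k"
          using UN \<open>k \<in> K\<close> \<open>x \<in> k\<close> by meson
        ultimately show ?thesis by (intro bexI[of _ f]) auto
      qed
    qed (use UN in blast)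
  qed auto
next
  assume U: "?R U"
  have basic: "openin (mat_zariski N) {y \<in> carrier_mat N N. f y \<noteq> (0 :: 'a)}" if "f \<in> poly_funs N" for f
    unfolding mat_zariski_def
    by (rule topology_generated_by_Basis, rule CollectI, rule exI[of _ f]) (use that in simp)
  show "openin (mat_zariski N) U"
  proof (subst openin_subopen, intro ballI)
    fix x assume x: "x \<in> U"
    then obtain f where "f \<in> poly_funs N" "f x \<noteq> 0" "{y \<in> carrier_mat N N. f y \<noteq> 0} \<subseteq> U" using U by blast
    thus "\<exists>T. openin (mat_zariski N) T \<and> x \<in> T \<and> T \<subseteq> U" using basic U x by blast
  qed
qed

text \<open>A member of \<open>poly_funs\<close> has prescribed values on matrices of every size,
  whereas composites with matrix operations are controlled only on \<open>N\<close> by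
  \<open>N\<close> matrices; agreement is therefore demanded only there.\<close>

definition poly_on :: "nat \<Rightarrow> ('a :: field mat \<Rightarrow> 'a) \<Rightarrow> bool" where
  "poly_on N f \<longleftrightarrow> (\<exists>g\<in>poly_funs N. \<forall>x\<in>carrier_mat N N. f x = g x)"

definition poly_map :: "nat \<Rightarrow> ('a :: field mat \<Rightarrow> 'a mat) \<Rightarrow> bool" where
  "poly_map N \<phi> \<longleftrightarrow> (\<forall>x\<in>carrier_mat N N. \<phi> x \<in> carrier_mat N N) \<and>
     (\<forall>i<N. \<forall>j<N. poly_on N (\<lambda>x. \<phi> x $$ (i, j)))"

section \<open>Calculus of polynomial functions and polynomial maps\<close>

lemma poly_on_const: "poly_on N (\<lambda>_. c)"
  unfolding poly_on_def by (rule bexI[OF _ poly_funs.const]) auto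

lemma poly_on_entry: "i < N \<Longrightarrow> j < N \<Longrightarrow> poly_on N (\<lambda>x. x $$ (i, j))"
  unfolding poly_on_def by (rule bexI[of _ "\<lambda>x. x $$ (i, j)"]) (auto intro: poly_funs.entry)

lemma poly_on_add: "poly_on N f \<Longrightarrow> poly_on N g \<Longrightarrow> poly_on N (\<lambda>x. f x + g x)"
  unfolding poly_on_def
proof (elim bexE)
  fix f' g' assume "f' \<in> poly_funs N" "g' \<in> poly_funs N"
    "\<forall>x\<in>carrier_mat N N. f x = f' x" "\<forall>x\<in>carrier_mat N N. g x = g' x"
  thus "\<exists>h\<in>poly_funs N. \<forall>x\<in>carrier_mat N N. f x + g x = h x"
    by (intro bexI[of _ "\<lambda>x. f' x + g' x"] poly_funs.add) auto
qed

lemma poly_on_mult: "poly_on N f \<Longrightarrow> poly_on N g \<Longrightarrow> poly_on N (\<lambda>x. f x * g x)"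
  unfolding poly_on_def
proof (elim bexE)
  fix f' g' assume "f' \<in> poly_funs N" "g' \<in> poly_funs N"
    "\<forall>x\<in>carrier_mat N N. f x = f' x" "\<forall>x\<in>carrier_mat N N. g x = g' x"
  thus "\<exists>h\<in>poly_funs N. \<forall>x\<in>carrier_mat N N. f x * g x = h x"
    by (intro bexI[of _ "\<lambda>x. f' x * g' x"] poly_funs.mult) auto
qed

lemma poly_on_sum: "finite A \<Longrightarrow> (\<And>i. i \<in> A \<Longrightarrow> poly_on N (f i)) \<Longrightarrow> poly_on N (\<lambda>x. \<Sum>i\<in>A. f i x)"
  by (induction A rule: finite_induct) (simp_all add: poly_on_const poly_on_add)

lemma poly_on_prod: "finite A \<Longrightarrow> (\<And>i. i \<in> A \<Longrightarrow> poly_on N (f i)) \<Longrightarrow> poly_on N (\<lambda>x. \<Prod>i\<in>A. f i x)"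
  by (induction A rule: finite_induct) (simp_all add: poly_on_const poly_on_mult)

lemma poly_on_cong: "poly_on N f \<Longrightarrow> (\<And>x. x \<in> carrier_mat N N \<Longrightarrow> g x = f x) \<Longrightarrow> poly_on N g"
  unfolding poly_on_def by auto

lemma poly_map_carrier: "poly_map N \<phi> \<Longrightarrow> x \<in> carrier_mat N N \<Longrightarrow> \<phi> x \<in> carrier_mat N N"
  by (simp add: poly_map_def)

lemma poly_on_comp:
  assumes f: "poly_on N f" and \<phi>: "poly_map N \<phi>"
  shows "poly_on N (\<lambda>x. f (\<phi> x))"
proof -
  obtain g where g: "g \<in> poly_funs N" "\<And>x. x \<in> carrier_mat N N \<Longrightarrow> f x = g x"
    using f by (auto simp: poly_on_def)
  from g(1) have "poly_on N (\<lambda>x. g (\<phi> x))"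
    by induction (use \<phi> in \<open>simp_all add: poly_on_const poly_on_add poly_on_mult poly_map_def\<close>)
  thus ?thesis by (rule poly_on_cong) (use g \<phi> in \<open>simp add: poly_map_def\<close>)
qed

lemma poly_map_const: "A \<in> carrier_mat N N \<Longrightarrow> poly_map N (\<lambda>_. A)"
  by (simp add: poly_map_def poly_on_const)

lemma poly_map_id: "poly_map N (\<lambda>x. x)"
  by (simp add: poly_map_def poly_on_entry)

lemma poly_map_mult:
  assumes "poly_map N \<phi>" "poly_map N \<psi>"
  shows "poly_map N (\<lambda>x. \<phi> x * \<psi> x)"
  unfolding poly_map_def
proof (intro conjI ballI allI impI)
  fix i j assume ij: "i < N" "j < N"
  have "poly_on N (\<lambda>x. \<Sum>k<N. \<phi> x $$ (i, k) * \<psi> x $$ (k, j))"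
    by (intro poly_on_sum poly_on_mult) (use assms ij in \<open>auto simp: poly_map_def\<close>)
  thus "poly_on N (\<lambda>x. (\<phi> x * \<psi> x) $$ (i, j))"
    by (rule poly_on_cong) (rule sq_mult_index, use assms ij in \<open>auto simp: poly_map_def\<close>)
qed (use assms in \<open>simp add: poly_map_def sq_mat\<close>)

text \<open>Inversion on the orthogonal group extends to a linear map on all matrices, so words with
  inverses stay polynomial and no determinant has to be inverted.\<close>

lemma poly_map_orth_inv: "poly_map N (orth_inv N)"
  unfolding poly_map_def
proof (intro conjI ballI allI impI)
  fix i j assume ij: "i < N" "j < N"
  have "poly_on N (\<lambda>x. x $$ (N - 1 - j, N - 1 - i))" by (rule poly_on_entry) (use ij in auto)
  thus "poly_on N (\<lambda>x. orth_inv N x $$ (i, j))"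
    by (rule poly_on_cong) (use ij orth_inv_index in auto)
qed simp

lemma continuous_map_poly_map:
  assumes "poly_map N \<phi>"
  shows "continuous_map (mat_zariski N) (mat_zariski N) \<phi>"
  unfolding continuous_map_def
proof (intro conjI allI impI)
  fix U :: "'a mat set" assume U: "openin (mat_zariski N) U"
  show "openin (mat_zariski N) {x \<in> topspace (mat_zariski N). \<phi> x \<in> U}"
    unfolding openin_mat_zariski_iff
  proof (intro conjI ballI)
    fix x assume "x \<in> {x \<in> topspace (mat_zariski N). \<phi> x \<in> U}"
    hence x: "x \<in> carrier_mat N N" "\<phi> x \<in> U" by auto
    then obtain f where f: "f \<in> poly_funs N" "f (\<phi> x) \<noteq> 0" "{y \<in> carrier_mat N N. f y \<noteq> 0} \<subseteq> U"
      using U unfolding openin_mat_zariski_iff by blast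
    hence "poly_on N f" by (auto simp: poly_on_def)
    from poly_on_comp[OF this assms] obtain g where
      "g \<in> poly_funs N" "\<forall>x\<in>carrier_mat N N. f (\<phi> x) = g x" by (auto simp: poly_on_def)
    thus "\<exists>g\<in>poly_funs N. g x \<noteq> 0 \<and> {y \<in> carrier_mat N N. g y \<noteq> 0} \<subseteq> {x \<in> topspace (mat_zariski N). \<phi> x \<in> U}"
      using f x poly_map_carrier[OF assms] by (intro bexI[of _ g]) auto
  qed auto
qed (use assms in \<open>auto simp: poly_map_def\<close>)

lemma openin_poly_on_nonzero:
  assumes "poly_on N f"
  shows "openin (mat_zariski N) {x \<in> carrier_mat N N. f x \<noteq> 0}"
proof -
  obtain g where "g \<in> poly_funs N" "\<forall>x\<in>carrier_mat N N. f x = g x" using assms by (auto simp: poly_on_def)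
  thus ?thesis unfolding openin_mat_zariski_iff by (intro conjI ballI bexI[of _ g]) auto
qed

lemma closedin_poly_on_zero:
  assumes "poly_on N f"
  shows "closedin (mat_zariski N) {x \<in> carrier_mat N N. f x = 0}"
proof -
  have "topspace (mat_zariski N) - {x \<in> carrier_mat N N. f x = 0} = {x \<in> carrier_mat N N. f x \<noteq> 0}" by auto
  thus ?thesis using openin_poly_on_nonzero[OF assms] by (simp add: closedin_def)
qed

text \<open>If \<open>f\<close> took the value \<open>f x\<close> and another one on
  \<open>H\<close>, the fibre over \<open>f x\<close> and its complement would separate
  \<open>H\<close>. Both are relatively open: the complement is where \<open>f - f x\<close> does
  not vanish, the fibre is where the product of \<open>f - c\<close> over the other values does not
  vanish.\<close>

lemma connectedin_finite_values_const:
  fixes f :: "'a :: field mat \<Rightarrow> 'a"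
  assumes conn: "connectedin (mat_zariski N) H" and f: "poly_on N f" and fin: "finite (f ` H)"
    and xy: "x \<in> H" "y \<in> H"
  shows "f x = f y"
proof (rule ccontr)
  assume ne: "f x \<noteq> f y"
  have HN: "H \<subseteq> carrier_mat N N" using connectedin_subset_topspace[OF conn] by simp
  let ?p = "\<lambda>z. \<Prod>c\<in>f ` H - {f x}. f z - c" and ?q = "\<lambda>z. f z - f x"
  have diff: "poly_on N (\<lambda>z. f z - c)" for c
    using poly_on_add[OF f poly_on_const[of N "- c"]] by simp
  have p: "?p z \<noteq> 0 \<longleftrightarrow> f z = f x" if "z \<in> H" for z
    using fin that by auto
  let ?U = "{z \<in> carrier_mat N N. ?p z \<noteq> 0}" and ?V = "{z \<in> carrier_mat N N. ?q z \<noteq> 0}"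
  have "openin (mat_zariski N) ?U" by (rule openin_poly_on_nonzero[OF poly_on_prod]) (use fin diff in auto)
  moreover have "openin (mat_zariski N) ?V" by (rule openin_poly_on_nonzero[OF diff])
  moreover have "H \<subseteq> ?U \<union> ?V" using HN p by fastforce
  moreover have "?U \<inter> ?V \<inter> H = {}" using p by fastforce
  moreover have "x \<in> ?U \<inter> H" using HN p[OF xy(1)] xy by auto
  moreover have "y \<in> ?V \<inter> H" using HN xy ne by auto
  ultimately show False using conn unfolding connectedin by blast
qed

text \<open>The curve is even irreducible: two non-empty relatively open subsets pull back to
  complements of finite sets of parameters, and these meet in an infinite field. The exponent
  \<open>e\<close> clears denominators, so that polynomials in the matrix entries become polynomials
  in the parameter.\<close>

lemma connectedin_rational_curve:
  fixes \<gamma> :: "'a :: alg_closed_field \<Rightarrow> 'a mat" and q :: "'a poly"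
  assumes q: "q \<noteq> 0" and \<gamma>: "\<And>s. poly q s \<noteq> 0 \<Longrightarrow> \<gamma> s \<in> carrier_mat N N"
    and rat: "\<And>i j. i < N \<Longrightarrow> j < N \<Longrightarrow> \<exists>p e. \<forall>s. poly q s \<noteq> 0 \<longrightarrow> \<gamma> s $$ (i, j) * poly q s ^ e = poly p s"
  shows "connectedin (mat_zariski N) (\<gamma> ` {s. poly q s \<noteq> 0})"
proof -
  let ?D = "{s. poly q s \<noteq> 0}"
  have ratf: "\<exists>p e. \<forall>s. poly q s \<noteq> 0 \<longrightarrow> f (\<gamma> s) * poly q s ^ e = poly p s" if "f \<in> poly_funs N" for f
    using that
  proof induction
    case (const c)
    show ?case by (rule exI[of _ "[:c:]"], rule exI[of _ 0]) simp
  next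
    case (entry i j)
    thus ?case by (rule rat)
  next
    case (add f g)
    then obtain p d p' d' where "\<And>s. poly q s \<noteq> 0 \<Longrightarrow> f (\<gamma> s) * poly q s ^ d = poly p s"
      "\<And>s. poly q s \<noteq> 0 \<Longrightarrow> g (\<gamma> s) * poly q s ^ d' = poly p' s" by blast
    hence "(f (\<gamma> s) + g (\<gamma> s)) * poly q s ^ (d + d') = poly (p * q ^ d' + p' * q ^ d) s" if "poly q s \<noteq> 0" for s
      using that by (simp add: algebra_simps power_add flip: mult.assoc)
    thus ?case by blast
  next
    case (mult f g)
    then obtain p d p' d' where pf: "\<And>s. poly q s \<noteq> 0 \<Longrightarrow> f (\<gamma> s) * poly q s ^ d = poly p s"
      and pg: "\<And>s. poly q s \<noteq> 0 \<Longrightarrow> g (\<gamma> s) * poly q s ^ d' = poly p' s" by blast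
    have "(f (\<gamma> s) * g (\<gamma> s)) * poly q s ^ (d + d') = poly (p * p') s" if "poly q s \<noteq> 0" for s
      unfolding poly_mult pf[OF that, symmetric] pg[OF that, symmetric] by (simp add: power_add mult_ac)
    thus ?case by blast
  qed
  have meet: "U \<inter> V \<inter> \<gamma> ` ?D \<noteq> {}"
    if U: "openin (mat_zariski N) U" "U \<inter> \<gamma> ` ?D \<noteq> {}" and V: "openin (mat_zariski N) V" "V \<inter> \<gamma> ` ?D \<noteq> {}" for U V
  proof -
    obtain s where s: "poly q s \<noteq> 0" "\<gamma> s \<in> U" using U(2) by auto
    obtain t where t: "poly q t \<noteq> 0" "\<gamma> t \<in> V" using V(2) by auto
    obtain f where f: "f \<in> poly_funs N" "f (\<gamma> s) \<noteq> 0" "{y \<in> carrier_mat N N. f y \<noteq> 0} \<subseteq> U"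
      using U(1) s unfolding openin_mat_zariski_iff by blast
    obtain g where g: "g \<in> poly_funs N" "g (\<gamma> t) \<noteq> 0" "{y \<in> carrier_mat N N. g y \<noteq> 0} \<subseteq> V"
      using V(1) t unfolding openin_mat_zariski_iff by blast
    obtain p d where p: "\<And>s. poly q s \<noteq> 0 \<Longrightarrow> f (\<gamma> s) * poly q s ^ d = poly p s" using ratf[OF f(1)] by blast
    obtain p' d' where p': "\<And>s. poly q s \<noteq> 0 \<Longrightarrow> g (\<gamma> s) * poly q s ^ d' = poly p' s" using ratf[OF g(1)] by blast
    have "poly p s \<noteq> 0" "poly p' t \<noteq> 0"
      unfolding p[OF s(1), symmetric] p'[OF t(1), symmetric] using s t f g by auto
    \<comment> \<open>A parameter off the roots of this product lies in the domain of the curve and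
      is sent into both open sets.\<close>
    hence "p * p' * q \<noteq> 0" using q by auto
    hence "finite {x. poly (p * p' * q) x = 0}" by (rule poly_roots_finite)
    then obtain x where "poly (p * p' * q) x \<noteq> 0"
      using infinite_UNIV_alg_closed[where 'a = 'a] by (metis (mono_tags, lifting) Collect_cong UNIV_def)
    hence x: "poly q x \<noteq> 0" "poly p x \<noteq> 0" "poly p' x \<noteq> 0" by auto
    hence "f (\<gamma> x) \<noteq> 0" "g (\<gamma> x) \<noteq> 0" using p[OF x(1)] p'[OF x(1)] by auto
    hence "\<gamma> x \<in> U \<inter> V" using f g \<gamma>[OF x(1)] by blast
    thus ?thesis using x by blast
  qed
  show ?thesis unfolding connectedin
  proof (intro conjI notI)
    show "\<gamma> ` ?D \<subseteq> topspace (mat_zariski N)" using \<gamma> by auto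
  qed (use meet in blast)
qed

section \<open>The standard Borel subgroup\<close>

text \<open>Level 0 is the upper triangular group and level 1 its unipotent part; at level
  \<open>k > 0\<close> the \<open>k - 1\<close> diagonals next to the main one vanish too, until
  level \<open>N\<close> is trivial. This filtration bounds the derived series.\<close>

definition unip_level :: "nat \<Rightarrow> nat \<Rightarrow> 'a :: field mat set" where
  "unip_level N k = {x \<in> orth N. \<forall>i<N. \<forall>j<N. j < i + k \<longrightarrow> x $$ (i, j) = (if i = j then 1 else 0)}"

text \<open>On the first diagonal left free, the product depends only on that diagonal of the
  factors, multiplicatively for \<open>k = 0\<close> and additively otherwise. It is symmetric in
  the factors in both cases.\<close>

lemma unip_level_mult_index:
  fixes x y :: "'a :: field mat"
  assumes x: "x \<in> unip_level N k" and y: "y \<in> unip_level N k" and ij: "i < N" "j < N"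
  shows "j < i + k \<Longrightarrow> (x * y) $$ (i, j) = (if i = j then 1 else 0)"
    and "j = i + k \<Longrightarrow> (x * y) $$ (i, j) = (if k = 0 then x $$ (i, j) * y $$ (i, j) else x $$ (i, j) + y $$ (i, j))"
proof -
  have xc: "x \<in> carrier_mat N N" and yc: "y \<in> carrier_mat N N"
    using x y orthD(1) by (auto simp: unip_level_def)
  have X: "\<And>i j. i < N \<Longrightarrow> j < N \<Longrightarrow> j < i + k \<Longrightarrow> x $$ (i, j) = (if i = j then 1 else 0)"
    and Y: "\<And>i j. i < N \<Longrightarrow> j < N \<Longrightarrow> j < i + k \<Longrightarrow> y $$ (i, j) = (if i = j then 1 else 0)"
    using x y by (auto simp: unip_level_def)
  have prod: "(x * y) $$ (i, j) = (\<Sum>l<N. x $$ (i, l) * y $$ (l, j))"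
    by (rule sq_mult_index[OF xc yc ij])
  show "(x * y) $$ (i, j) = (if i = j then 1 else 0)" if lt: "j < i + k"
  proof -
    have "x $$ (i, l) * y $$ (l, j) = (if l = i then (if i = j then 1 else 0) else 0)" if l: "l < N" for l
      using X[OF ij(1) l] Y[OF l ij(2)] Y[OF ij lt] lt by (cases "l < i + k") auto
    hence "(x * y) $$ (i, j) = (\<Sum>l<N. if l = i then (if i = j then 1 else 0) else 0)"
      unfolding prod by (intro sum.cong) auto
    thus ?thesis using ij by simp
  qed
  show "(x * y) $$ (i, j) = (if k = 0 then x $$ (i, j) * y $$ (i, j) else x $$ (i, j) + y $$ (i, j))"
    if eq: "j = i + k"
  proof (cases "k = 0")
    case True
    have "x $$ (i, l) * y $$ (l, j) = (if l = i then x $$ (i, j) * y $$ (i, j) else 0)" if l: "l < N" for l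
      using X[OF ij(1) l] Y[OF l ij(2)] eq True by (cases l i rule: linorder_cases) auto
    hence "(x * y) $$ (i, j) = (\<Sum>l<N. if l = i then x $$ (i, j) * y $$ (i, j) else 0)"
      unfolding prod by (intro sum.cong) auto
    thus ?thesis using ij True by simp
  next
    case False
    have "x $$ (i, l) * y $$ (l, j) = (if l = i then y $$ (i, j) else 0) + (if l = j then x $$ (i, j) else 0)"
      if l: "l < N" for l
      using X[OF ij(1) l] Y[OF l ij(2)] eq False by (cases "l < i + k") auto
    hence "(x * y) $$ (i, j) =
        (\<Sum>l<N. (if l = i then y $$ (i, j) else 0) + (if l = j then x $$ (i, j) else 0))"
      unfolding prod by (intro sum.cong) auto
    thus ?thesis using ij False by (simp add: sum.distrib)
  qed
qed

lemma unip_level_subgroup: "subgroup (unip_level N k) (split_orthogonal N :: 'a :: field mat monoid)"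
proof (rule group.subgroupI[OF split_orthogonal_group])
  show "unip_level N k \<noteq> ({} :: 'a mat set)"
    using orth_one[of N] by (auto simp: unip_level_def intro!: exI[of _ "1\<^sub>m N"])
next
  fix x :: "'a mat" assume x: "x \<in> unip_level N k"
  hence xO: "x \<in> orth N" by (simp add: unip_level_def)
  have "orth_inv N x \<in> unip_level N k"
    using x orth_inv_orth[OF xO] orth_inv_index[OF orthD(1)[OF xO]] by (auto simp: unip_level_def)
  thus "inv\<^bsub>split_orthogonal N\<^esub> x \<in> unip_level N k" by (simp add: split_orthogonal_inv[OF xO])
next
  fix x y :: "'a mat" assume x: "x \<in> unip_level N k" and y: "y \<in> unip_level N k"
  hence "x * y \<in> orth N" by (simp add: unip_level_def orth_mult)
  hence "x * y \<in> unip_level N k"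
    using unip_level_mult_index(1)[OF x y] unfolding unip_level_def by blast
  thus "x \<otimes>\<^bsub>split_orthogonal N\<^esub> y \<in> unip_level N k" by simp
qed (auto simp: unip_level_def)

text \<open>The products \<open>x * y\<close> and \<open>y * x\<close> agree up to the
  \<open>k\<close>-th diagonal. Multiplying both on the right by the same upper triangular matrix
  preserves this agreement and turns them into the commutator and the unit matrix.\<close>

lemma unip_level_commutator:
  fixes x y :: "'a :: field mat"
  assumes x: "x \<in> unip_level N k" and y: "y \<in> unip_level N k"
  shows "x * y * orth_inv N x * orth_inv N y \<in> unip_level N (Suc k)"
proof -
  have xO: "x \<in> orth N" and yO: "y \<in> orth N" using x y by (auto simp: unip_level_def)
  note xc = orthD(1)[OF xO] and yc = orthD(1)[OF yO]
  \<comment> \<open>This is the inverse of \<open>y * x\<close>.\<close>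
  define z where "z = orth_inv N x * orth_inv N y"
  have zO: "z \<in> orth N" using xO yO by (simp add: z_def orth_mult orth_inv_orth)
  note zc = orthD(1)[OF zO]
  have xyc: "x * y \<in> carrier_mat N N" "y * x \<in> carrier_mat N N" using xc yc by (simp_all add: sq_mat)
  have c: "x * y * orth_inv N x * orth_inv N y = x * y * z"
    unfolding z_def by (rule sq_mat(2)[OF xyc(1) orth_inv_carrier[OF xc] orth_inv_carrier[OF yc]])
  have "y * x * z = y * (x * orth_inv N x) * orth_inv N y"
    unfolding z_def using xc yc by (simp only: sq_mat[where N = N] orth_inv_carrier)
  hence yxz: "y * x * z = 1\<^sub>m N" using yc by (simp add: orth_inv_right xO yO)
  have zlow: "z $$ (l, j) = 0" if "l < N" "j < N" "j < l" for l j
  proof -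
    have "unip_level N k \<subseteq> unip_level N 0" by (auto simp: unip_level_def)
    hence "orth_inv N x \<in> unip_level N 0" "orth_inv N y \<in> unip_level N 0"
      using subgroup.m_inv_closed[OF unip_level_subgroup[of N 0]] x y xO yO
      by (force simp: split_orthogonal_inv)+
    thus ?thesis using unip_level_mult_index(1)[of "orth_inv N x" N 0 "orth_inv N y" l j] that by (simp add: z_def)
  qed
  have eq: "(x * y) $$ (i, l) = (y * x) $$ (i, l)" if "i < N" "l < N" "l \<le> i + k" for i l
    using unip_level_mult_index[OF x y that(1,2)] unip_level_mult_index[OF y x that(1,2)] that(3)
    by (cases "l = i + k") (simp_all add: mult.commute add.commute)
  have "(x * y * z) $$ (i, j) = (if i = j then 1 else 0)" if ij: "i < N" "j < N" "j < i + Suc k" for i j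
  proof -
    have "(x * y) $$ (i, l) * z $$ (l, j) = (y * x) $$ (i, l) * z $$ (l, j)" if "l < N" for l
      using eq[OF ij(1) that] zlow[OF that ij(2)] ij(3) by (cases "l \<le> i + k") auto
    hence "(x * y * z) $$ (i, j) = (y * x * z) $$ (i, j)"
      unfolding sq_mult_index[OF xyc(1) zc ij(1,2)] sq_mult_index[OF xyc(2) zc ij(1,2)] by (intro sum.cong) auto
    thus ?thesis unfolding yxz using ij by simp
  qed
  moreover have "x * y * z \<in> orth N" using xO yO zO by (simp add: orth_mult)
  ultimately show ?thesis unfolding c by (simp add: unip_level_def)
qed

lemma (in group) exp_of_derived_consistent:
  assumes "subgroup H G"
  shows "(derived (G\<lparr>carrier := H\<rparr>) ^^ n) H = (derived G ^^ n) H \<and> (derived G ^^ n) H \<subseteq> H"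
proof (induction n)
  case (Suc n)
  thus ?case using derived_consistent[OF _ assms] derived_incl[OF _ assms] by simp
qed simp

text \<open>This moves the derived series into the ambient group, where conjugation acts on it and
  connectedness of its members can be followed.\<close>

lemma (in group) solvable_subgroup_iff:
  assumes "subgroup H G"
  shows "solvable (G\<lparr>carrier := H\<rparr>) \<longleftrightarrow> (\<exists>n. (derived G ^^ n) H = {\<one>})"
  using group.solvable_iff_trivial_derived_seq[OF subgroup_imp_group[OF assms]]
    exp_of_derived_consistent[OF assms] by simp

lemma solvable_upper_triangular:
  fixes H :: "'a :: field mat set"
  assumes H: "subgroup H (split_orthogonal N)" and "H \<subseteq> unip_level N 0"
  shows "solvable ((split_orthogonal N)\<lparr>carrier := H\<rparr>)"
proof -
  let ?G = "split_orthogonal N :: 'a mat monoid"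
  interpret group ?G by (rule split_orthogonal_group)
  have "(derived ?G ^^ k) H \<subseteq> unip_level N k" for k
  proof (induction k)
    case (Suc k)
    have "derived_set ?G ((derived ?G ^^ k) H) \<subseteq> unip_level N (Suc k)"
    proof
      fix c assume "c \<in> derived_set ?G ((derived ?G ^^ k) H)"
      then obtain x y where xy: "x \<in> unip_level N k" "y \<in> unip_level N k"
        and c: "c = x * y * inv\<^bsub>?G\<^esub> x * inv\<^bsub>?G\<^esub> y" using Suc by auto
      have "x \<in> orth N" "y \<in> orth N" using xy by (auto simp: unip_level_def)
      thus "c \<in> unip_level N (Suc k)" using unip_level_commutator[OF xy] c by (simp add: split_orthogonal_inv)
    qed
    thus ?case
      unfolding funpow.simps(2) comp_def derived_def
      by (rule generate_subgroup_incl[OF _ unip_level_subgroup])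
  qed (use assms in simp)
  moreover have "unip_level N N \<subseteq> {1\<^sub>m N :: 'a mat}"
  proof
    fix x :: "'a mat" assume x: "x \<in> unip_level N N"
    hence "x \<in> carrier_mat N N" using orthD(1) by (auto simp: unip_level_def)
    thus "x \<in> {1\<^sub>m N}" using x by (auto simp: unip_level_def intro!: eq_matI)
  qed
  ultimately have "(derived ?G ^^ N) H \<subseteq> {\<one>\<^bsub>?G\<^esub>}" by fastforce
  moreover have "\<one>\<^bsub>?G\<^esub> \<in> (derived ?G ^^ N) H"
    by (rule subgroup.one_closed[OF exp_of_derived_is_subgroup[OF H]])
  ultimately show ?thesis unfolding solvable_subgroup_iff[OF H] by blast
qed

lemma std_borel_alt:
  "std_borel r = {b \<in> unip_level (2 * r + 1) 0. b $$ (r, r) = (1 :: 'a :: field)}"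
  by (auto simp: std_borel_def unip_level_def)

lemma std_borel_subgroup: "subgroup (std_borel r) (split_orthogonal (2 * r + 1) :: 'a :: field mat monoid)"
proof -
  define N where "N = 2 * r + 1"
  have r: "r < N" "N - 1 - r = r" by (simp_all add: N_def)
  have alt: "std_borel r = {b \<in> unip_level N 0. b $$ (r, r) = (1 :: 'a)}" by (simp only: std_borel_alt N_def)
  note sub = unip_level_subgroup[of N 0, where 'a = 'a]
  have "subgroup (std_borel r) (split_orthogonal N :: 'a mat monoid)"
  proof (rule group.subgroupI[OF split_orthogonal_group])
    show "std_borel r \<subseteq> (orth N :: 'a mat set)" by (auto simp: alt unip_level_def)
    have "(1\<^sub>m N :: 'a mat) \<in> std_borel r" using orth_one[of N] r by (auto simp: alt unip_level_def)
    thus "std_borel r \<noteq> ({} :: 'a mat set)" by blast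
  next
    fix x :: "'a mat" assume x: "x \<in> std_borel r"
    hence xO: "x \<in> orth N" by (simp add: alt unip_level_def)
    have "inv\<^bsub>split_orthogonal N\<^esub> x \<in> unip_level N 0" using subgroup.m_inv_closed[OF sub] x by (simp add: alt)
    thus "inv\<^bsub>split_orthogonal N\<^esub> x \<in> std_borel r"
      using orth_inv_index[OF orthD(1)[OF xO] r(1) r(1)] x r by (simp add: alt split_orthogonal_inv[OF xO])
  next
    fix x y :: "'a mat" assume x: "x \<in> std_borel r" and y: "y \<in> std_borel r"
    have "x * y \<in> unip_level N 0" using subgroup.m_closed[OF sub, of x y] x y by (simp add: alt)
    thus "x \<otimes>\<^bsub>split_orthogonal N\<^esub> y \<in> std_borel r"
      using unip_level_mult_index(2)[of x N 0 y r r] x y r by (simp add: alt)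
  qed
  thus ?thesis by (simp only: N_def)
qed

lemma std_borel_closed:
  "closedin (subtopology (mat_zariski (2 * r + 1)) (orth (2 * r + 1))) (std_borel r :: 'a :: field mat set)"
proof -
  define N where "N = 2 * r + 1"
  let ?F = "insert {x \<in> carrier_mat N N. x $$ (r, r) - 1 = (0 :: 'a)}
    ((\<lambda>p. {x \<in> carrier_mat N N. x $$ p = (0 :: 'a)}) ` {(i, j). i < N \<and> j < i})"
  have "r < N" by (simp add: N_def)
  hence "poly_on N (\<lambda>x. x $$ (r, r) - (1 :: 'a))"
    using poly_on_add[OF poly_on_entry[of r N r] poly_on_const[of N "- 1"]] by simp
  hence "closedin (mat_zariski N) {x \<in> carrier_mat N N. x $$ (r, r) - 1 = (0 :: 'a)}"
    by (rule closedin_poly_on_zero)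
  moreover have "closedin (mat_zariski N) {x \<in> carrier_mat N N. x $$ p = (0 :: 'a)}" if "p \<in> {(i, j). i < N \<and> j < i}" for p
    using that by (cases p) (auto intro!: closedin_poly_on_zero poly_on_entry)
  ultimately have "closedin (mat_zariski N) C" if "C \<in> ?F" for C
    using that by (elim insertE imageE) simp_all
  hence "closedin (mat_zariski N) (\<Inter>?F)" by (intro closedin_Inter) auto
  moreover have "std_borel r = \<Inter>?F \<inter> orth N"
    using orthD(1)[of _ N] by (auto simp: std_borel_def N_def)
  ultimately show ?thesis unfolding closedin_subtopology N_def by blast
qed

lemma dmat_orth:
  assumes "\<And>i. i < N \<Longrightarrow> t i * t (N - 1 - i) = 1"
  shows "dmat N t \<in> orth N"
  unfolding orth_iff[OF dmat_carrier]
proof (intro allI impI)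
  fix i j assume ij: "i < N" "j < N"
  have "split_form N (\<lambda>k. dmat N t $$ (k, i)) (\<lambda>k. dmat N t $$ (k, j)) =
      (\<Sum>k<N. if k = i then (if i + j + 1 = N then 1 else 0) else 0)"
    unfolding split_form_def
  proof (rule sum.cong)
    fix k assume "k \<in> {..<N}"
    moreover have "i + j + 1 = N \<longleftrightarrow> j = N - 1 - i" using ij by auto
    ultimately show "dmat N t $$ (k, i) * dmat N t $$ (N - 1 - k, j) =
        (if k = i then (if i + j + 1 = N then 1 else 0) else 0)"
      using ij assms[OF ij(1)] by (auto simp: dmat_def)
  qed simp
  thus "split_form N (\<lambda>k. dmat N t $$ (k, i)) (\<lambda>k. dmat N t $$ (k, j)) = (if i + j + 1 = N then 1 else 0)"
    using ij by simp
qed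

text \<open>The curve \<open>\<gamma>\<close> below contracts \<open>b\<close> to its diagonal part, and \<open>\<delta>\<close> contracts that to the identity.\<close>

lemma std_borel_connected:
  "connectedin (mat_zariski (2 * r + 1)) (std_borel r :: 'a :: alg_closed_field mat set)"
proof -
  define N where "N = 2 * r + 1"
  have r: "r < N" "N - 1 - r = r" by (simp_all add: N_def)
  have alt: "std_borel r = {b \<in> unip_level N 0. b $$ (r, r) = (1 :: 'a)}" by (simp only: std_borel_alt N_def)
  have one: "(1\<^sub>m N :: 'a mat) \<in> std_borel r" using orth_one[of N] r by (auto simp: alt unip_level_def)
  have "\<exists>C. connectedin (mat_zariski N) C \<and> C \<subseteq> std_borel r \<and> b \<in> C \<and> 1\<^sub>m N \<in> C"
    if b: "b \<in> std_borel r" for b :: "'a mat"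
  proof -
    have bO: "b \<in> orth N" and low: "\<And>i j. i < N \<Longrightarrow> j < i \<Longrightarrow> b $$ (i, j) = 0" and br: "b $$ (r, r) = 1"
      using b by (auto simp: std_borel_def N_def)
    note bc = orthD(1)[OF bO]
    define t where "t i = b $$ (i, i)" for i
    have tt: "t i * t (N - 1 - i) = 1" if "i < N" for i
      using upper_triangular_diag_nonzero[OF bO low that] by (simp add: t_def)
    \<comment> \<open>For non-zero \<open>s\<close> this is conjugation of \<open>b\<close> by the
      diagonal matrix with entries \<open>s ^ i\<close> in inverse powers. Because \<open>b\<close>
      is upper triangular the formula is polynomial and makes sense at \<open>s = 0\<close>.\<close>
    define \<gamma> where "\<gamma> s = mat N N (\<lambda>(i, j). if i \<le> j then b $$ (i, j) * s ^ (j - i) else 0)" for s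
    have \<gamma>c: "\<gamma> s \<in> carrier_mat N N" for s by (simp add: \<gamma>_def)
    have \<gamma>_std: "\<gamma> s \<in> std_borel r" for s
    proof -
      have "split_form N (\<lambda>k. \<gamma> s $$ (k, i)) (\<lambda>k. \<gamma> s $$ (k, j)) = (if i + j + 1 = N then 1 else 0)"
        if ij: "i < N" "j < N" for i j
      proof -
        \<comment> \<open>All non-zero terms carry the same power of \<open>s\<close>. The exponent
          is 0 on the antidiagonal; everywhere else the Gram entry of \<open>b\<close> is 0, so
          truncated subtraction does no harm.\<close>
        have "split_form N (\<lambda>k. \<gamma> s $$ (k, i)) (\<lambda>k. \<gamma> s $$ (k, j)) =
            (\<Sum>k<N. s ^ (i + j + 1 - N) * (b $$ (k, i) * b $$ (N - 1 - k, j)))"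
          unfolding split_form_def
        proof (rule sum.cong)
          fix k assume "k \<in> {..<N}"
          hence k: "k < N" by simp
          show "\<gamma> s $$ (k, i) * \<gamma> s $$ (N - 1 - k, j) = s ^ (i + j + 1 - N) * (b $$ (k, i) * b $$ (N - 1 - k, j))"
          proof (cases "k \<le> i \<and> N - 1 - k \<le> j")
            case True
            hence "(i - k) + (j - (N - 1 - k)) = i + j + 1 - N" using k by linarith
            hence "s ^ (i - k) * s ^ (j - (N - 1 - k)) = s ^ (i + j + 1 - N)" by (simp only: flip: power_add)
            thus ?thesis using True k ij by (simp add: \<gamma>_def mult_ac)
          next
            case False
            thus ?thesis using k ij low[of k i] low[of "N - 1 - k" j] by (auto simp: \<gamma>_def)
          qed
        qed simp
        also have "\<dots> = s ^ (i + j + 1 - N) * split_form N (\<lambda>k. b $$ (k, i)) (\<lambda>k. b $$ (k, j))"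
          unfolding split_form_def by (rule sum_distrib_left[symmetric])
        also have "\<dots> = (if i + j + 1 = N then 1 else 0)"
          using bO ij unfolding orth_iff[OF bc] by auto
        finally show ?thesis .
      qed
      hence "\<gamma> s \<in> orth N" unfolding orth_iff[OF \<gamma>c] by blast
      thus ?thesis using r br by (auto simp: alt unip_level_def \<gamma>_def)
    qed
    have c1: "connectedin (mat_zariski N) (\<gamma> ` {s. poly (1 :: 'a poly) s \<noteq> 0})"
    proof (rule connectedin_rational_curve)
      fix i j assume ij: "i < N" "j < N"
      show "\<exists>p e. \<forall>s. poly (1 :: 'a poly) s \<noteq> 0 \<longrightarrow> \<gamma> s $$ (i, j) * poly 1 s ^ e = poly p s"
        by (rule exI[of _ "if i \<le> j then monom (b $$ (i, j)) (j - i) else 0"], rule exI[of _ 0])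
          (use ij in \<open>simp add: \<gamma>_def poly_monom\<close>)
    qed (simp_all add: \<gamma>c)
    \<comment> \<open>A straight line from 1 to \<open>t i\<close> for the first \<open>r\<close>
      diagonal entries; the last \<open>r\<close> entries are the inverses. The polynomial
      \<open>q\<close> vanishes exactly where one of the lines meets 0.\<close>
    define u where "u i s = 1 + s * (t i - 1)" for i and s :: 'a
    define q where "q = (\<Prod>i<r. [:1, t i - 1:])"
    have qs: "poly q s = (\<Prod>i<r. u i s)" for s by (simp add: q_def poly_prod u_def algebra_simps)
    have t_nz: "t i \<noteq> 0" if "i < N" for i using tt[OF that] by auto
    have q01: "poly q 0 \<noteq> 0" "poly q 1 \<noteq> 0" using t_nz r by (auto simp: qs u_def)
    hence q0: "q \<noteq> 0" by auto
    define v where "v s i = (if i < r then u i s else if i = r then 1 else inverse (u (N - 1 - i) s))" for s i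
    define \<delta> where "\<delta> s = dmat N (v s)" for s
    have \<delta>_std: "\<delta> s \<in> std_borel r" if s: "poly q s \<noteq> 0" for s
    proof -
      have nz: "u i s \<noteq> 0" if "i < r" for i using s that by (auto simp: qs)
      have "v s i * v s (N - 1 - i) = 1" if i: "i < N" for i
      proof (cases i r rule: linorder_cases)
        case less
        hence "\<not> N - 1 - i < r" "N - 1 - i \<noteq> r" "N - 1 - (N - 1 - i) = i" by (auto simp: N_def)
        thus ?thesis using less nz by (simp add: v_def)
      next
        case equal
        thus ?thesis using r by (simp add: v_def)
      next
        case greater
        hence "N - 1 - i < r" using i by (auto simp: N_def)
        thus ?thesis using greater nz by (simp add: v_def)
      qed
      hence "\<delta> s \<in> orth N" unfolding \<delta>_def by (rule dmat_orth)
      thus ?thesis using r by (auto simp: alt unip_level_def \<delta>_def dmat_def v_def)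
    qed
    have c2: "connectedin (mat_zariski N) (\<delta> ` {s. poly q s \<noteq> 0})"
    proof (rule connectedin_rational_curve[OF q0])
      show "\<delta> s \<in> carrier_mat N N" for s by (simp add: \<delta>_def)
    next
      fix i j assume ij: "i < N" "j < N"
      show "\<exists>p e. \<forall>s. poly q s \<noteq> 0 \<longrightarrow> \<delta> s $$ (i, j) * poly q s ^ e = poly p s"
      proof (cases "i = j \<and> r < i")
        case False
        show ?thesis
          by (rule exI[of _ "if i = j then if i < r then [:1, t i - 1:] else 1 else 0"], rule exI[of _ 0])
            (use ij False in \<open>auto simp: \<delta>_def dmat_def v_def u_def algebra_simps\<close>)
      next
        case True
        define k where "k = N - 1 - i"
        have k: "k < r" using True ij by (auto simp: k_def N_def)
        \<comment> \<open>The inverse of one factor of \<open>q\<close> is the product of the other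
          factors divided by \<open>q\<close>, so the exponent 1 clears the denominator.\<close>
        have "\<delta> s $$ (i, j) * poly q s ^ 1 = poly (\<Prod>i\<in>{..<r} - {k}. [:1, t i - 1:]) s" if "poly q s \<noteq> 0" for s
        proof -
          have "u k s \<noteq> 0" using that k by (auto simp: qs)
          moreover have "poly q s = u k s * (\<Prod>i\<in>{..<r} - {k}. u i s)"
            unfolding qs using k by (simp add: prod.remove)
          moreover have "poly (\<Prod>i\<in>{..<r} - {k}. [:1, t i - 1:]) s = (\<Prod>i\<in>{..<r} - {k}. u i s)"
            by (simp add: poly_prod u_def algebra_simps)
          ultimately show ?thesis using True ij by (simp add: \<delta>_def dmat_def v_def k_def)
        qed
        thus ?thesis by blast
      qed
    qed
    have "\<delta> 1 = \<gamma> 0"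
    proof -
      have "v 1 i = t i" if i: "i < N" for i
      proof (cases i r rule: linorder_cases)
        case greater
        thus ?thesis using tt[OF i] by (simp add: v_def u_def inverse_unique mult.commute)
      qed (use br in \<open>simp_all add: v_def u_def t_def\<close>)
      thus ?thesis by (intro eq_matI) (auto simp: \<delta>_def dmat_def \<gamma>_def t_def)
    qed
    moreover have "\<delta> 0 = 1\<^sub>m N" by (intro eq_matI) (auto simp: \<delta>_def dmat_def v_def u_def)
    moreover have "\<gamma> 1 = b"
      by (intro eq_matI) (use bc low in \<open>auto simp: \<gamma>_def not_le\<close>)
    ultimately have mem: "\<gamma> 0 \<in> \<delta> ` {s. poly q s \<noteq> 0}" "1\<^sub>m N \<in> \<delta> ` {s. poly q s \<noteq> 0}" "b \<in> range \<gamma>"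
      using q01 by (metis (mono_tags, lifting) imageI mem_Collect_eq rangeI)+
    have "connectedin (mat_zariski N) (range \<gamma> \<union> \<delta> ` {s. poly q s \<noteq> 0})"
      by (rule connectedin_Un) (use c1 c2 mem in auto)
    moreover have "range \<gamma> \<union> \<delta> ` {s. poly q s \<noteq> 0} \<subseteq> std_borel r" using \<gamma>_std \<delta>_std by auto
    ultimately show ?thesis using mem by blast
  qed
  then obtain C where C: "\<And>b. b \<in> std_borel r \<Longrightarrow>
      connectedin (mat_zariski N) (C b) \<and> C b \<subseteq> std_borel r \<and> b \<in> C b \<and> (1\<^sub>m N :: 'a mat) \<in> C b"
    by metis
  have "connectedin (mat_zariski N) (\<Union>(C ` std_borel r))"
    by (rule connectedin_Union) (use C one in auto)
  moreover have "\<Union>(C ` std_borel r) = std_borel r" using C by blast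
  ultimately show ?thesis by (simp add: N_def)
qed

theorem std_borel_closed_connected_solvable:
  "closed_connected_solvable (2 * r + 1) (split_orthogonal (2 * r + 1)) (std_borel r :: 'a :: alg_closed_field mat set)"
  unfolding closed_connected_solvable_def
proof (intro conjI)
  show "connectedin (subtopology (mat_zariski (2 * r + 1)) (orth (2 * r + 1))) (std_borel r :: 'a mat set)"
    unfolding connectedin_subtopology using std_borel_connected by (auto simp: std_borel_def)
  show "solvable ((split_orthogonal (2 * r + 1))\<lparr>carrier := std_borel r :: 'a mat set\<rparr>)"
    by (rule solvable_upper_triangular[OF std_borel_subgroup]) (auto simp: std_borel_alt)
qed (rule std_borel_subgroup std_borel_closed)+

section \<open>Transport of closed connected solvable subgroups by conjugation\<close>

definition orth_conj :: "nat \<Rightarrow> 'a :: field mat \<Rightarrow> 'a mat \<Rightarrow> 'a mat" where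
  "orth_conj N g x = g * x * orth_inv N g"

lemma poly_map_orth_conj: "g \<in> carrier_mat N N \<Longrightarrow> poly_map N (orth_conj N g)"
  unfolding orth_conj_def by (intro poly_map_mult poly_map_const poly_map_id) simp_all

lemma orth_conj_closed: "g \<in> orth N \<Longrightarrow> x \<in> orth N \<Longrightarrow> orth_conj N g x \<in> orth N"
  by (simp add: orth_conj_def orth_mult orth_inv_orth)

lemma orth_inv_inv: "g \<in> orth N \<Longrightarrow> orth_inv N (orth_inv N g) = g" for g :: "'a :: field mat"
  using group.inv_inv[OF split_orthogonal_group, of g N] by (simp add: split_orthogonal_inv orth_inv_orth)

lemma orth_inv_mult: "g \<in> orth N \<Longrightarrow> h \<in> orth N \<Longrightarrow> orth_inv N (g * h) = orth_inv N h * orth_inv N g"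
  for g :: "'a :: field mat"
  using group.inv_mult_group[OF split_orthogonal_group, of g N h] by (simp add: split_orthogonal_inv orth_mult)

lemma orth_conj_mult:
  assumes "g \<in> orth N" "h \<in> orth N" "x \<in> carrier_mat N N"
  shows "orth_conj N (g * h) x = orth_conj N g (orth_conj N h x)"
  using assms orthD(1)[OF assms(1)] orthD(1)[OF assms(2)]
  by (simp only: orth_conj_def orth_inv_mult sq_mat[where N = N] orth_inv_carrier)

lemma orth_conj_one: "x \<in> carrier_mat N N \<Longrightarrow> orth_conj N (1\<^sub>m N) x = x"
proof -
  assume "x \<in> carrier_mat N N"
  moreover have "orth_inv N (1\<^sub>m N) = (1\<^sub>m N :: 'a mat)" by (simp add: orth_inv_def gram_gram sq_mat(4)[where N = N])
  ultimately show ?thesis by (simp add: orth_conj_def)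
qed

lemma orth_conj_inv:
  assumes "g \<in> orth N" "x \<in> carrier_mat N N"
  shows "orth_conj N (orth_inv N g) (orth_conj N g x) = x" "orth_conj N g (orth_conj N (orth_inv N g) x) = x"
  using orth_conj_mult[OF orth_inv_orth[OF assms(1)] assms(1,2)] orth_conj_mult[OF assms(1) orth_inv_orth[OF assms(1)] assms(2)]
  by (simp_all add: orth_inv_left orth_inv_right orth_conj_one assms)

lemma orth_conj_hom:
  assumes g: "g \<in> orth N"
  shows "group_hom (split_orthogonal N) (split_orthogonal N) (orth_conj N (g :: 'a :: field mat))"
proof (rule group_hom.intro[OF split_orthogonal_group split_orthogonal_group], unfold_locales)
  have "orth_conj N g (x * y) = orth_conj N g x * orth_conj N g y" if "x \<in> orth N" "y \<in> orth N" for x y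
  proof -
    note c = orthD(1)[OF g] orthD(1)[OF that(1)] orthD(1)[OF that(2)]
    have "orth_conj N g x * orth_conj N g y = g * x * ((orth_inv N g * g) * (y * orth_inv N g))"
      unfolding orth_conj_def using c by (simp only: sq_mat[where N = N] orth_inv_carrier)
    also have "\<dots> = orth_conj N g (x * y)"
      unfolding orth_conj_def orth_inv_left[OF g] using c by (simp only: sq_mat[where N = N] orth_inv_carrier)
    finally show ?thesis by simp
  qed
  thus "orth_conj N g \<in> hom (split_orthogonal N) (split_orthogonal N)"
    using orth_conj_closed[OF g] by (auto simp: hom_def)
qed

lemma closed_connected_solvable_conj:
  fixes H :: "'a :: field mat set"
  assumes g: "g \<in> orth N" and H: "closed_connected_solvable N (split_orthogonal N) H"
  shows "closed_connected_solvable N (split_orthogonal N) (orth_conj N g ` H)"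
proof -
  let ?G = "split_orthogonal N :: 'a mat monoid"
  interpret h: group_hom ?G ?G "orth_conj N g" by (rule orth_conj_hom[OF g])
  have sub: "subgroup H ?G" and closed: "closedin (subtopology (mat_zariski N) (orth N)) H"
    and conn: "connectedin (mat_zariski N) H" and solv: "solvable (?G\<lparr>carrier := H\<rparr>)"
    using H by (auto simp: closed_connected_solvable_def connectedin_subtopology)
  have HO: "H \<subseteq> orth N" by (rule subgroup.subset[OF sub])
  have sub': "subgroup (orth_conj N g ` H) ?G" by (rule h.subgroup_img_is_subgroup[OF sub])
  note gc = orthD(1)[OF g] and gi = orth_inv_orth[OF g]
  have "connectedin (mat_zariski N) (orth_conj N g ` H)"
    by (rule connectedin_continuous_map_image[OF continuous_map_poly_map[OF poly_map_orth_conj[OF gc]] conn])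
  moreover have "closedin (subtopology (mat_zariski N) (orth N)) (orth_conj N g ` H)"
  proof -
    obtain C where C: "closedin (mat_zariski N) C" "H = C \<inter> orth N"
      using closed by (auto simp: closedin_subtopology)
    let ?C = "{x \<in> topspace (mat_zariski N). orth_conj N (orth_inv N g) x \<in> C}"
    have "closedin (mat_zariski N) ?C"
      by (rule closedin_continuous_map_preimage[OF continuous_map_poly_map[OF poly_map_orth_conj] C(1)])
        (use gc in simp)
    moreover have "orth_conj N g ` H = ?C \<inter> orth N"
    proof (intro equalityI subsetI)
      fix x assume "x \<in> ?C \<inter> orth N"
      hence x: "x \<in> orth N" "orth_conj N (orth_inv N g) x \<in> H"
        using C(2) orth_conj_closed[OF gi] by auto
      thus "x \<in> orth_conj N g ` H" using orth_conj_inv(2)[OF g orthD(1)[OF x(1)]] by (metis imageI)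
    next
      fix x assume "x \<in> orth_conj N g ` H"
      then obtain y where y: "y \<in> H" "x = orth_conj N g y" by auto
      hence "y \<in> orth N" "y \<in> C" using C(2) by auto
      thus "x \<in> ?C \<inter> orth N"
        using orth_conj_inv(1)[OF g orthD(1), of y] orth_conj_closed[OF g, of y] y(2) orthD(1)[of x N] by simp
    qed
    ultimately show ?thesis unfolding closedin_subtopology by blast
  qed
  moreover have "solvable (?G\<lparr>carrier := orth_conj N g ` H\<rparr>)"
  proof -
    obtain n where "(derived ?G ^^ n) H = {\<one>\<^bsub>?G\<^esub>}" using solv h.solvable_subgroup_iff[OF sub] by blast
    hence "(derived ?G ^^ n) (orth_conj N g ` H) = {\<one>\<^bsub>?G\<^esub>}"
      using h.exp_of_derived_img[OF HO, of n] h.hom_one by simp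
    thus ?thesis unfolding h.solvable_subgroup_iff[OF sub'] by blast
  qed
  ultimately show ?thesis
    using sub' subgroup.subset[OF sub'] by (simp add: closed_connected_solvable_def connectedin_subtopology)
qed

section \<open>The Lie--Kolchin theorem\<close>

text \<open>Each element is joined to the identity by a connected set. For a commutator with
  \<open>b\<close> fixed, the first argument varies over \<open>H\<close> and reaches the identity
  at 1; for a product, the set of the second factor is translated so that it meets the set of the
  first.\<close>

lemma derived_connected:
  fixes H :: "'a :: field mat set"
  assumes H: "subgroup H (split_orthogonal N)" and conn: "connectedin (mat_zariski N) H"
  shows "connectedin (mat_zariski N) (derived (split_orthogonal N) H)"
proof -
  let ?G = "split_orthogonal N :: 'a mat monoid" and ?X = "mat_zariski N :: 'a mat topology"
  interpret group ?G by (rule split_orthogonal_group)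
  have HO: "H \<subseteq> orth N" by (rule subgroup.subset[OF H])
  have oneH: "1\<^sub>m N \<in> H" using subgroup.one_closed[OF H] by simp
  define D where "D = derived_set ?G H"
  have D_iff: "h \<in> D \<longleftrightarrow> (\<exists>a\<in>H. \<exists>b\<in>H. h = a * b * orth_inv N a * orth_inv N b)" for h
    using HO by (auto simp: D_def split_orthogonal_inv subset_iff)
  let ?D' = "derived ?G H"
  have D': "?D' = generate ?G D" by (simp add: derived_def D_def)
  have DO: "?D' \<subseteq> orth N" by (rule derived_in_carrier[OF HO])
  have img: "connectedin ?X (\<phi> ` A)" if "poly_map N \<phi>" "connectedin ?X A" for \<phi> and A :: "'a mat set"
    using connectedin_continuous_map_image[OF continuous_map_poly_map] that by blast
  have comm: "\<exists>A. connectedin ?X A \<and> A \<subseteq> D \<and> 1\<^sub>m N \<in> A \<and> h \<in> A" if h: "h \<in> D" for h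
  proof -
    obtain a b where ab: "a \<in> H" "b \<in> H" "h = a * b * orth_inv N a * orth_inv N b" using h unfolding D_iff by blast
    have abO: "a \<in> orth N" "b \<in> orth N" using ab HO by auto
    let ?c = "\<lambda>x. x * b * orth_inv N x * orth_inv N b"
    have bc: "b \<in> carrier_mat N N" "orth_inv N b \<in> carrier_mat N N" using orthD(1)[OF abO(2)] by simp_all
    have pm: "poly_map N ?c"
      by (intro poly_map_mult poly_map_id poly_map_orth_inv poly_map_const bc)
    have "orth_inv N (1\<^sub>m N) = (1\<^sub>m N :: 'a mat)"
      using inv_one split_orthogonal_inv[OF orth_one, where 'a = 'a and N = N] by simp
    hence "?c (1\<^sub>m N) = 1\<^sub>m N" using bc by (simp add: orth_inv_right[OF abO(2)])
    hence "1\<^sub>m N \<in> ?c ` H" using oneH by (intro image_eqI[of _ _ "1\<^sub>m N"]) simp_all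
    moreover have "?c ` H \<subseteq> D" using ab(2) D_iff by blast
    moreover have "h = ?c a" by (rule ab(3))
    ultimately show ?thesis using img[OF pm conn] ab(1) by blast
  qed
  have DD: "D \<subseteq> ?D'" unfolding D' by (auto intro: generate.incl)
  have ex: "\<exists>A. connectedin ?X A \<and> A \<subseteq> ?D' \<and> 1\<^sub>m N \<in> A \<and> g \<in> A" if "g \<in> generate ?G D" for g
    using that
  proof induction
    case one
    have "1\<^sub>m N \<in> ?D'" using generate.one[of ?G D] by (simp add: D')
    thus ?case using connectedin_sing[of ?X "1\<^sub>m N"] by (intro exI[of _ "{1\<^sub>m N}"]) auto
  next
    case (incl h)
    thus ?case using comm DD by blast
  next
    case (inv h)
    then obtain A where A: "connectedin ?X A" "A \<subseteq> D" "1\<^sub>m N \<in> A" "h \<in> A" using comm by blast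
    have eq: "orth_inv N x = inv\<^bsub>?G\<^esub> x" if "x \<in> A" for x
      using that A(2) DD DO by (intro split_orthogonal_inv[symmetric]) auto
    have "orth_inv N ` A \<subseteq> ?D'"
      using eq A(2) generate.inv[of _ D ?G] by (auto simp: D')
    moreover have "inv\<^bsub>?G\<^esub> h \<in> orth_inv N ` A" using eq A(4) by force
    moreover have "1\<^sub>m N \<in> orth_inv N ` A" using eq[OF A(3)] A(3) inv_one by force
    ultimately show ?case using img[OF poly_map_orth_inv A(1)] by blast
  next
    case (eng h1 h2)
    then obtain A1 A2 where A1: "connectedin ?X A1" "A1 \<subseteq> ?D'" "1\<^sub>m N \<in> A1" "h1 \<in> A1"
      and A2: "connectedin ?X A2" "A2 \<subseteq> ?D'" "1\<^sub>m N \<in> A2" "h2 \<in> A2" by blast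
    have h1: "h1 \<in> carrier_mat N N" using A1 DO orthD(1) by blast
    have "(\<lambda>x. h1 * x) ` A2 \<subseteq> ?D'"
      using A1(2,4) A2(2) generate.eng[of _ ?G D] by (auto simp: D')
    moreover have "h1 \<in> (\<lambda>x. h1 * x) ` A2" using A2(3) h1 by (intro image_eqI[of _ _ "1\<^sub>m N"]) auto
    moreover have "connectedin ?X ((\<lambda>x. h1 * x) ` A2)"
      by (rule img[OF _ A2(1)]) (intro poly_map_mult poly_map_const poly_map_id h1)
    ultimately have "connectedin ?X (A1 \<union> (\<lambda>x. h1 * x) ` A2)" "A1 \<union> (\<lambda>x. h1 * x) ` A2 \<subseteq> ?D'"
      using A1 by (auto intro!: connectedin_Un)
    moreover have "h1 \<otimes>\<^bsub>?G\<^esub> h2 \<in> (\<lambda>x. h1 * x) ` A2" using A2 by simp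
    ultimately show ?case using A1(3) by blast
  qed
  hence "\<forall>g\<in>?D'. \<exists>A. connectedin ?X A \<and> A \<subseteq> ?D' \<and> 1\<^sub>m N \<in> A \<and> g \<in> A" by (simp add: D')
  then obtain A where A: "\<And>g. g \<in> ?D' \<Longrightarrow> connectedin ?X (A g) \<and> A g \<subseteq> ?D' \<and> 1\<^sub>m N \<in> A g \<and> g \<in> A g" by metis
  have "connectedin ?X (\<Union>(A ` ?D'))"
    by (rule connectedin_Union) (use A generate.one[of ?G D] in \<open>auto simp: D'\<close>)
  moreover have "\<Union>(A ` ?D') = ?D'" using A by blast
  ultimately show ?thesis by simp
qed

abbreviation coord_space :: "nat \<Rightarrow> (nat \<Rightarrow> 'a :: field) set" where
  "coord_space d \<equiv> fv.span (unit_fv ` {..<d})"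

section \<open>Eigenvalues and eigenvectors on stable subspaces\<close>

lemma finite_eigenvalues:
  fixes A :: "'a :: field mat"
  assumes A: "A \<in> carrier_mat d d"
  shows "finite {c. \<exists>v\<in>coord_space d. v \<noteq> 0 \<and> act d A v = fscale c v}"
proof (rule finite_subset)
  show "{c. \<exists>v\<in>coord_space d. v \<noteq> 0 \<and> act d A v = fscale c v} \<subseteq> {c. poly (char_poly A) c = 0}"
  proof
    fix c assume "c \<in> {c. \<exists>v\<in>coord_space d. v \<noteq> 0 \<and> act d A v = fscale c v}"
    then obtain v where v: "v \<in> coord_space d" "v \<noteq> 0" "act d A v = fscale c v" by blast
    note v0 = v(1)[unfolded span_unit_iff]
    obtain i where i: "v i \<noteq> 0" using v(2) by (auto simp: fun_eq_iff)
    hence "i < d" using v0 by (meson not_less)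
    hence "vec d v $ i \<noteq> (0\<^sub>v d) $ i" using i by simp
    hence nz: "vec d v \<noteq> 0\<^sub>v d" by auto
    have "A *\<^sub>v vec d v = c \<cdot>\<^sub>v vec d v"
    proof (rule eq_vecI)
      fix i assume "i < dim_vec (c \<cdot>\<^sub>v vec d v)"
      hence i: "i < d" by simp
      have "(A *\<^sub>v vec d v) $ i = act d A v i"
        using A i by (auto simp: act_def scalar_prod_def lessThan_atLeast0 intro!: sum.cong)
      thus "(A *\<^sub>v vec d v) $ i = (c \<cdot>\<^sub>v vec d v) $ i" using i v(3) by (simp add: fscale_def)
    qed (use A in simp)
    hence "eigenvector A (vec d v) c" using nz A by (simp add: eigenvector_def)
    hence "eigenvalue A c" by (auto simp: eigenvalue_def)
    thus "c \<in> {c. poly (char_poly A) c = 0}" using eigenvalue_root_char_poly[OF A] by simp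
  qed
  have "char_poly A \<noteq> 0" using degree_monic_char_poly[OF A] by auto
  thus "finite {c. poly (char_poly A) c = 0}" by (rule poly_roots_finite)
qed

text \<open>The vector \<open>p(A) w\<close>, evaluated by the Horner scheme.\<close>

definition poly_act :: "nat \<Rightarrow> 'a :: field mat \<Rightarrow> (nat \<Rightarrow> 'a) \<Rightarrow> 'a poly \<Rightarrow> nat \<Rightarrow> 'a" where
  "poly_act d A w p = fold_coeffs (\<lambda>a v. fscale a w + act d A v) p 0"

lemma act_zero [simp]: "act d A 0 = (0 :: nat \<Rightarrow> 'a :: field)"
  by (auto simp: act_def fun_eq_iff)

lemma poly_act_0 [simp]: "poly_act d A w 0 = 0"
  by (simp add: poly_act_def)

lemma poly_act_pCons: "poly_act d A w (pCons a p) = fscale a w + act d A (poly_act d A w p)"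
proof (cases "a = 0 \<and> p = 0")
  case False
  thus ?thesis by (auto simp: poly_act_def fold_coeffs_pCons_coeff_not_0_eq fold_coeffs_pCons_not_0_0_eq)
qed simp

lemma poly_act_add: "poly_act d A w (p + q) = poly_act d A w p + poly_act d A w q"
  by (induction p q rule: poly_induct2) (simp_all add: poly_act_pCons act_add fv.scale_left_distrib add_ac del: plus_fun_apply)

lemma poly_act_smult: "poly_act d A w (Polynomial.smult c p) = fscale c (poly_act d A w p)"
  by (induction p)
    (simp_all add: poly_act_pCons act_scale fv.scale_right_distrib del: plus_fun_apply zero_fun_apply)

lemma poly_act_linear_factor:
  "poly_act d A w ([:- c, 1:] * q) = act d A (poly_act d A w q) - fscale c (poly_act d A w q)"
proof -
  have eq: "[:- c, 1:] * q = Polynomial.smult (- c) q + pCons 0 q" by simp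
  show ?thesis
    unfolding eq poly_act_add poly_act_smult poly_act_pCons by (rule ext) (simp add: fscale_def)
qed

lemma poly_act_monom: "poly_act d A w (monom 1 k) = (act d A ^^ k) w"
  by (induction k) (simp_all add: monom_Suc monom_0 poly_act_pCons)

text \<open>Among the iterates of \<open>w\<close>, one must depend on its predecessors, as
  \<open>d + 1\<close> independent vectors do not fit into dimension \<open>d\<close>. The
  dependence is a monic polynomial that kills \<open>w\<close>.\<close>

lemma annihilating_poly_exists:
  fixes w :: "nat \<Rightarrow> 'a :: field"
  assumes w: "w \<in> coord_space d"
  shows "\<exists>p. p \<noteq> 0 \<and> poly_act d A w p = 0"
proof -
  let ?b = "\<lambda>i. (act d A ^^ i) w"
  have b: "?b i \<in> coord_space d" for i by (induction i) (use w in \<open>simp_all add: act_span\<close>)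
  have "\<exists>k. ?b k \<in> fv.span (?b ` {..<k})"
  proof (rule ccontr)
    assume no: "\<nexists>k. ?b k \<in> fv.span (?b ` {..<k})"
    have "fv.independent (?b ` {..<k}) \<and> card (?b ` {..<k}) = k" for k
    proof (induction k)
      case (Suc k)
      have "?b k \<notin> fv.span (?b ` {..<k})" using no by blast
      moreover from this have "?b k \<notin> ?b ` {..<k}" using fv.span_base by metis
      moreover have "?b ` {..<Suc k} = insert (?b k) (?b ` {..<k})" by (simp only: lessThan_Suc image_insert)
      ultimately show ?case using Suc by (simp only: fv.independent_insert card_insert_if) simp
    qed (simp add: fv.independent_empty)
    moreover have "?b ` {..<Suc d} \<subseteq> coord_space d" using b by auto
    ultimately have "card (?b ` {..<Suc d}) \<le> card (unit_fv ` {..<d} :: (nat \<Rightarrow> 'a) set)"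
      using fv.independent_span_bound by blast
    also have "\<dots> \<le> d" using card_image_le[of "{..<d}"] by fastforce
    finally show False using \<open>\<And>k. _ \<and> card (?b ` {..<k}) = k\<close>[of "Suc d"] by simp
  qed
  then obtain k where k: "?b k \<in> fv.span (?b ` {..<k})" ..
  have "\<exists>q. (\<forall>i\<ge>k. coeff q i = 0) \<and> poly_act d A w q = x" if "x \<in> fv.span (?b ` {..<k})" for x
    using that
  proof (induction rule: fv.span_induct_alt)
    case base
    show ?case by (rule exI[of _ 0]) simp
  next
    case (step c x y)
    then obtain q j where "\<forall>i\<ge>k. coeff q i = 0" "poly_act d A w q = y" "j < k" "x = ?b j" by auto
    thus ?case
      by (intro exI[of _ "Polynomial.smult c (monom 1 j) + q"])
        (auto simp: poly_act_add poly_act_smult poly_act_monom)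
  qed
  from this[OF k] obtain q where q: "\<forall>i\<ge>k. coeff q i = 0" "poly_act d A w q = ?b k" by blast
  have "poly_act d A w (monom 1 k + Polynomial.smult (- 1) q) = 0"
    unfolding poly_act_add poly_act_smult poly_act_monom q(2) by simp
  moreover have "coeff (monom 1 k + Polynomial.smult (- 1) q) k = 1" using q(1) by simp
  hence "monom 1 k + Polynomial.smult (- 1) q \<noteq> 0" by (metis coeff_0 zero_neq_one)
  ultimately show ?thesis by blast
qed

text \<open>Take a polynomial of least degree that kills \<open>w\<close> and split off a linear
  factor. By minimality the cofactor sends \<open>w\<close> to a non-zero vector, which the linear
  factor kills. The vector stays in \<open>W\<close>, so the restriction of \<open>A\<close> to
  \<open>W\<close> never has to be written as a matrix.\<close>

lemma eigenvector_in_stable_subspace: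
  fixes A :: "'a :: alg_closed_field mat"
  assumes W: "fv.subspace W" "W \<subseteq> coord_space d" "\<And>v. v \<in> W \<Longrightarrow> act d A v \<in> W" and w: "w \<in> W" "w \<noteq> 0"
  obtains v c where "v \<in> W" "v \<noteq> 0" "act d A v = fscale c v"
proof -
  define P where "P p \<longleftrightarrow> p \<noteq> 0 \<and> poly_act d A w p = 0" for p
  obtain p where p: "P p" and min: "\<And>q. P q \<Longrightarrow> degree p \<le> degree q"
    using annihilating_poly_exists[of w d A] W(2) w(1) ex_has_least_nat[of P _ degree] by (metis P_def subsetD)
  have "degree p > 0"
  proof (rule ccontr)
    assume "\<not> degree p > 0"
    then obtain c where "p = [:c:]" using degree_eq_zeroE by blast
    thus False using p w by (auto simp: P_def poly_act_pCons)
  qed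
  then obtain c where "poly p c = 0" using alg_closed_imp_poly_has_root by blast
  then obtain q where q: "p = [:- c, 1:] * q" by (auto simp: poly_eq_0_iff_dvd elim: dvdE)
  have q0: "q \<noteq> 0" using p q by (auto simp: P_def)
  hence "degree p = degree q + 1" unfolding q by (subst degree_mult_eq) auto
  hence "\<not> P q" using min[of q] by auto
  hence nz: "poly_act d A w q \<noteq> 0" using q0 by (simp add: P_def)
  have "poly_act d A w q \<in> W"
    by (induction q) (use W w in \<open>auto simp: poly_act_pCons fv.subspace_add fv.subspace_scale fv.subspace_0
        simp del: plus_fun_apply zero_fun_apply\<close>)
  moreover have "act d A (poly_act d A w q) = fscale c (poly_act d A w q)"
    using p poly_act_linear_factor[of d A w c q] by (simp add: P_def q)
  ultimately show thesis using that nz by blast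
qed

lemma dim_strict_mono:
  fixes U W :: "(nat \<Rightarrow> 'a :: field) set"
  assumes U: "fv.subspace U" and W: "W \<subseteq> coord_space d" and UW: "U \<subset> W"
  shows "fv.dim U < fv.dim W"
proof -
  obtain B where B: "B \<subseteq> U" "fv.independent B" "U \<subseteq> fv.span B" "card B = fv.dim U"
    using fv.basis_exists by blast
  obtain v where v: "v \<in> W" "v \<notin> U" using UW by blast
  have "fv.span B \<subseteq> U" using B(1) U by (metis fv.span_minimal)
  hence vB: "v \<notin> fv.span B" using v by auto
  hence "fv.independent (insert v B)" using B(2) by (simp add: fv.independent_insert)
  moreover have "insert v B \<subseteq> W" using v B UW by auto
  ultimately obtain C where C: "insert v B \<subseteq> C" "C \<subseteq> W" "fv.independent C" "W \<subseteq> fv.span C"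
    using fv.maximal_independent_subset_extend by metis
  have finC: "finite C" using fv.independent_span_bound[OF _ C(3)] C(2) W by blast
  have "v \<notin> B" using vB fv.span_base by blast
  hence "card B < card (insert v B)" using finC C(1) finite_subset by fastforce
  also have "\<dots> \<le> card C" by (rule card_mono[OF finC C(1)])
  also have "card C = fv.dim W" using fv.basis_card_eq_dim[OF C(2) C(4) C(3)] by simp
  finally show ?thesis using B by simp
qed

text \<open>The representation dimension \<open>d\<close> is separate from the matrix size
  \<open>N\<close>: in the application \<open>\<rho>\<close> is the middle block of a partly
  triangularized group, while the group and its topology stay those of \<open>N\<close> by
  \<open>N\<close> matrices.\<close>

locale polynomial_rep =
  fixes N d :: nat and H0 :: "'a :: alg_closed_field mat set" and \<rho> :: "'a mat \<Rightarrow> 'a mat"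
  assumes H0: "subgroup H0 (split_orthogonal N)"
    and \<rho>_carrier: "x \<in> H0 \<Longrightarrow> \<rho> x \<in> carrier_mat d d"
    and \<rho>_mult: "x \<in> H0 \<Longrightarrow> y \<in> H0 \<Longrightarrow> \<rho> (x * y) = \<rho> x * \<rho> y"
    and \<rho>_one: "\<rho> (1\<^sub>m N) = 1\<^sub>m d"
    and \<rho>_poly: "i < d \<Longrightarrow> j < d \<Longrightarrow> poly_on N (\<lambda>x. \<rho> x $$ (i, j))"
begin

abbreviation G :: "'a mat monoid" where "G \<equiv> split_orthogonal N"

sublocale G: group G by (rule split_orthogonal_group)

abbreviation ract :: "'a mat \<Rightarrow> (nat \<Rightarrow> 'a) \<Rightarrow> nat \<Rightarrow> 'a" where "ract x \<equiv> act d (\<rho> x)"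

lemma H0_orth: "x \<in> H0 \<Longrightarrow> x \<in> orth N"
  using subgroup.subset[OF H0] by blast

lemma ract_mult: "x \<in> H0 \<Longrightarrow> y \<in> H0 \<Longrightarrow> ract (x * y) v = ract x (ract y v)"
  by (simp add: \<rho>_mult act_mult \<rho>_carrier)

lemma ract_one: "ract (1\<^sub>m N) v = v"
  by (simp add: \<rho>_one act_one)

lemma ract_poly: "i < d \<Longrightarrow> poly_on N (\<lambda>x. ract x v i)"
  unfolding act_def by (auto intro!: poly_on_sum poly_on_mult poly_on_const \<rho>_poly)

lemma H0_closed:
  "x \<in> H0 \<Longrightarrow> y \<in> H0 \<Longrightarrow> x * y \<in> H0" "x \<in> H0 \<Longrightarrow> orth_inv N x \<in> H0" "1\<^sub>m N \<in> H0"
  using subgroup.m_closed[OF H0, of x y] subgroup.m_inv_closed[OF H0, of x] subgroup.one_closed[OF H0]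
    split_orthogonal_inv[OF H0_orth, of x] by simp_all

lemma ract_inv: "x \<in> H0 \<Longrightarrow> ract (orth_inv N x) (ract x v) = v" "x \<in> H0 \<Longrightarrow> ract x (ract (orth_inv N x) v) = v"
  using ract_mult[of "orth_inv N x" x v] ract_mult[of x "orth_inv N x" v] H0_closed(2)[of x]
    orth_inv_left[OF H0_orth, of x] orth_inv_right[OF H0_orth, of x]
  by (simp_all add: ract_one)

lemma ract_nonzero: "x \<in> H0 \<Longrightarrow> v \<noteq> 0 \<Longrightarrow> ract x v \<noteq> 0"
  using ract_inv(1)[of x v] by auto

lemma coord_nonzero:
  assumes "v \<in> coord_space d" "v \<noteq> 0"
  obtains i where "i < d" "v i \<noteq> 0"
proof -
  obtain i where "v i \<noteq> 0" using assms(2) by (auto simp: fun_eq_iff)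
  thus thesis using that assms(1) unfolding span_unit_iff by (meson not_less)
qed

text \<open>A character of a connected group with values in the finite set of eigenvalues of a fixed
  matrix is constant, because its values are read off from one coordinate of a vector.\<close>

lemma eigenvalue_constant:
  assumes conn: "connectedin (mat_zariski N) H" and HH0: "H \<subseteq> H0" and x: "x \<in> H0"
    and \<phi>: "poly_map N \<phi>" "\<And>h. h \<in> H \<Longrightarrow> \<phi> h \<in> H0"
    and v: "v \<in> coord_space d" "v \<noteq> 0"
    and \<chi>: "\<And>h. h \<in> H \<Longrightarrow> ract (\<phi> h) v = fscale (\<chi> h) v"
    and eig: "\<And>h. h \<in> H \<Longrightarrow> \<exists>u\<in>coord_space d. u \<noteq> 0 \<and> ract x u = fscale (\<chi> h * c) u"
    and c: "c \<noteq> 0" and hk: "h \<in> H" "k \<in> H"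
  shows "\<chi> h = \<chi> k"
proof -
  obtain i where i: "i < d" "v i \<noteq> 0" using coord_nonzero[OF v] .
  let ?f = "\<lambda>h. ract (\<phi> h) v i"
  have f: "?f h = \<chi> h * v i" if "h \<in> H" for h using \<chi>[OF that] by (simp add: fscale_def)
  let ?E = "{e. \<exists>u\<in>coord_space d. u \<noteq> 0 \<and> ract x u = fscale e u}"
  have "?f ` H \<subseteq> (\<lambda>e. e / c * v i) ` ?E"
  proof
    fix y assume "y \<in> ?f ` H"
    then obtain h where h: "h \<in> H" "y = ?f h" by auto
    hence "\<chi> h * c \<in> ?E" using eig by blast
    moreover have "y = (\<chi> h * c) / c * v i" using f[OF h(1)] h(2) c by simp
    ultimately show "y \<in> (\<lambda>e. e / c * v i) ` ?E" by blast
  qed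
  hence "finite (?f ` H)"
    using finite_eigenvalues[OF \<rho>_carrier[OF x]] finite_subset by blast
  moreover have "poly_on N ?f" by (rule poly_on_comp[OF ract_poly[OF i(1)] \<phi>(1)])
  ultimately have "?f h = ?f k" using connectedin_finite_values_const[OF conn] hk by blast
  thus ?thesis using f hk i(2) by simp
qed

text \<open>Inside a minimal non-zero stable subspace \<open>U\<close>, every stable eigenspace is
  all of \<open>U\<close>. Connectedness makes the weight space of the derived group stable, so that
  group acts by scalars; a second use shows that the scalars of commutators are 1. Then the
  eigenspaces of single elements are stable, and \<open>H\<close> acts on \<open>U\<close> by
  scalars.\<close>

theorem lie_kolchin:
  assumes "subgroup H G" "H \<subseteq> H0" "connectedin (mat_zariski N) H" "(derived G ^^ n) H = {1\<^sub>m N}"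
    and "fv.subspace W" "W \<subseteq> coord_space d" "W \<noteq> {0}" "\<And>h v. h \<in> H \<Longrightarrow> v \<in> W \<Longrightarrow> ract h v \<in> W"
  shows "\<exists>v\<in>W. v \<noteq> 0 \<and> (\<forall>h\<in>H. \<exists>c. ract h v = fscale c v)"
  using assms
proof (induction n arbitrary: H W)
  case 0
  hence "H = {1\<^sub>m N}" by simp
  moreover obtain v where "v \<in> W" "v \<noteq> 0" using 0(7) fv.subspace_0[OF 0(5)] by blast
  moreover have "ract (1\<^sub>m N) v = fscale 1 v" by (simp add: ract_one)
  ultimately show ?case by blast
next
  case (Suc n)
  note H = Suc.prems(1) and HH0 = Suc.prems(2) and conn = Suc.prems(3)
  let ?H' = "derived G H"
  have HO: "H \<subseteq> orth N" by (rule subgroup.subset[OF H])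
  have Hm: "x * y \<in> H" "orth_inv N x \<in> H" if "x \<in> H" "y \<in> H" for x y
    using subgroup.m_closed[OF H, of x y] subgroup.m_inv_closed[OF H, of x] that HO
    by (auto simp: split_orthogonal_inv)
  have H1: "1\<^sub>m N \<in> H" using subgroup.one_closed[OF H] by simp
  have H': "subgroup ?H' G" "?H' \<subseteq> H" "connectedin (mat_zariski N) ?H'" "(derived G ^^ n) ?H' = {1\<^sub>m N}"
    using G.derived_is_subgroup[OF HO] G.derived_incl[OF subset_refl H] derived_connected[OF H conn] Suc.prems(4)
    by (simp_all add: funpow_swap1)
  have H'1: "1\<^sub>m N \<in> ?H'" using subgroup.one_closed[OF H'(1)] by simp
  have comm: "a * b * orth_inv N a * orth_inv N b \<in> ?H'" if "a \<in> H" "b \<in> H" for a b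
  proof -
    have "a * b * orth_inv N a * orth_inv N b = a \<otimes>\<^bsub>G\<^esub> b \<otimes>\<^bsub>G\<^esub> inv\<^bsub>G\<^esub> a \<otimes>\<^bsub>G\<^esub> inv\<^bsub>G\<^esub> b"
      using subsetD[OF HO that(1)] subsetD[OF HO that(2)] by (simp add: split_orthogonal_inv)
    thus ?thesis using that unfolding derived_def by (intro generate.incl) blast
  qed
  have normal: "orth_inv N h * x * h \<in> ?H'" if "h \<in> H" "x \<in> ?H'" for h x
    using normal.inv_op_closed1[OF G.derived_subgroup_is_normal[OF H], of h x] that HO
      G.m_inv_consistent[OF H that(1)] by (auto simp: split_orthogonal_inv)
  \<comment> \<open>Candidates for a non-zero stable subspace of least dimension; minimality plays
    the part of irreducibility.\<close>
  define Q where "Q U \<longleftrightarrow> fv.subspace U \<and> U \<subseteq> W \<and> U \<noteq> {0} \<and> (\<forall>h\<in>H. \<forall>v\<in>U. ract h v \<in> U)" for U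
  have "Q W" unfolding Q_def using Suc.prems by blast
  then obtain U where QU: "Q U" and Umin: "\<And>T. Q T \<Longrightarrow> fv.dim U \<le> fv.dim T"
    using ex_has_least_nat[of Q W fv.dim] by blast
  have U: "fv.subspace U" "U \<subseteq> W" "U \<noteq> {0}" "\<And>h v. h \<in> H \<Longrightarrow> v \<in> U \<Longrightarrow> ract h v \<in> U"
    and Ud: "U \<subseteq> coord_space d"
    using QU Suc.prems(6) by (auto simp: Q_def)
  have minimal: "T = U" if "fv.subspace T" "T \<subseteq> U" "v \<in> T" "v \<noteq> 0" "\<And>h v. h \<in> H \<Longrightarrow> v \<in> T \<Longrightarrow> ract h v \<in> T" for T v
  proof (rule ccontr)
    assume "T \<noteq> U"
    hence "fv.dim T < fv.dim U" using dim_strict_mono[OF that(1) Ud] that(2) by blast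
    moreover have "Q T" using that U(2) by (auto simp: Q_def)
    ultimately show False using Umin by fastforce
  qed
  have "\<exists>v\<in>U. v \<noteq> 0 \<and> (\<forall>h\<in>?H'. \<exists>c. ract h v = fscale c v)"
    by (rule Suc.IH[OF H'(1) _ H'(3,4) U(1) Ud U(3)]) (use H'(2) HH0 U(4) in auto)
  then obtain v where v: "v \<in> U" "v \<noteq> 0" and ev: "\<forall>h\<in>?H'. \<exists>c. ract h v = fscale c v" by blast
  from ev obtain \<chi> where \<chi>: "\<And>h. h \<in> ?H' \<Longrightarrow> ract h v = fscale (\<chi> h) v" by metis
  have \<chi>1: "\<chi> (1\<^sub>m N) = 1"
  proof -
    have "fscale (\<chi> (1\<^sub>m N)) v = fscale 1 v" using \<chi>[OF H'1] by (simp add: ract_one)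
    thus ?thesis using v(2) by (simp only: fv.scale_cancel_right) blast
  qed
  \<comment> \<open>The weight space of the derived group for the weight \<open>\<chi>\<close> of
    \<open>v\<close>. An element \<open>k\<close> of \<open>H\<close> carries it to the weight space
    of the conjugated weight.\<close>
  let ?T = "{u \<in> U. \<forall>x\<in>?H'. ract x u = fscale (\<chi> x) u}"
  have T_stable: "ract h u \<in> ?T" if h: "h \<in> H" and u: "u \<in> ?T" for h u
  proof (cases "u = 0")
    case True
    thus ?thesis using fv.subspace_0[OF U(1)] by (simp add: act_zero fv.scale_zero_right del: zero_fun_apply)
  next
    case False
    have "ract x (ract h u) = fscale (\<chi> x) (ract h u)" if x: "x \<in> ?H'" for x
    proof -
      have conj: "ract x (ract k u) = fscale (\<chi> (orth_inv N k * x * k)) (ract k u)" if k: "k \<in> H" for k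
      proof -
        have mem: "orth_inv N k * x * k \<in> ?H'" "k \<in> H0" "x \<in> H0" "orth_inv N k \<in> H0"
          using normal[OF k x] k x H'(2) HH0 H0_closed by auto
        have "ract k (ract (orth_inv N k * x * k) u) = ract k (ract (orth_inv N k) (ract x (ract k u)))"
          using mem by (simp add: ract_mult H0_closed)
        hence "ract x (ract k u) = ract k (ract (orth_inv N k * x * k) u)" using mem by (simp add: ract_inv)
        thus ?thesis using u mem(1) by (simp add: act_scale)
      qed
      \<comment> \<open>While \<open>k\<close> runs through the connected group \<open>H\<close>,
        the conjugated weight at \<open>x\<close> is always an eigenvalue of the fixed operator of
        \<open>x\<close>, so it keeps its value at \<open>k = 1\<close>.\<close>
      have "\<chi> (orth_inv N h * x * h) = \<chi> (orth_inv N (1\<^sub>m N) * x * 1\<^sub>m N)"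
      proof (rule eigenvalue_constant[OF conn HH0, where x = x and \<phi> = "\<lambda>k. orth_inv N k * x * k"
            and \<chi> = "\<lambda>k. \<chi> (orth_inv N k * x * k)" and v = u and c = 1])
        show "x \<in> H0" using x H'(2) HH0 by blast
        have "x \<in> carrier_mat N N" using x H'(2) HO orthD(1) by blast
        thus "poly_map N (\<lambda>k. orth_inv N k * x * k)"
          by (intro poly_map_mult poly_map_orth_inv poly_map_const poly_map_id)
        show "orth_inv N k * x * k \<in> H0" if "k \<in> H" for k using normal[OF that x] H'(2) HH0 by blast
        show "u \<in> coord_space d" using u Ud by blast
        show "ract (orth_inv N k * x * k) u = fscale (\<chi> (orth_inv N k * x * k)) u" if "k \<in> H" for k
          using normal[OF that x] u by blast
        show "\<exists>w\<in>coord_space d. w \<noteq> 0 \<and> ract x w = fscale (\<chi> (orth_inv N k * x * k) * 1) w" if k: "k \<in> H" for k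
          using conj[OF k] ract_nonzero[OF _ False, of k] U(4)[OF k, of u] u k HH0 Ud
          by (intro bexI[of _ "ract k u"]) auto
      qed (use False h H1 in auto)
      also have "orth_inv N (1\<^sub>m N) * x * 1\<^sub>m N = x"
        using orth_conj_one[of x N] orthD(1)[of x N] x H'(2) HO
        by (metis G.inv_one orth_one split_orthogonal_inv split_orthogonal_simps(2) sq_mat(3,4) subsetD)
      finally show ?thesis using conj[OF h] by simp
    qed
    thus ?thesis using U(4)[OF h] u by blast
  qed
  have "?T = U"
  proof (rule minimal[of _ v])
    show "fv.subspace ?T"
      using U(1) by (auto simp: fv.subspace_def act_add act_scale fv.scale_right_distrib fv.scale_left_commute
          simp del: plus_fun_apply zero_fun_apply)
  qed (use T_stable v \<chi> in auto)
  hence scalar: "ract x u = fscale (\<chi> x) u" if "x \<in> ?H'" "u \<in> U" for x u using that by blast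
  have "\<exists>c. \<forall>u\<in>U. ract a u = fscale c u" if a: "a \<in> H" for a
  proof -
    have aH0: "a \<in> H0" using a HH0 by blast
    obtain u c where u: "u \<in> U" "u \<noteq> 0" "ract a u = fscale c u"
      using eigenvector_in_stable_subspace[OF U(1) Ud U(4)[OF a] v] by blast
    have c: "c \<noteq> 0" using ract_nonzero[OF aH0 u(2)] u(3) by auto
    let ?c = "\<lambda>b. a * b * orth_inv N a * orth_inv N b"
    \<comment> \<open>On \<open>U\<close> the commutator of \<open>a\<close> and \<open>b\<close>
      acts by the scalar \<open>\<chi>\<close>. Hence \<open>b\<close> sends an eigenvector of
      \<open>a\<close> for \<open>c\<close> to one for \<open>c\<close> times that scalar, which
      confines the scalar to finitely many values.\<close>
    have ab: "ract a (ract b w) = fscale (\<chi> (?c b)) (ract b (ract a w))" if b: "b \<in> H" and w: "w \<in> U" for b w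
    proof -
      have bH0: "b \<in> H0" using b HH0 by blast
      have "ract (?c b) (ract b (ract a w)) = ract a (ract b w)"
        using aH0 bH0 by (simp add: ract_mult H0_closed ract_inv)
      thus ?thesis using scalar[OF comm[OF a b] U(4)[OF b U(4)[OF a w]]] by simp
    qed
    have one: "\<chi> (?c b) = 1" if b: "b \<in> H" for b
    proof -
      have ac: "a \<in> carrier_mat N N" using a HO orthD(1) by blast
      have "\<chi> (?c b) = \<chi> (?c (1\<^sub>m N))"
      proof (rule eigenvalue_constant[OF conn HH0 aH0, where \<phi> = ?c and \<chi> = "\<lambda>k. \<chi> (?c k)" and v = v and c = c])
        show "poly_map N ?c"
          by (intro poly_map_mult poly_map_orth_inv poly_map_const poly_map_id orth_inv_carrier ac)
        show "?c k \<in> H0" if "k \<in> H" for k using comm[OF a that] H'(2) HH0 by blast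
        show "v \<in> coord_space d" using v Ud by blast
        show "\<exists>w\<in>coord_space d. w \<noteq> 0 \<and> ract a w = fscale (\<chi> (?c k) * c) w" if k: "k \<in> H" for k
          using ab[OF k u(1)] ract_nonzero[OF _ u(2), of k] U(4)[OF k u(1)] u k HH0 Ud
          by (intro bexI[of _ "ract k u"]) (auto simp: act_scale)
      qed (use \<chi> comm[OF a] v c b H1 in auto)
      also have "?c (1\<^sub>m N) = 1\<^sub>m N"
      proof -
        have "orth_inv N (1\<^sub>m N) = (1\<^sub>m N :: 'a mat)"
          using G.inv_one split_orthogonal_inv[OF orth_one, where 'a = 'a and N = N] by simp
        thus ?thesis using ac a HO by (auto simp: orth_inv_right)
      qed
      finally show ?thesis using \<chi>1 by simp
    qed
    \<comment> \<open>As \<open>a\<close> commutes with all of \<open>H\<close> on \<open>U\<close>,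
      its eigenspace is stable and minimality applies again.\<close>
    have "{w \<in> U. ract a w = fscale c w} = U"
    proof (rule minimal[of _ u])
      show "fv.subspace {w \<in> U. ract a w = fscale c w}"
        using U(1) by (auto simp: fv.subspace_def act_add act_scale fv.scale_right_distrib fv.scale_left_commute
            simp del: plus_fun_apply zero_fun_apply)
    qed (use u ab one U(4) in \<open>auto simp: act_scale\<close>)
    thus ?thesis by blast
  qed
  thus ?case using v U(2) by blast
qed

end

section \<open>Conjugacy of Borel subgroups\<close>

text \<open>An isometry can scale an anisotropic vector only by 1 or -1. A non-zero coordinate of
  the moved vector then takes at most two values on a connected group, so the scalar is always the
  one at the identity.\<close>

lemma (in polynomial_rep) anisotropic_eigenvector_fixed:
  assumes two: "(2 :: 'a) \<noteq> 0" and orth: "\<And>x. x \<in> H0 \<Longrightarrow> \<rho> x \<in> orth d"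
    and conn: "connectedin (mat_zariski N) H0"
    and v: "v \<in> coord_space d" "split_form d v v \<noteq> 0" and eig: "\<And>h. h \<in> H0 \<Longrightarrow> \<exists>c. ract h v = fscale c v"
    and h: "h \<in> H0"
  shows "ract h v = v"
proof -
  interpret quadratic_space fscale "split_form d :: (nat \<Rightarrow> 'a) \<Rightarrow> _"
    by (rule quadratic_space_split_form[OF two])
  have "v \<noteq> 0" using v(2) form_zero(1) by blast
  then obtain i where i: "i < d" "v i \<noteq> 0" using coord_nonzero[OF v(1)] by blast
  have c1: "c = 1 \<or> c = - 1" if "h \<in> H0" "ract h v = fscale c v" for h c
  proof -
    have "c * c * split_form d v v = split_form d v v"
      using split_form_act[OF orth[OF that(1)], of v v] by (simp add: that(2) form_simps)
    hence "c * c = 1" using v(2) by simp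
    thus ?thesis by (rule square_eq_1_iff[THEN iffD1])
  qed
  have "(\<lambda>h. ract h v i) ` H0 \<subseteq> {v i, - v i}"
  proof
    fix y assume "y \<in> (\<lambda>h. ract h v i) ` H0"
    then obtain h where h: "h \<in> H0" "y = ract h v i" by auto
    obtain c where c: "ract h v = fscale c v" using eig[OF h(1)] by blast
    thus "y \<in> {v i, - v i}" using c1[OF h(1) c] h(2) by (auto simp: fscale_def)
  qed
  hence fin: "finite ((\<lambda>h. ract h v i) ` H0)" using finite_subset by blast
  have "ract h v i = ract (1\<^sub>m N) v i"
    by (rule connectedin_finite_values_const[OF conn ract_poly[OF i(1)] fin h H0_closed(3)])
  moreover obtain c where c: "ract h v = fscale c v" using eig[OF h] by blast
  ultimately have "c = 1" using i(2) by (simp add: ract_one fscale_def)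
  thus ?thesis using c by simp
qed

text \<open>If the first two common eigenvectors are anisotropic, they are fixed by the whole group, and so is
  an isotropic combination of them.\<close>

lemma (in polynomial_rep) isotropic_eigenvector:
  assumes two: "(2 :: 'a) \<noteq> 0" and orth: "\<And>x. x \<in> H0 \<Longrightarrow> \<rho> x \<in> orth d"
    and conn: "connectedin (mat_zariski N) H0" and solv: "(derived G ^^ n) H0 = {1\<^sub>m N}" and d: "2 \<le> d"
  obtains u where "u \<in> coord_space d" "u \<noteq> 0" "split_form d u u = 0" "\<And>h. h \<in> H0 \<Longrightarrow> \<exists>c. ract h u = fscale c u"
proof -
  interpret quadratic_space fscale "split_form d :: (nat \<Rightarrow> 'a) \<Rightarrow> _"
    by (rule quadratic_space_split_form[OF two])
  let ?V = "coord_space d :: (nat \<Rightarrow> 'a) set"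
  have e: "unit_fv i \<in> ?V" "unit_fv i \<noteq> (0 :: nat \<Rightarrow> 'a)" if "i < d" for i
  proof -
    show "unit_fv i \<in> ?V" by (rule fv.span_base) (use that in simp)
    have "unit_fv i i = (1 :: 'a)" by (simp add: unit_fv_def)
    thus "unit_fv i \<noteq> (0 :: nat \<Rightarrow> 'a)" by (metis zero_fun_apply zero_neq_one)
  qed
  have "?V \<noteq> {0}" using e[of 0] d by auto
  then obtain v where v: "v \<in> ?V" "v \<noteq> 0" "\<forall>h\<in>H0. \<exists>c. ract h v = fscale c v"
    using lie_kolchin[OF H0 subset_refl conn solv fv.subspace_span subset_refl] act_span by blast
  show thesis
  proof (cases "split_form d v v = 0")
    case True
    thus ?thesis using that v by blast
  next
    case False
    have fix_v: "ract h v = v" if "h \<in> H0" for h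
      using anisotropic_eigenvector_fixed[OF two orth conn v(1) False _ that] v(3) by blast
    define W where "W = ?V \<inter> {x. split_form d x v = 0}"
    have W: "fv.subspace W" unfolding W_def by (intro fv.subspace_inter fv.subspace_span subspace_orthogonal)
    have WV: "W \<subseteq> ?V" by (simp add: W_def)
    have "ract h x \<in> W" if "h \<in> H0" "x \<in> W" for h x
      using split_form_act[OF orth[OF that(1)], of x v] fix_v[OF that(1)] that(2) act_span by (auto simp: W_def)
    moreover have "W \<noteq> {0}"
    proof -
      let ?b = "\<lambda>i. split_form d (unit_fv i) v"
      \<comment> \<open>Two coordinates suffice for a non-zero vector orthogonal to
        \<open>v\<close>; this is where dimension at least 2 enters.\<close>
      let ?x = "if ?b 0 = 0 then unit_fv 0 else fscale (?b 1) (unit_fv 0) - fscale (?b 0) (unit_fv 1)"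
      have "?x \<in> W" using e(1)[of 0] e(1)[of 1] d
        by (auto simp: W_def form_simps intro: fv.span_diff fv.span_scale)
      moreover have "?x \<noteq> 0"
      proof
        assume "?x = 0"
        hence "?x 0 = 0" "?x 1 = 0" by (simp_all only: zero_fun_apply)
        thus False by (auto simp: unit_fv_def fscale_def split: if_splits)
      qed
      ultimately show ?thesis by blast
    qed
    ultimately obtain v' where v': "v' \<in> W" "v' \<noteq> 0" "\<forall>h\<in>H0. \<exists>c. ract h v' = fscale c v'"
      using lie_kolchin[OF H0 subset_refl conn solv W WV] by blast
    show ?thesis
    proof (cases "split_form d v' v' = 0")
      case True
      thus ?thesis using that v' WV by blast
    next
      case False': False
      have fix_v': "ract h v' = v'" if "h \<in> H0" for h
        using anisotropic_eigenvector_fixed[OF two orth conn _ False' _ that] v' WV by blast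
      obtain t where t: "t * t = - split_form d v v / split_form d v' v'" using sqrt_exists by blast
      have perp: "split_form d v' v = 0" "split_form d v v' = 0" using v'(1) by (simp_all add: W_def form_sym[of v v'])
      define u where "u = v + fscale t v'"
      have "split_form d u u = split_form d v v + t * t * split_form d v' v'"
        by (simp add: u_def form_simps perp)
      hence "split_form d u u = 0" using False' by (simp add: t)
      moreover have "split_form d u v \<noteq> 0" using False by (simp add: u_def form_simps perp)
      hence "u \<noteq> 0" using form_zero(1) by blast
      moreover have "u \<in> ?V" unfolding u_def using v v' WV by (intro fv.span_add fv.span_scale) auto
      moreover have "ract h u = fscale 1 u" if "h \<in> H0" for h
        using fix_v[OF that] fix_v'[OF that] by (simp add: u_def act_add act_scale del: plus_fun_apply)
      ultimately show ?thesis using that by blast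
    qed
  qed
qed

text \<open>The reflection in \<open>u - v\<close> exchanges two vectors of equal norm, provided
  that \<open>u - v\<close> is anisotropic. For isotropic \<open>u\<close> and \<open>v\<close> its
  norm is -2 times their product, so non-orthogonality is the right condition.\<close>

lemma reflection_exists:
  fixes u v :: "nat \<Rightarrow> 'a :: alg_closed_field"
  assumes two: "(2 :: 'a) \<noteq> 0" and uv: "u \<in> coord_space d" "v \<in> coord_space d"
    and iso: "split_form d u u = 0" "split_form d v v = 0" and ne: "split_form d u v \<noteq> 0"
  obtains g where "g \<in> orth d" "act d g u = v"
proof -
  interpret quadratic_space fscale "split_form d :: (nat \<Rightarrow> 'a) \<Rightarrow> _"
    by (rule quadratic_space_split_form[OF two])
  define z where "z = u - v"
  have z0: "z i = 0" if "i \<ge> d" for i using uv that by (simp add: z_def span_unit_iff)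
  \<comment> \<open>This is 2 divided by the norm of \<open>z\<close>, the coefficient in the
    formula for the reflection.\<close>
  define c where "c = - inverse (split_form d u v)"
  have zz: "c * split_form d z z = 2" "c * split_form d z u = 1"
    using ne by (simp_all add: z_def form_simps iso c_def form_sym[of v u] field_simps)
  define R where "R = mat d d (\<lambda>(i, j). (if i = j then 1 else 0) - c * z i * z (d - 1 - j))"
  have R: "R \<in> carrier_mat d d" by (simp add: R_def)
  have act: "act d R x = x - fscale (c * split_form d z x) z" for x
  proof
    fix i
    show "act d R x i = (x - fscale (c * split_form d z x) z) i"
    proof (cases "i < d")
      case True
      have "act d R x i = (\<Sum>k<d. (if k = i then x i else 0) - c * z i * (x k * z (d - 1 - k)))"
        unfolding act_def using True by (auto simp: R_def algebra_simps intro!: sum.cong)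
      also have "\<dots> = x i - c * z i * split_form d x z"
        using True by (simp add: sum_subtractf sum_distrib_left split_form_def)
      finally show ?thesis by (simp add: fscale_def form_sym[of z x])
    qed (simp add: act_def fscale_def z0)
  qed
  have form: "split_form d (act d R x) (act d R y) = split_form d x y" for x y
  proof -
    have "split_form d (act d R x) (act d R y) = split_form d x y
        - 2 * c * split_form d z x * split_form d z y
        + c * split_form d z x * split_form d z y * (c * split_form d z z)"
      unfolding act by (simp add: form_simps form_sym[of x z] form_sym[of y z] algebra_simps)
    thus ?thesis by (simp add: zz(1))
  qed
  have "R \<in> orth d"
    unfolding orth_iff[OF R]
  proof (intro allI impI)
    fix i j assume ij: "i < d" "j < d"
    have "split_form d (\<lambda>k. R $$ (k, i)) (\<lambda>k. R $$ (k, j)) =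
        split_form d (act d R (unit_fv i)) (act d R (unit_fv j))"
      by (rule split_form_cong) (simp_all add: act_unit ij)
    also have "\<dots> = (if i + j + 1 = d then 1 else 0)"
      unfolding form split_form_unit[OF ij(2)] using ij by (auto simp: unit_fv_def)
    finally show "split_form d (\<lambda>k. R $$ (k, i)) (\<lambda>k. R $$ (k, j)) = (if i + j + 1 = d then 1 else 0)" .
  qed
  moreover have "act d R u = v" unfolding act zz(2) by (simp add: z_def)
  ultimately show thesis using that by blast
qed

text \<open>Orthogonal isotropic vectors are joined by two reflections, through an isotropic vector
  orthogonal to neither. A vector pairing non-trivially with both exists because two proper
  hyperplanes do not cover the space.\<close>

lemma isotropic_transitive:
  fixes u v :: "nat \<Rightarrow> 'a :: alg_closed_field"
  assumes two: "(2 :: 'a) \<noteq> 0" and uv: "u \<in> coord_space d" "v \<in> coord_space d" "u \<noteq> 0" "v \<noteq> 0"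
    and iso: "split_form d u u = 0" "split_form d v v = 0"
  obtains g where "g \<in> orth d" "act d g u = v"
proof (cases "split_form d u v = 0")
  case False
  thus ?thesis using reflection_exists[OF two uv(1,2) iso] that by blast
next
  case True
  interpret quadratic_space fscale "split_form d :: (nat \<Rightarrow> 'a) \<Rightarrow> _"
    by (rule quadratic_space_split_form[OF two])
  obtain y1 where y1: "y1 \<in> coord_space d" "split_form d u y1 \<noteq> 0" using split_form_nondegenerate[OF uv(1,3)] by blast
  obtain y2 where y2: "y2 \<in> coord_space d" "split_form d v y2 \<noteq> 0" using split_form_nondegenerate[OF uv(2,4)] by blast
  have "\<exists>y\<in>coord_space d. split_form d u y \<noteq> 0 \<and> split_form d v y \<noteq> 0"
  proof (cases "split_form d v y1 = 0 \<and> split_form d u y2 = 0")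
    case True
    thus ?thesis using y1 y2 by (intro bexI[of _ "y1 + y2"] fv.span_add) (auto simp: form_simps)
  qed (use y1 y2 in blast)
  then obtain y where y: "y \<in> coord_space d" "split_form d u y \<noteq> 0" "split_form d v y \<noteq> 0" by blast
  \<comment> \<open>A multiple of \<open>u\<close> makes \<open>y\<close> isotropic. The products
    with \<open>u\<close> and \<open>v\<close> are unaffected, since \<open>u\<close> is isotropic
    and orthogonal to \<open>v\<close>.\<close>
  define z where "z = y - fscale (split_form d y y / (2 * split_form d u y)) u"
  have "split_form d z z = 0"
    using y(2) two by (simp add: z_def form_simps iso form_sym[of y u] field_simps)
  moreover have "split_form d u z \<noteq> 0" using y(2) by (simp add: z_def form_simps iso)
  moreover have "split_form d z v \<noteq> 0" using y(3) True by (simp add: z_def form_simps form_sym[of y v])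
  moreover have "z \<in> coord_space d" unfolding z_def by (intro fv.span_diff fv.span_scale y uv)
  ultimately obtain g h where g: "g \<in> orth d" "act d g u = z" and h: "h \<in> orth d" "act d h z = v"
    using reflection_exists[OF two uv(1) _ iso(1)] reflection_exists[OF two _ uv(2) _ iso(2)] by metis
  have "act d (h * g) u = v" using act_mult[OF orthD(1)[OF h(1)] orthD(1)[OF g(1)]] g h by simp
  thus ?thesis using that orth_mult[OF h(1) g(1)] by blast
qed

section \<open>Triangularization of a subgroup column by column\<close>

definition first_cols_triangular :: "nat \<Rightarrow> nat \<Rightarrow> 'a :: field mat \<Rightarrow> bool" where
  "first_cols_triangular N k x \<longleftrightarrow> (\<forall>i<N. \<forall>j<k. j < i \<longrightarrow> x $$ (i, j) = 0)"

definition middle_block :: "nat \<Rightarrow> nat \<Rightarrow> 'a :: field mat \<Rightarrow> 'a mat" where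
  "middle_block d k x = mat d d (\<lambda>(i, j). x $$ (i + k, j + k))"

lemma middle_block_carrier [simp]: "middle_block d k x \<in> carrier_mat d d"
  by (simp add: middle_block_def)

lemma sum_middle:
  fixes f :: "nat \<Rightarrow> 'a :: comm_monoid_add"
  assumes "k + d \<le> N" and "\<And>l. l < k \<Longrightarrow> f l = 0" and "\<And>l. k + d \<le> l \<Longrightarrow> l < N \<Longrightarrow> f l = 0"
  shows "(\<Sum>l<N. f l) = (\<Sum>l<d. f (l + k))"
proof -
  have "(\<Sum>l<N. f l) = (\<Sum>l\<in>{k..<k + d}. f l)"
    by (rule sum.mono_neutral_right) (use assms in auto)
  also have "\<dots> = (\<Sum>l\<in>{0..<d}. f (l + k))"
    using sum.shift_bounds_nat_ivl[of f 0 k d] by (simp add: add.commute)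
  finally show ?thesis by (simp add: lessThan_atLeast0)
qed

text \<open>Inversion reflects a matrix in the antidiagonal, so the first columns of the inverse are
  the last rows of the matrix read backwards.\<close>

lemma last_rows_triangular:
  fixes x :: "'a :: field mat"
  assumes x: "x \<in> orth N" and tri: "first_cols_triangular N k (orth_inv N x)" and ij: "i < N" "N \<le> i + k" "j < i"
  shows "x $$ (i, j) = 0"
proof -
  have "x $$ (i, j) = orth_inv N x $$ (N - 1 - j, N - 1 - i)"
    using orth_inv_index[OF orthD(1)[OF x], of "N - 1 - j" "N - 1 - i"] ij by simp
  also have "\<dots> = 0" using tri ij by (auto simp: first_cols_triangular_def)
  finally show ?thesis .
qed

text \<open>Triangularity of the first \<open>k\<close> columns, and by inversion of the last
  \<open>k\<close> rows, makes the middle block a representation by isometries of a split space of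
  dimension \<open>2 * (r - k) + 1\<close>. An isotropic common eigenvector there is moved to the
  first middle basis vector, which extends the triangular shape by one column.\<close>

lemma triangular_step:
  fixes H :: "'a :: alg_closed_field mat set"
  assumes two: "(2 :: 'a) \<noteq> 0" and H: "closed_connected_solvable (2 * r + 1) (split_orthogonal (2 * r + 1)) H"
    and tri: "\<And>h. h \<in> H \<Longrightarrow> first_cols_triangular (2 * r + 1) k h" and k: "k < r"
  obtains g where "g \<in> orth (2 * r + 1)"
    "\<And>h. h \<in> H \<Longrightarrow> first_cols_triangular (2 * r + 1) (Suc k) (orth_conj (2 * r + 1) (orth_inv (2 * r + 1) g) h)"
proof -
  define N where N: "N = 2 * r + 1"
  define n where n: "n = r - k"
  define d where d: "d = 2 * n + 1"
  have dims: "N = 2 * k + 2 * n + 1" "k + d \<le> N" "N = k + d + k" "2 \<le> d" using k by (simp_all add: N n d)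
  note H = H[folded N] and tri = tri[folded N]
  interpret O: group "split_orthogonal N :: 'a mat monoid" by (rule split_orthogonal_group)
  have sub: "subgroup H (split_orthogonal N)" and conn: "connectedin (mat_zariski N) H"
    using H by (auto simp: closed_connected_solvable_def connectedin_subtopology)
  obtain s where solv: "(derived (split_orthogonal N) ^^ s) H = {1\<^sub>m N}"
    using H O.solvable_subgroup_iff[OF sub] by (auto simp: closed_connected_solvable_def)
  have HO: "h \<in> orth N" if "h \<in> H" for h using subgroup.subset[OF sub] that by blast
  have Hinv: "orth_inv N h \<in> H" if "h \<in> H" for h
    using subgroup.m_inv_closed[OF sub that] HO[OF that] by (simp add: split_orthogonal_inv)
  have col: "h $$ (i, j) = 0" if "h \<in> H" "i < N" "j < k" "j < i" for h i j
    using tri[OF that(1)] that by (auto simp: first_cols_triangular_def)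
  have row: "h $$ (i, j) = 0" if "h \<in> H" "i < N" "k + d \<le> i" "j < i" for h i j
    by (rule last_rows_triangular[OF HO[OF that(1)] tri[OF Hinv[OF that(1)]]]) (use that dims in auto)
  let ?\<rho> = "middle_block d k :: 'a mat \<Rightarrow> 'a mat"
  have orth\<rho>: "?\<rho> h \<in> orth d" if h: "h \<in> H" for h
    unfolding orth_iff[OF middle_block_carrier]
  proof (intro allI impI)
    fix i j assume ij: "i < d" "j < d"
    have "split_form d (\<lambda>l. ?\<rho> h $$ (l, i)) (\<lambda>l. ?\<rho> h $$ (l, j)) =
        (\<Sum>l<d. h $$ (l + k, i + k) * h $$ (N - 1 - (l + k), j + k))"
      unfolding split_form_def
    proof (rule sum.cong)
      fix l assume "l \<in> {..<d}"
      moreover from this have "d - 1 - l + k = N - 1 - (l + k)" using dims by auto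
      ultimately show "?\<rho> h $$ (l, i) * ?\<rho> h $$ (d - 1 - l, j) = h $$ (l + k, i + k) * h $$ (N - 1 - (l + k), j + k)"
        using ij by (simp add: middle_block_def)
    qed simp
    \<comment> \<open>In a middle column the last \<open>k\<close> rows vanish, and the form pairs
      the first \<open>k\<close> rows with them, so only the middle rows contribute.\<close>
    also have "\<dots> = split_form N (\<lambda>l. h $$ (l, i + k)) (\<lambda>l. h $$ (l, j + k))"
      unfolding split_form_def
    proof (rule sum_middle[symmetric])
      fix l assume "l < k"
      thus "h $$ (l, i + k) * h $$ (N - 1 - l, j + k) = 0"
        using row[OF h, of "N - 1 - l" "j + k"] dims ij by simp
    next
      fix l assume "k + d \<le> l" "l < N"
      thus "h $$ (l, i + k) * h $$ (N - 1 - l, j + k) = 0"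
        using row[OF h, of l "i + k"] ij by simp
    qed (rule dims)
    also have "\<dots> = (if i + j + 1 = d then 1 else 0)"
    proof -
      have "i + k + (j + k) + 1 = N \<longleftrightarrow> i + j + 1 = d" "i + k < N" "j + k < N" using dims ij by auto
      thus ?thesis using HO[OF h] orth_iff[OF orthD(1)[OF HO[OF h]]] by simp
    qed
    finally show "split_form d (\<lambda>l. ?\<rho> h $$ (l, i)) (\<lambda>l. ?\<rho> h $$ (l, j)) = (if i + j + 1 = d then 1 else 0)" .
  qed
  interpret polynomial_rep N d H ?\<rho>
  proof (rule polynomial_rep.intro)
    show "subgroup H (split_orthogonal N)" by (rule sub)
  next
    fix x y assume x: "x \<in> H" and y: "y \<in> H"
    show "?\<rho> (x * y) = ?\<rho> x * ?\<rho> y"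
    proof (rule eq_matI)
      fix i j assume "i < dim_row (?\<rho> x * ?\<rho> y)" "j < dim_col (?\<rho> x * ?\<rho> y)"
      hence ij: "i < d" "j < d" by (simp_all add: middle_block_def)
      hence ijN: "i + k < N" "j + k < N" using dims by auto
      have "?\<rho> (x * y) $$ (i, j) = (\<Sum>l<N. x $$ (i + k, l) * y $$ (l, j + k))"
        using ij sq_mult_index[OF orthD(1)[OF HO[OF x]] orthD(1)[OF HO[OF y]] ijN]
        by (simp add: middle_block_def)
      also have "\<dots> = (\<Sum>l<d. x $$ (i + k, l + k) * y $$ (l + k, j + k))"
      proof (rule sum_middle[OF dims(2)])
        fix l assume "l < k"
        thus "x $$ (i + k, l) * y $$ (l, j + k) = 0" using col[OF x ijN(1), of l] by simp
      next
        fix l assume "k + d \<le> l" "l < N"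
        thus "x $$ (i + k, l) * y $$ (l, j + k) = 0" using row[OF y, of l "j + k"] ij by simp
      qed
      also have "\<dots> = (?\<rho> x * ?\<rho> y) $$ (i, j)"
        unfolding sq_mult_index[OF middle_block_carrier middle_block_carrier ij]
        using ij by (intro sum.cong) (auto simp: middle_block_def)
      finally show "?\<rho> (x * y) $$ (i, j) = (?\<rho> x * ?\<rho> y) $$ (i, j)" .
    qed (simp_all add: middle_block_def)
  next
    show "?\<rho> (1\<^sub>m N) = 1\<^sub>m d" using dims by (intro eq_matI) (auto simp: middle_block_def)
  next
    fix i j assume ij: "i < d" "j < d"
    have "poly_on N (\<lambda>x :: 'a mat. x $$ (i + k, j + k))" by (rule poly_on_entry) (use ij dims in auto)
    thus "poly_on N (\<lambda>x. ?\<rho> x $$ (i, j))" using ij by (simp add: middle_block_def)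
  qed simp
  obtain u where u: "u \<in> coord_space d" "u \<noteq> 0" "split_form d u u = 0"
    and eig: "\<And>h. h \<in> H \<Longrightarrow> \<exists>c. ract h u = fscale c u"
    using isotropic_eigenvector[OF two orth\<rho> conn solv dims(4)] by blast
  have e0: "(unit_fv 0 :: nat \<Rightarrow> 'a) \<in> coord_space d" "(unit_fv 0 :: nat \<Rightarrow> 'a) \<noteq> 0"
  proof -
    show "(unit_fv 0 :: nat \<Rightarrow> 'a) \<in> coord_space d" by (rule fv.span_base) (use dims in auto)
    have "unit_fv 0 0 = (1 :: 'a)" by (simp add: unit_fv_def)
    thus "(unit_fv 0 :: nat \<Rightarrow> 'a) \<noteq> 0" by (metis zero_fun_apply zero_neq_one)
  qed
  have "split_form d (unit_fv 0) (unit_fv 0 :: nat \<Rightarrow> 'a) = 0"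
    using split_form_unit[of 0 d "unit_fv 0 :: nat \<Rightarrow> 'a"] dims by (simp add: unit_fv_def)
  from isotropic_transitive[OF two e0(1) u(1) e0(2) u(2) this u(3)]
  obtain g' where g': "g' \<in> orth d" "act d g' (unit_fv 0) = u" .
  have g'0: "g' $$ (i, 0) = u i" if "i < d" for i
    using act_unit[of 0 d i g'] that g'(2) dims by simp
  \<comment> \<open>The outer coordinates are left alone, which preserves the columns already
    treated, while the first middle column of \<open>g\<close> becomes \<open>u\<close>.\<close>
  define g where "g = orth_sum k n (1\<^sub>m (2 * k)) g'"
  have gO: "g \<in> orth N"
    unfolding g_def dims(1)
    by (subst orth_sum_mem_iff) (use g'(1) orth_one orthD(1)[OF g'(1)] in \<open>auto simp: d\<close>)
  have g_out: "g $$ (i, j) = (if i = j then 1 else 0)"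
    if "i < N" "j < N" "i < k \<or> k + d \<le> i \<or> j < k \<or> k + d \<le> j" for i j
  proof -
    have inner: "is_inner k n l \<longleftrightarrow> k \<le> l \<and> l < k + d" for l by (auto simp: is_inner_def d)
    have ni: "\<not> (is_inner k n i \<and> is_inner k n j)" using that(3) by (auto simp: inner)
    have out: "outer_pos k n l < 2 * k" if "l < N" "\<not> is_inner k n l" for l
      using that dims(3) d by (auto simp: inner outer_pos_def)
    have out_eq: "outer_pos k n i = outer_pos k n j \<longleftrightarrow> i = j" if "\<not> is_inner k n i" "\<not> is_inner k n j"
      using that d by (auto simp: inner outer_pos_def split: if_splits)
    have "g $$ (i, j) = (if \<not> is_inner k n i \<and> \<not> is_inner k n j
        then 1\<^sub>m (2 * k) $$ (outer_pos k n i, outer_pos k n j) else 0)"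
      using that(1,2) ni unfolding g_def orth_sum_def dims(1)[symmetric] by auto
    thus ?thesis
      using out[OF that(1)] out[OF that(2)] out_eq ni
      by (cases "is_inner k n i"; cases "is_inner k n j") auto
  qed
  have g_in: "g $$ (i + k, k) = u i" if "i < d" for i
  proof -
    have "g $$ (i + k, k) = g' $$ (i, 0)"
      using that dims unfolding g_def orth_sum_def is_inner_def by (auto simp: d)
    thus ?thesis using g'0[OF that] by simp
  qed
  note gc = orthD(1)[OF gO]
  have ginv: "orth_inv N g $$ (i, l) = (if i = l then 1 else 0)" if "i < N" "l < k" for i l
  proof -
    have "l < N" using that dims by simp
    hence "orth_inv N g $$ (i, l) = g $$ (N - 1 - l, N - 1 - i)" by (rule orth_inv_index[OF gc that(1)])
    also have "\<dots> = (if N - 1 - l = N - 1 - i then 1 else 0)"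
      by (rule g_out) (use that dims in auto)
    also have "N - 1 - l = N - 1 - i \<longleftrightarrow> i = l" using that \<open>l < N\<close> by auto
    finally show ?thesis .
  qed
  have "first_cols_triangular N (Suc k) (orth_conj N (orth_inv N g) h)" if h: "h \<in> H" for h
    unfolding first_cols_triangular_def
  proof (intro allI impI)
    fix i j assume i: "i < N" and j: "j < Suc k" and ji: "j < i"
    note hc = orthD(1)[OF HO[OF h]]
    have hg: "h * g \<in> carrier_mat N N" using hc gc by (simp add: sq_mat)
    have jN: "j < N" using j dims by simp
    have eq: "orth_conj N (orth_inv N g) h = orth_inv N g * (h * g)"
      unfolding orth_conj_def orth_inv_inv[OF gO] by (rule sq_mat(2)) (use hc gc in simp_all)
    obtain c where c: "ract h u = fscale c u" using eig[OF h] by blast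
    \<comment> \<open>From row \<open>j\<close> downwards, column \<open>j\<close> of
      \<open>h * g\<close> is a multiple of that of \<open>g\<close>. For \<open>j < k\<close> this
      is the triangularity of \<open>h\<close>, for \<open>j = k\<close> it is the eigenvector
      property of \<open>u\<close>. Multiplication by the inverse of \<open>g\<close> then gives a
      multiple of a unit column below the diagonal.\<close>
    have "\<exists>c. \<forall>l<N. j \<le> l \<longrightarrow> (h * g) $$ (l, j) = c * g $$ (l, j)"
    proof (cases "j = k")
      case False
      hence jk: "j < k" using j by simp
      have "(h * g) $$ (l, j) = h $$ (l, j)" if l: "l < N" for l
      proof -
        have "(\<Sum>t<N. h $$ (l, t) * g $$ (t, j)) = (\<Sum>t<N. if t = j then h $$ (l, j) else 0)"
          by (rule sum.cong) (use g_out jk jN in auto)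
        thus ?thesis unfolding sq_mult_index[OF hc gc l jN] using jN by simp
      qed
      moreover have "h $$ (l, j) = h $$ (j, j) * g $$ (l, j)" if "l < N" "j \<le> l" for l
        using col[OF h that(1) jk] that jk jN g_out[of l j] by (cases "l = j") auto
      ultimately show ?thesis by metis
    next
      case True
      have sum: "(h * g) $$ (l, k) = (\<Sum>t<d. h $$ (l, t + k) * u t)" if l: "l < N" for l
      proof -
        have "(h * g) $$ (l, k) = (\<Sum>t<d. h $$ (l, t + k) * g $$ (t + k, k))"
          unfolding sq_mult_index[OF hc gc l jN[unfolded True]]
          by (rule sum_middle[OF dims(2)]) (use g_out jN True dims in auto)
        thus ?thesis using g_in by simp
      qed
      have "(h * g) $$ (l, k) = c * g $$ (l, k)" if l: "l < N" "k \<le> l" for l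
      proof (cases "l < k + d")
        case True
        hence l': "l - k < d" "l - k + k = l" using l by auto
        have "(h * g) $$ (l, k) = ract h u (l - k)"
          unfolding sum[OF l(1)] act_def using l' by (auto simp: middle_block_def intro!: sum.cong)
        also have "\<dots> = c * g $$ (l - k + k, k)" unfolding c g_in[OF l'(1)] by (simp add: fscale_def)
        finally show ?thesis by (simp only: l'(2))
      next
        case False
        have "(h * g) $$ (l, k) = 0"
          unfolding sum[OF l(1)] using row[OF h l(1)] False by (intro sum.neutral) auto
        moreover have "g $$ (l, k) = 0" using g_out[of l k] l False dims by auto
        ultimately show ?thesis by simp
      qed
      thus ?thesis unfolding True by blast
    qed
    then obtain c' where c': "\<And>l. l < N \<Longrightarrow> j \<le> l \<Longrightarrow> (h * g) $$ (l, j) = c' * g $$ (l, j)" by blast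
    \<comment> \<open>Above row \<open>j\<close> the two columns need not be proportional, but there
      row \<open>i\<close> of the inverse of \<open>g\<close> has zero entries.\<close>
    have summand: "orth_inv N g $$ (i, l) * (h * g) $$ (l, j) = c' * (orth_inv N g $$ (i, l) * g $$ (l, j))"
      if l: "l < N" for l
    proof (cases "j \<le> l")
      case False
      hence "l < k" "i \<noteq> l" using j ji by auto
      thus ?thesis using ginv[OF i] by simp
    qed (use c'[OF l] in simp)
    have "orth_conj N (orth_inv N g) h $$ (i, j) = c' * (\<Sum>l<N. orth_inv N g $$ (i, l) * g $$ (l, j))"
      unfolding eq sq_mult_index[OF orth_inv_carrier[OF gc] hg i jN] sum_distrib_left
      by (intro sum.cong refl summand) simp
    also have "(\<Sum>l<N. orth_inv N g $$ (i, l) * g $$ (l, j)) = (orth_inv N g * g) $$ (i, j)"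
      by (rule sq_mult_index[OF orth_inv_carrier[OF gc] gc i jN, symmetric])
    also have "\<dots> = 0" unfolding orth_inv_left[OF gO] using i jN ji by simp
    finally show "orth_conj N (orth_inv N g) h $$ (i, j) = 0" by simp
  qed
  thus thesis using that gO by (simp add: N)
qed

text \<open>Triangularization puts \<open>B\<close> inside a conjugate of
  \<open>std_borel r\<close>. That conjugate is itself closed, connected and solvable, so the
  maximality of \<open>B\<close> gives equality.\<close>

theorem borel_is_conjugate:
  fixes B :: "'a :: alg_closed_field mat set"
  assumes two: "(2 :: 'a) \<noteq> 0" and B: "borel_subgroup (2 * r + 1) (split_orthogonal (2 * r + 1)) B"
  obtains g where "g \<in> orth (2 * r + 1)" "B = orth_conj (2 * r + 1) g ` std_borel r"
proof -
  define N where N: "N = 2 * r + 1"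
  let ?G = "split_orthogonal N :: 'a mat monoid"
  have ccs: "closed_connected_solvable N ?G B" using B by (simp add: borel_subgroup_def N)
  have max: "H = B" if "closed_connected_solvable N ?G H" "B \<subseteq> H" for H
    using B that by (simp add: borel_subgroup_def N)
  have "\<exists>g\<in>orth N. \<forall>h\<in>B. first_cols_triangular N k (orth_conj N (orth_inv N g) h)" if "k \<le> r" for k
    using that
  proof (induction k)
    case 0
    show ?case by (rule bexI[OF _ orth_one]) (simp add: first_cols_triangular_def)
  next
    case (Suc k)
    then obtain g where g: "g \<in> orth N" "\<And>h. h \<in> B \<Longrightarrow> first_cols_triangular N k (orth_conj N (orth_inv N g) h)"
      by auto
    let ?H = "orth_conj N (orth_inv N g) ` B"
    have "closed_connected_solvable N ?G ?H"
      by (rule closed_connected_solvable_conj[OF orth_inv_orth[OF g(1)] ccs])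
    moreover have "first_cols_triangular N k h" if "h \<in> ?H" for h using that g(2) by auto
    ultimately obtain g' where g': "g' \<in> orth N"
      "\<And>h. h \<in> ?H \<Longrightarrow> first_cols_triangular N (Suc k) (orth_conj N (orth_inv N g') h)"
      using triangular_step[OF two, of r ?H k, folded N] Suc.prems by auto
    have "orth_conj N (orth_inv N (g * g')) h = orth_conj N (orth_inv N g') (orth_conj N (orth_inv N g) h)"
      if "h \<in> B" for h
    proof -
      have "h \<in> carrier_mat N N"
        using that ccs subgroup.subset orthD(1) by (metis closed_connected_solvable_def subsetD)
      thus ?thesis
        unfolding orth_inv_mult[OF g(1) g'(1)]
        by (rule orth_conj_mult[OF orth_inv_orth[OF g'(1)] orth_inv_orth[OF g(1)]])
    qed
    thus ?case using g'(2) orth_mult[OF g(1) g'(1)] by (intro bexI[of _ "g * g'"]) auto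
  qed
  then obtain g where g: "g \<in> orth N" "\<And>h. h \<in> B \<Longrightarrow> first_cols_triangular N r (orth_conj N (orth_inv N g) h)"
    by blast
  define H where "H = orth_conj N (orth_inv N g) ` B"
  have H: "closed_connected_solvable N ?G H"
    unfolding H_def by (rule closed_connected_solvable_conj[OF orth_inv_orth[OF g(1)] ccs])
  hence sub: "subgroup H ?G" and conn: "connectedin (mat_zariski N) H"
    by (auto simp: closed_connected_solvable_def connectedin_subtopology)
  have HO: "h \<in> orth N" if "h \<in> H" for h using subgroup.subset[OF sub] that by blast
  have Hinv: "orth_inv N h \<in> H" if "h \<in> H" for h
    using subgroup.m_inv_closed[OF sub that] HO[OF that] by (simp add: split_orthogonal_inv)
  have cols: "first_cols_triangular N r h" if "h \<in> H" for h using that g(2) by (auto simp: H_def)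
  \<comment> \<open>An entry below the diagonal in a column from \<open>r\<close> on lies in one of
    the last \<open>r\<close> rows, which are controlled by the inverse of \<open>h\<close>.\<close>
  have up: "h $$ (i, j) = 0" if "h \<in> H" "i < N" "j < i" for h i j
  proof (cases "j < r")
    case True
    thus ?thesis using cols[OF that(1)] that by (simp add: first_cols_triangular_def)
  next
    case False
    thus ?thesis
      using last_rows_triangular[OF HO[OF that(1)] cols[OF Hinv[OF that(1)]] that(2) _ that(3)] that N by simp
  qed
  have rr: "h $$ (r, r) = 1 \<or> h $$ (r, r) = - 1" if "h \<in> H" for h
  proof -
    have "h $$ (r, r) * h $$ (r, r) = 1"
      using upper_triangular_diag_nonzero[OF HO[OF that] up[OF that], of r] by (simp add: N)
    thus ?thesis by (rule square_eq_1_iff[THEN iffD1])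
  qed
  \<comment> \<open>The middle entry is a polynomial function with values among 1 and -1, so
    connectedness of \<open>H\<close> keeps it at its value on the identity.\<close>
  have "H \<subseteq> std_borel r"
  proof
    fix h assume h: "h \<in> H"
    have "poly_on N (\<lambda>x :: 'a mat. x $$ (r, r))" by (rule poly_on_entry) (simp_all add: N)
    moreover have "(\<lambda>x. x $$ (r, r)) ` H \<subseteq> {1, - 1}" using rr by auto
    hence "finite ((\<lambda>x. x $$ (r, r)) ` H)" using finite_subset by blast
    moreover have "1\<^sub>m N \<in> H" using subgroup.one_closed[OF sub] by simp
    ultimately have "h $$ (r, r) = 1\<^sub>m N $$ (r, r)"
      using connectedin_finite_values_const[OF conn] h by blast
    thus "h \<in> std_borel r" using HO[OF h] up[OF h] by (simp add: std_borel_def N)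
  qed
  have "B \<subseteq> orth_conj N g ` std_borel r"
  proof
    fix b assume b: "b \<in> B"
    hence "b \<in> carrier_mat N N"
      using ccs subgroup.subset orthD(1) by (metis closed_connected_solvable_def subsetD)
    hence "b = orth_conj N g (orth_conj N (orth_inv N g) b)" using orth_conj_inv(2)[OF g(1)] by simp
    thus "b \<in> orth_conj N g ` std_borel r" using b \<open>H \<subseteq> std_borel r\<close> by (auto simp: H_def)
  qed
  moreover have "closed_connected_solvable N ?G (orth_conj N g ` std_borel r)"
    by (rule closed_connected_solvable_conj[OF g(1)]) (simp add: std_borel_closed_connected_solvable[of r, folded N])
  ultimately have "orth_conj N g ` std_borel r = B" using max by blast
  thus thesis using that g(1) by (simp add: N)
qed

section \<open>Double cosets\<close>

lemma orth_cancel: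
  fixes A B :: "'a :: field mat"
  assumes "A \<in> carrier_mat N N" "B \<in> carrier_mat N N" "q \<in> orth N"
  shows "A * q = B * q \<Longrightarrow> A = B" "q * A = q * B \<Longrightarrow> A = B"
proof -
  note qc = orthD(1)[OF assms(3)]
  have "A * q * orth_inv N q = A" "B * q * orth_inv N q = B"
    unfolding sq_mat(2)[OF assms(1) qc orth_inv_carrier[OF qc]] sq_mat(2)[OF assms(2) qc orth_inv_carrier[OF qc]]
    by (simp_all add: orth_inv_right[OF assms(3)] sq_mat(4)[OF assms(1)] sq_mat(4)[OF assms(2)])
  thus "A * q = B * q \<Longrightarrow> A = B" by metis
  have "orth_inv N q * (q * A) = A" "orth_inv N q * (q * B) = B"
    unfolding sq_mat(2)[OF orth_inv_carrier[OF qc] qc assms(1), symmetric]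
      sq_mat(2)[OF orth_inv_carrier[OF qc] qc assms(2), symmetric]
    by (simp_all add: orth_inv_left[OF assms(3)] sq_mat(3)[OF assms(1)] sq_mat(3)[OF assms(2)])
  thus "q * A = q * B \<Longrightarrow> A = B" by metis
qed

lemma double_coset_iff:
  "y \<in> (B #>\<^bsub>split_orthogonal N\<^esub> g) <#>\<^bsub>split_orthogonal N\<^esub> K \<longleftrightarrow> (\<exists>b\<in>B. \<exists>k\<in>K. y = b * g * k)"
  by (auto simp: r_coset_def set_mult_def)

lemma double_coset_subset:
  fixes B K :: "'a :: field mat set"
  assumes B: "subgroup B (split_orthogonal N)" and K: "subgroup K (split_orthogonal N)"
    and g: "g \<in> orth N" "b \<in> B" "k \<in> K"
  shows "(B #>\<^bsub>split_orthogonal N\<^esub> (b * g * k)) <#>\<^bsub>split_orthogonal N\<^esub> K \<subseteq>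
    (B #>\<^bsub>split_orthogonal N\<^esub> g) <#>\<^bsub>split_orthogonal N\<^esub> K"
proof
  fix y assume "y \<in> (B #>\<^bsub>split_orthogonal N\<^esub> (b * g * k)) <#>\<^bsub>split_orthogonal N\<^esub> K"
  then obtain b' k' where y: "b' \<in> B" "k' \<in> K" "y = b' * (b * g * k) * k'" unfolding double_coset_iff by blast
  have c: "b' \<in> carrier_mat N N" "b \<in> carrier_mat N N" "g \<in> carrier_mat N N" "k \<in> carrier_mat N N" "k' \<in> carrier_mat N N"
    using subgroup.subset[OF B] subgroup.subset[OF K] y g orthD(1) by blast+
  have "y = (b' * b) * g * (k * k')" unfolding y(3) using c by (simp only: sq_mat[where N = N])
  moreover have "b' * b \<in> B" "k * k' \<in> K"
    using subgroup.m_closed[OF B y(1) g(2)] subgroup.m_closed[OF K g(3) y(2)] by simp_all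
  ultimately show "y \<in> (B #>\<^bsub>split_orthogonal N\<^esub> g) <#>\<^bsub>split_orthogonal N\<^esub> K"
    unfolding double_coset_iff by blast
qed

lemma double_coset_eq:
  fixes B K :: "'a :: field mat set"
  assumes B: "subgroup B (split_orthogonal N)" and K: "subgroup K (split_orthogonal N)"
    and g: "g \<in> orth N" "b \<in> B" "k \<in> K"
  shows "(B #>\<^bsub>split_orthogonal N\<^esub> (b * g * k)) <#>\<^bsub>split_orthogonal N\<^esub> K =
    (B #>\<^bsub>split_orthogonal N\<^esub> g) <#>\<^bsub>split_orthogonal N\<^esub> K"
proof
  have bO: "b \<in> orth N" and kO: "k \<in> orth N"
    using subgroup.subset[OF B] subgroup.subset[OF K] g by blast+
  note c = orthD(1)[OF bO] orthD(1)[OF g(1)] orthD(1)[OF kO]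
  have "orth_inv N b * (b * g * k) * orth_inv N k = (orth_inv N b * b) * g * (k * orth_inv N k)"
    using c by (simp only: sq_mat[where N = N] orth_inv_carrier)
  also have "\<dots> = g" using c by (simp add: orth_inv_left[OF bO] orth_inv_right[OF kO] sq_mat(3)[where N = N])
  finally have "g = orth_inv N b * (b * g * k) * orth_inv N k" by simp
  moreover have "orth_inv N b \<in> B" "orth_inv N k \<in> K"
    using subgroup.m_inv_closed[OF B g(2)] subgroup.m_inv_closed[OF K g(3)] bO kO by (simp_all add: split_orthogonal_inv)
  moreover have "b * g * k \<in> orth N" using bO kO g by (simp add: orth_mult)
  ultimately show "(B #>\<^bsub>split_orthogonal N\<^esub> g) <#>\<^bsub>split_orthogonal N\<^esub> K \<subseteq>
      (B #>\<^bsub>split_orthogonal N\<^esub> (b * g * k)) <#>\<^bsub>split_orthogonal N\<^esub> K"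
    using double_coset_subset[OF B K, of "b * g * k" "orth_inv N b" "orth_inv N k"] by simp
qed (rule double_coset_subset[OF assms])

section \<open>The sign matrix and its centralizer\<close>

lemma sign_mat_dmat:
  "sign_mat m n = dmat (2 * m + 2 * n + 1) (\<lambda>i. if i \<in> {i. i < 2 * m + 2 * n + 1 \<and> \<not> is_inner m n i} then - 1 else 1)"
  by (intro eq_matI) (auto simp: sign_mat_def dmat_def)

lemma sign_mat_orth: "(sign_mat m n :: 'a :: field mat) \<in> orth (2 * m + 2 * n + 1)"
  unfolding sign_mat_dmat by (rule dmat_orth) (auto simp: is_inner_def)

lemma sign_mat_invol: "sign_mat m n * sign_mat m n = (1\<^sub>m (2 * m + 2 * n + 1) :: 'a :: field mat)"
proof (rule eq_matI)
  fix i j assume "i < dim_row (1\<^sub>m (2 * m + 2 * n + 1) :: 'a mat)" "j < dim_col (1\<^sub>m (2 * m + 2 * n + 1) :: 'a mat)"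
  hence ij: "i < 2 * m + 2 * n + 1" "j < 2 * m + 2 * n + 1" by simp_all
  show "(sign_mat m n * sign_mat m n) $$ (i, j) = (1\<^sub>m (2 * m + 2 * n + 1) :: 'a mat) $$ (i, j)"
    unfolding sign_mat_dmat dmat_mult_index(1)[OF dmat_carrier ij] using ij by (simp add: dmat_def)
qed (simp_all add: sign_mat_def)

lemma card_outer: "card {i. i < 2 * m + 2 * n + 1 \<and> \<not> is_inner m n i} = 2 * m"
proof -
  have "{i. i < 2 * m + 2 * n + 1 \<and> \<not> is_inner m n i} = {..<m} \<union> {m + 2 * n + 1..<2 * m + 2 * n + 1}"
    by (auto simp: is_inner_def)
  moreover have "card ({..<m} \<union> {m + 2 * n + 1..<2 * m + 2 * n + 1}) = m + m"
    by (subst card_Un_disjoint) auto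
  ultimately show ?thesis by simp
qed

text \<open>As the sign matrix is its own inverse, being fixed under conjugation by it means
  commuting with it. In this form double cosets translate directly into intertwining
  relations.\<close>

lemma product_subgroup_iff:
  assumes two: "(2 :: 'a :: field) \<noteq> 0"
  shows "(k :: 'a mat) \<in> split_orthogonal_product m n \<longleftrightarrow>
    k \<in> orth (2 * m + 2 * n + 1) \<and> sign_mat m n * k = k * sign_mat m n"
proof -
  define N where N: "N = 2 * m + 2 * n + 1"
  let ?s = "sign_mat m n :: 'a mat"
  have s: "?s \<in> carrier_mat N N" "?s * ?s = 1\<^sub>m N"
    using orthD(1)[OF sign_mat_orth[of m n]] sign_mat_invol[of m n] by (simp_all only: N)
  have "?s * k * ?s = k \<longleftrightarrow> ?s * k = k * ?s" if "k \<in> orth N"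
  proof -
    note k = orthD(1)[OF that]
    have 1: "?s * k * ?s * ?s = ?s * k" using k s by (simp add: sq_mat[where N = N])
    have 2: "k * ?s * ?s = k" using k s by (simp add: sq_mat[where N = N])
    show ?thesis using 1 2 by metis
  qed
  thus ?thesis unfolding split_orthogonal_product_symmetric[OF two] N[symmetric] by blast
qed

lemma product_subgroup:
  assumes two: "(2 :: 'a :: field) \<noteq> 0"
  shows "subgroup (split_orthogonal_product m n :: 'a mat set) (split_orthogonal (2 * m + 2 * n + 1))"
proof -
  define N where N: "N = 2 * m + 2 * n + 1"
  let ?s = "sign_mat m n :: 'a mat"
  have s: "?s \<in> carrier_mat N N" using orthD(1)[OF sign_mat_orth[of m n]] by (simp only: N)
  note iff = product_subgroup_iff[OF two, of _ m n, folded N]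
  have "subgroup (split_orthogonal_product m n :: 'a mat set) (split_orthogonal N)"
  proof (rule group.subgroupI[OF split_orthogonal_group])
    have "1\<^sub>m N \<in> (split_orthogonal_product m n :: 'a mat set)"
      unfolding iff using s by (simp add: orth_one sq_mat(3)[where N = N])
    thus "split_orthogonal_product m n \<noteq> ({} :: 'a mat set)" by blast
  next
    fix k :: "'a mat" assume k: "k \<in> split_orthogonal_product m n"
    hence kO: "k \<in> orth N" and comm: "?s * k = k * ?s" by (simp_all add: iff)
    note kc = orthD(1)[OF kO] and ki = orth_inv_carrier[OF orthD(1)[OF kO]]
    have "k * (?s * orth_inv N k) = (?s * k) * orth_inv N k"
      unfolding comm by (rule sq_mat(2)[OF kc s ki, symmetric])
    also have "\<dots> = ?s * (k * orth_inv N k)" by (rule sq_mat(2)[OF s kc ki])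
    also have "\<dots> = (k * orth_inv N k) * ?s"
      unfolding orth_inv_right[OF kO] using s by (simp add: sq_mat(3,4)[where N = N])
    also have "\<dots> = k * (orth_inv N k * ?s)" by (rule sq_mat(2)[OF kc ki s])
    finally have "?s * orth_inv N k = orth_inv N k * ?s"
      by (rule orth_cancel(2)[OF _ _ kO, rotated 2]) (use s ki in \<open>simp_all add: sq_mat\<close>)
    thus "inv\<^bsub>split_orthogonal N\<^esub> k \<in> split_orthogonal_product m n"
      unfolding split_orthogonal_inv[OF kO] iff using orth_inv_orth[OF kO] by simp
  next
    fix k l :: "'a mat" assume "k \<in> split_orthogonal_product m n" "l \<in> split_orthogonal_product m n"
    hence kO: "k \<in> orth N" "l \<in> orth N" and comm: "?s * k = k * ?s" "?s * l = l * ?s" by (simp_all add: iff)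
    note kc = orthD(1)[OF kO(1)] and lc = orthD(1)[OF kO(2)]
    have "?s * (k * l) = (k * ?s) * l" unfolding comm(1)[symmetric] by (rule sq_mat(2)[OF s kc lc, symmetric])
    also have "\<dots> = k * (l * ?s)" unfolding comm(2)[symmetric] by (rule sq_mat(2)[OF kc s lc])
    also have "\<dots> = k * l * ?s" by (rule sq_mat(2)[OF kc lc s, symmetric])
    finally have "?s * (k * l) = k * l * ?s" .
    thus "k \<otimes>\<^bsub>split_orthogonal N\<^esub> l \<in> split_orthogonal_product m n"
      using orth_mult[OF kO] by (simp add: iff)
  qed (simp add: iff subset_iff)
  thus ?thesis by (simp only: N)
qed

text \<open>Both matrices are similar to diagonal matrices of signs, and such matrices are similar
  when they have equally many entries -1: \<open>clan_size\<close> of them on one side,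
  \<open>2 * m\<close> outer positions on the other.\<close>

lemma clan_mat_similar_sign_mat_iff:
  assumes two: "(2 :: 'a :: field) \<noteq> 0" and clan: "is_clan (m + n) w L"
  shows "similar_mat (clan_mat (m + n) w L :: 'a mat) (sign_mat m n) \<longleftrightarrow> clan_size (m + n) w L = 2 * m"
proof -
  have N: "2 * (m + n) + 1 = 2 * m + 2 * n + 1" by simp
  define A where "A = {i. i < 2 * m + 2 * n + 1 \<and> (int i - int (m + n) \<in> L \<or> w (int i - int (m + n)) < int i - int (m + n))}"
  let ?D = "dmat (2 * m + 2 * n + 1) (\<lambda>i. if i \<in> A then - 1 else 1) :: 'a mat"
  have sim: "similar_mat (clan_mat (m + n) w L) ?D" and card: "card A = clan_size (m + n) w L"
    using clan_mat_similar[OF two clan] unfolding N A_def by blast+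
  have "similar_mat (clan_mat (m + n) w L :: 'a mat) (sign_mat m n) \<longleftrightarrow> similar_mat ?D (sign_mat m n)"
    using sim similar_mat_trans similar_mat_sym by blast
  also have "\<dots> \<longleftrightarrow> card A = card {i. i < 2 * m + 2 * n + 1 \<and> \<not> is_inner m n i}"
    unfolding sign_mat_dmat by (rule dmat_sign_similar_iff[OF two]) (auto simp: A_def)
  finally show ?thesis unfolding card card_outer .
qed

lemma two_neq_zero: "CHAR('a :: field) \<noteq> 2 \<Longrightarrow> (2 :: 'a) \<noteq> 0"
proof
  assume "CHAR('a) \<noteq> 2" "(2 :: 'a) = 0"
  hence "of_nat 2 = (0 :: 'a)" by simp
  hence "CHAR('a) dvd 2" by (simp only: of_nat_eq_0_iff_char_dvd)
  hence "CHAR('a) = 1" using \<open>CHAR('a) \<noteq> 2\<close> prime_nat_iff two_is_prime_nat by blast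
  thus False using of_nat_CHAR[where 'a = 'a] by simp
qed

theorem theorem5p11:
  fixes m n :: nat
    and B :: "'a :: alg_closed_field mat set"
  assumes "CHAR('a) \<noteq> 2"
    and "borel_subgroup (2 * m + 2 * n + 1) (split_orthogonal (2 * m + 2 * n + 1)) B"
  shows "\<exists>\<phi>. bij_betw \<phi> (minus_invariant_matchings m n)
    (double_cosets (split_orthogonal (2 * m + 2 * n + 1)) B (split_orthogonal_product m n))"
proof -
  define N where N: "N = 2 * m + 2 * n + 1"
  define r where r: "r = m + n"
  have Nr: "2 * r + 1 = N" by (simp add: N r)
  have two: "(2 :: 'a) \<noteq> 0" by (rule two_neq_zero[OF assms(1)])
  let ?G = "split_orthogonal N :: 'a mat monoid" and ?K = "split_orthogonal_product m n :: 'a mat set"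
  let ?s = "sign_mat m n :: 'a mat"
  let ?DC = "\<lambda>g. (B #>\<^bsub>?G\<^esub> g) <#>\<^bsub>?G\<^esub> ?K"
  obtain g0 where g0: "g0 \<in> orth N" and B: "B = orth_conj N g0 ` std_borel r"
    using borel_is_conjugate[OF two, of r B] assms(2) unfolding Nr N[symmetric] by blast
  have subB: "subgroup B ?G"
    using assms(2) by (simp add: borel_subgroup_def closed_connected_solvable_def N)
  have subK: "subgroup ?K ?G" using product_subgroup[OF two, of m n] by (simp only: N)
  note K = product_subgroup_iff[OF two, of _ m n, folded N]
  have sO: "?s \<in> orth N" "?s * ?s = 1\<^sub>m N" using sign_mat_orth[of m n] sign_mat_invol[of m n] by (simp_all only: N)
  note sc = orthD(1)[OF sO(1)]
  have stdO: "b \<in> orth N" if "b \<in> std_borel r" for b :: "'a mat" using that unfolding std_borel_def Nr by blast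
  let ?C = "{(w, L). is_clan r w L \<and> clan_size r w L = 2 * m}"
  \<comment> \<open>The clan matrix and the sign matrix are similar involutive isometries, so an
    isometry conjugates one into the other. It is determined up to a right factor in
    \<open>K\<close>.\<close>
  have "\<exists>h. h \<in> orth N \<and> clan_mat r (fst c) (snd c) * h = h * ?s" if "c \<in> ?C" for c
  proof -
    have c: "is_clan r (fst c) (snd c)" "clan_size r (fst c) (snd c) = 2 * m" using that by auto
    hence sim: "similar_mat (clan_mat r (fst c) (snd c) :: 'a mat) ?s"
      using clan_mat_similar_sign_mat_iff[OF two, of m n "fst c" "snd c"] by (simp add: r)
    show ?thesis
      using orth_conjugate_of_similar[OF two clan_mat_orth[OF c(1), unfolded Nr] clan_mat_invol[OF c(1), unfolded Nr] sO sim]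
      by blast
  qed
  then obtain hh where "\<forall>c\<in>?C. hh c \<in> orth N \<and> clan_mat r (fst c) (snd c) * hh c = hh c * ?s"
    using bchoice[of ?C "\<lambda>c h. h \<in> orth N \<and> clan_mat r (fst c) (snd c) * h = h * ?s"] by blast
  hence hh: "\<And>c. c \<in> ?C \<Longrightarrow> hh c \<in> orth N" "\<And>c. c \<in> ?C \<Longrightarrow> clan_mat r (fst c) (snd c) * hh c = hh c * ?s"
    by blast+
  have cosets: "double_cosets ?G B ?K = ?DC ` orth N" by (auto simp: double_cosets_def)
  \<comment> \<open>The factor \<open>g0\<close> accounts for \<open>B\<close> being a conjugate of
    \<open>std_borel r\<close> rather than that group itself.\<close>
  have "bij_betw (\<lambda>c. ?DC (g0 * hh c)) ?C (double_cosets ?G B ?K)"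
    unfolding bij_betw_def
  proof (intro conjI inj_onI)
    fix c c' assume c: "c \<in> ?C" and c': "c' \<in> ?C" and eq: "?DC (g0 * hh c) = ?DC (g0 * hh c')"
    let ?M = "clan_mat r (fst c) (snd c) :: 'a mat" and ?M' = "clan_mat r (fst c') (snd c') :: 'a mat"
    have Mc: "?M \<in> carrier_mat N N" "?M' \<in> carrier_mat N N" using clan_mat_carrier[of r, unfolded Nr] by blast+
    note hO = hh(1)[OF c] hh(1)[OF c']
    note gc = orthD(1)[OF g0] and hc = orthD(1)[OF hO(1)] and hc' = orthD(1)[OF hO(2)]
    have "1\<^sub>m N \<in> B" "1\<^sub>m N \<in> ?K" using subgroup.one_closed[OF subB] subgroup.one_closed[OF subK] by simp_all
    moreover have "g0 * hh c' = 1\<^sub>m N * (g0 * hh c') * 1\<^sub>m N" using gc hc' by (simp add: sq_mat[where N = N])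
    ultimately have "g0 * hh c' \<in> ?DC (g0 * hh c')" unfolding double_coset_iff by blast
    then obtain b' k where k: "b' \<in> B" "k \<in> ?K" "g0 * hh c' = b' * (g0 * hh c) * k"
      unfolding eq[symmetric] double_coset_iff by blast
    obtain b where b: "b \<in> std_borel r" "b' = orth_conj N g0 b" using k(1) by (auto simp: B)
    note bc = orthD(1)[OF stdO[OF b(1)]]
    have kO: "k \<in> orth N" and comm: "?s * k = k * ?s" using k(2) by (simp_all add: K)
    note kc = orthD(1)[OF kO]
    have "g0 * hh c' = g0 * b * (orth_inv N g0 * g0) * hh c * k"
      unfolding k(3) b(2) orth_conj_def using gc bc hc kc by (simp only: sq_mat[where N = N] orth_inv_carrier)
    also have "\<dots> = g0 * (b * (hh c * k))"
      unfolding orth_inv_left[OF g0] using gc bc hc kc by (simp add: sq_mat[where N = N])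
    finally have h': "hh c' = b * (hh c * k)"
      by (rule orth_cancel(2)[OF _ _ g0, rotated 2]) (use bc hc kc hc' in \<open>simp_all add: sq_mat\<close>)
    \<comment> \<open>Since \<open>hh c\<close> and \<open>hh c'\<close> conjugate the sign matrix
      to the two clan matrices and \<open>k\<close> commutes with it, \<open>b\<close> intertwines
      the clan matrices, and uniqueness of the normal form applies.\<close>
    have "(?M' * b) * (hh c * k) = ?M' * hh c'"
      unfolding h' using Mc bc hc kc by (simp only: sq_mat[where N = N])
    also have "\<dots> = hh c' * ?s" by (rule hh(2)[OF c'])
    also have "\<dots> = b * (hh c * (k * ?s))"
      unfolding h' using bc hc kc sc by (simp only: sq_mat[where N = N])
    also have "\<dots> = b * ((hh c * ?s) * k)"
      unfolding comm[symmetric] using hc kc sc by (simp only: sq_mat[where N = N])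
    also have "\<dots> = (b * ?M) * (hh c * k)"
      unfolding hh(2)[OF c, symmetric] using Mc bc hc kc by (simp only: sq_mat[where N = N])
    finally have "?M' * b = b * ?M"
      by (rule orth_cancel(1)[OF _ _ orth_mult[OF hO(1) kO], rotated 2]) (use Mc bc in \<open>simp_all add: sq_mat\<close>)
    hence "fst c = fst c'" "snd c = snd c'"
      using clan_mat_unique[OF two _ _ b(1), of "fst c" "snd c" "fst c'" "snd c'"] c c' by auto
    thus "c = c'" by (simp add: prod_eq_iff)
  next
    show "(\<lambda>c. ?DC (g0 * hh c)) ` ?C = double_cosets ?G B ?K"
      unfolding cosets
    proof (intro equalityI subsetI)
      fix X assume "X \<in> (\<lambda>c. ?DC (g0 * hh c)) ` ?C"
      thus "X \<in> ?DC ` orth N" using hh(1) orth_mult[OF g0] by blast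
    next
      fix X assume "X \<in> ?DC ` orth N"
      then obtain g where g: "g \<in> orth N" "X = ?DC g" by blast
      define x where "x = orth_inv N g0 * g"
      have xO: "x \<in> orth N" using g g0 by (simp add: x_def orth_mult orth_inv_orth)
      note gc = orthD(1)[OF g(1)] and g0c = orthD(1)[OF g0] and xc = orthD(1)[OF xO]
      have gx: "g = g0 * x"
      proof -
        have "g0 * x = (g0 * orth_inv N g0) * g"
          unfolding x_def by (rule sq_mat(2)[symmetric]) (use gc g0c in simp_all)
        thus ?thesis using gc by (simp add: orth_inv_right[OF g0])
      qed
      \<comment> \<open>The involution that represents the coset of \<open>x\<close> modulo
        \<open>K\<close>; its normal form names the clan of the double coset.\<close>
      define S where "S = orth_conj N x ?s"
      have SO: "S \<in> orth N" unfolding S_def by (rule orth_conj_closed[OF xO sO(1)])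
      note Sc = orthD(1)[OF SO]
      have Sx: "S * x = x * ?s"
      proof -
        have "S * x = x * ?s * (orth_inv N x * x)"
          unfolding S_def orth_conj_def by (rule sq_mat(2)) (use xc sc in \<open>simp_all add: sq_mat\<close>)
        thus ?thesis using xc sc by (simp add: orth_inv_left[OF xO] sq_mat[where N = N])
      qed
      have "S * S * x = 1\<^sub>m N * x"
      proof -
        have "S * S * x = S * (x * ?s)" by (simp only: sq_mat(2)[OF Sc Sc xc] Sx)
        also have "\<dots> = S * x * ?s" by (rule sq_mat(2)[OF Sc xc sc, symmetric])
        also have "\<dots> = (x * ?s) * ?s" by (simp only: Sx)
        also have "\<dots> = x * (?s * ?s)" by (rule sq_mat(2)[OF xc sc sc])
        finally have "S * S * x = x * (?s * ?s)" .
        thus ?thesis using xc by (simp add: sO(2))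
      qed
      hence SS: "S * S = 1\<^sub>m N"
        by (rule orth_cancel(1)[OF _ _ xO, rotated 2]) (use Sc in \<open>simp_all add: sq_mat\<close>)
      obtain b w L where b: "b \<in> std_borel r" and clan: "is_clan r w L" and nf: "S * b = b * clan_mat r w L"
        using clan_normal_form[OF two, of S r] SO SS unfolding Nr by blast
      have bO: "b \<in> orth N" by (rule stdO[OF b])
      note bc = orthD(1)[OF bO]
      let ?M = "clan_mat r w L :: 'a mat"
      have Mc: "?M \<in> carrier_mat N N" using clan_mat_carrier[of r w L, unfolded Nr] .
      have "similar_mat S ?M"
        by (rule similar_mat_intertwineI[OF Sc Mc bc orth_inv_carrier[OF bc] orth_inv_left[OF bO] nf])
      moreover have "similar_mat S ?s"
        by (rule similar_mat_intertwineI[OF Sc sc xc orth_inv_carrier[OF xc] orth_inv_left[OF xO] Sx])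
      ultimately have "similar_mat ?M ?s" using similar_mat_trans similar_mat_sym by blast
      hence c: "(w, L) \<in> ?C"
        using clan clan_mat_similar_sign_mat_iff[OF two, of m n w L] by (simp add: r)
      define h where "h = hh (w, L)"
      have hO: "h \<in> orth N" and h: "?M * h = h * ?s" using hh(1)[OF c] hh(2)[OF c] by (simp_all add: h_def)
      note hc = orthD(1)[OF hO]
      have bhO: "b * h \<in> orth N" by (rule orth_mult[OF bO hO])
      note bhc = orthD(1)[OF bhO]
      have "S * (b * h) = (b * ?M) * h" unfolding nf[symmetric] by (rule sq_mat(2)[OF Sc bc hc, symmetric])
      also have "\<dots> = b * (h * ?s)" unfolding h[symmetric] by (rule sq_mat(2)[OF bc Mc hc])
      also have "\<dots> = b * h * ?s" by (rule sq_mat(2)[OF bc hc sc, symmetric])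
      finally have Sbh: "S * (b * h) = b * h * ?s" .
      \<comment> \<open>Both \<open>b * h\<close> and \<open>x\<close> conjugate the sign matrix to
        \<open>S\<close>, so their quotient centralizes it and belongs to \<open>K\<close>.\<close>
      define k where "k = orth_inv N (b * h) * x"
      have kO: "k \<in> orth N" using bhO xO by (simp add: k_def orth_mult orth_inv_orth)
      note kc = orthD(1)[OF kO]
      have bhk: "b * h * k = x"
      proof -
        have "b * h * k = (b * h * orth_inv N (b * h)) * x"
          unfolding k_def by (rule sq_mat(2)[symmetric]) (use bhc xc in simp_all)
        thus ?thesis using xc by (simp add: orth_inv_right[OF bhO])
      qed
      have "(b * h) * (?s * k) = (b * h) * (k * ?s)"
      proof -
        have "(b * h) * (?s * k) = S * (b * h) * k" unfolding Sbh by (rule sq_mat(2)[symmetric, OF bhc sc kc])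
        also have "\<dots> = S * x" unfolding sq_mat(2)[OF Sc bhc kc] bhk ..
        also have "\<dots> = (b * h) * (k * ?s)"
          unfolding Sx by (subst bhk[symmetric]) (rule sq_mat(2)[OF bhc kc sc])
        finally show ?thesis .
      qed
      hence "?s * k = k * ?s"
        by (rule orth_cancel(2)[OF _ _ bhO, rotated 2]) (use kc sc in \<open>simp_all add: sq_mat\<close>)
      hence kK: "k \<in> ?K" using kO by (simp add: K)
      have "g = orth_conj N g0 b * (g0 * h) * k"
      proof -
        have "orth_conj N g0 b * (g0 * h) * k = g0 * b * ((orth_inv N g0 * g0) * (h * k))"
          unfolding orth_conj_def using g0c bc hc kc by (simp only: sq_mat[where N = N] orth_inv_carrier)
        also have "\<dots> = g0 * (b * h * k)"
          unfolding orth_inv_left[OF g0] using g0c bc hc kc by (simp add: sq_mat[where N = N])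
        finally show ?thesis unfolding bhk gx ..
      qed
      moreover have "orth_conj N g0 b \<in> B" using b by (simp add: B)
      ultimately have "X = ?DC (g0 * h)"
        using double_coset_eq[OF subB subK orth_mult[OF g0 hO] _ kK] g(2) by simp
      thus "X \<in> (\<lambda>c. ?DC (g0 * hh c)) ` ?C" using c h_def by blast
    qed
  qed
  moreover have "bij_betw (inv_into ?C (\<lambda>(w, L). clan_edges r w L)) (minus_invariant_matchings m n) ?C"
    using bij_betw_inv_into[OF clans_bij_matchings[of m n]] by (simp only: r)
  ultimately have "bij_betw ((\<lambda>c. ?DC (g0 * hh c)) \<circ> inv_into ?C (\<lambda>(w, L). clan_edges r w L))
      (minus_invariant_matchings m n) (double_cosets ?G B ?K)"
    using bij_betw_trans by blast
  thus ?thesis unfolding N by blast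
qed

end
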